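(* Let $E\subset\mathbb{R}$ be a measurable set with $\operatorname{mes}E>0$ satisfying the condition $$\sum_{j\in\mathbb{Z}}(\operatorname{mes}E_j)^{1/2}<\infty,\qquad\text{where } E_j=E\cap[j-1/2,\,j+1/2],\quad j\in\mathbb{Z}.$$ Then the truncated Fourier operator $\mathscr{F}_E$ is a trace class operator in $L^2(E)$.
   Context: $\operatorname{mes}$ denotes Lebesgue measure on $\mathbb{R}$; $L^2(E)$ is the complex Hilbert space of square-integrable functions on $E$. The truncated Fourier operator $\mathscr{F}_E:L^2(E)\to L^2(E)$ is $(\mathscr{F}_Ex)(t)=\frac{1}{\sqrt{2\pi}}\int_E e^{it\xi}x(\xi)\,d\xi$, $t\in E$; in general the integral is understood in the Fourier–Plancherel sense, i.e. $\mathscr{F}_Ex$ is the restriction to $E$ of the $L^2(\mathbb{R})$ Fourier–Plancherel transform (the unitary extension of $x\mapsto\frac{1}{\sqrt{2\pi}}\int_{\mathbb{R}}e^{it\xi}x(\xi)\,d\xi$) of $x$ extended by zero outside $E$. *)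

theory Defs
  imports "HOL-Analysis.Analysis"
begin

text \<open>
  Elements of \<open>L\<^sup>2(M)\<close> are represented by square-integrable functions; functions that agree
  almost everywhere represent the same element, so every identity between elements
  is stated almost everywhere.
\<close>

definition L2_space :: "'a measure \<Rightarrow> ('a \<Rightarrow> complex) set" where
  "L2_space M = {f \<in> borel_measurable M. integrable M (\<lambda>x. (cmod (f x))\<^sup>2)}"

definition L2_inner :: "'a measure \<Rightarrow> ('a \<Rightarrow> complex) \<Rightarrow> ('a \<Rightarrow> complex) \<Rightarrow> complex" where
  "L2_inner M f g = (LINT x|M. f x * cnj (g x))"

definition L2_norm :: "'a measure \<Rightarrow> ('a \<Rightarrow> complex) \<Rightarrow> real" where
  "L2_norm M f = sqrt (LINT x|M. (cmod (f x))\<^sup>2)"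

text \<open>
  Bounded linear operators on \<open>L\<^sup>2(M)\<close>. Linearity and boundedness together force \<open>T\<close> to respect
  almost-everywhere equality. The values of \<open>T\<close> outside \<open>L2_space M\<close> are irrelevant.
\<close>

definition L2_operator :: "'a measure \<Rightarrow> (('a \<Rightarrow> complex) \<Rightarrow> 'a \<Rightarrow> complex) \<Rightarrow> bool" where
  "L2_operator M T \<longleftrightarrow>
     (\<forall>f\<in>L2_space M. T f \<in> L2_space M) \<and>
     (\<forall>f\<in>L2_space M. \<forall>g\<in>L2_space M. \<forall>a b.
        AE x in M. T (\<lambda>y. a * f y + b * g y) x = a * T f x + b * T g x) \<and>
     (\<exists>C. \<forall>f\<in>L2_space M. L2_norm M (T f) \<le> C * L2_norm M f)"

definition L2_unitary :: "'a measure \<Rightarrow> (('a \<Rightarrow> complex) \<Rightarrow> 'a \<Rightarrow> complex) \<Rightarrow> bool" where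
  "L2_unitary M U \<longleftrightarrow>
     L2_operator M U \<and>
     (\<forall>f\<in>L2_space M. \<forall>g\<in>L2_space M. L2_inner M (U f) (U g) = L2_inner M f g) \<and>
     (\<forall>g\<in>L2_space M. \<exists>f\<in>L2_space M. AE x in M. U f x = g x)"

definition L2_adjoint ::
  "'a measure \<Rightarrow> (('a \<Rightarrow> complex) \<Rightarrow> 'a \<Rightarrow> complex) \<Rightarrow> (('a \<Rightarrow> complex) \<Rightarrow> 'a \<Rightarrow> complex) \<Rightarrow> bool" where
  "L2_adjoint M T S \<longleftrightarrow>
     L2_operator M S \<and>
     (\<forall>f\<in>L2_space M. \<forall>g\<in>L2_space M. L2_inner M (T f) g = L2_inner M f (S g))"

definition L2_positive :: "'a measure \<Rightarrow> (('a \<Rightarrow> complex) \<Rightarrow> 'a \<Rightarrow> complex) \<Rightarrow> bool" where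
  "L2_positive M P \<longleftrightarrow>
     L2_operator M P \<and> (\<forall>f\<in>L2_space M. L2_inner M (P f) f \<in> \<real>\<^sub>\<ge>\<^sub>0)"

text \<open>\<open>L2_abs M T P\<close>: \<open>P\<close> is the modulus \<open>|T|\<close>, the positive square root of \<open>T\<^sup>*T\<close>.\<close>

definition L2_abs ::
  "'a measure \<Rightarrow> (('a \<Rightarrow> complex) \<Rightarrow> 'a \<Rightarrow> complex) \<Rightarrow> (('a \<Rightarrow> complex) \<Rightarrow> 'a \<Rightarrow> complex) \<Rightarrow> bool" where
  "L2_abs M T P \<longleftrightarrow>
     L2_positive M P \<and>
     (\<exists>S. L2_adjoint M T S \<and> (\<forall>f\<in>L2_space M. AE x in M. P (P f) x = S (T f) x))"

text \<open>Orthonormality makes distinct members of \<open>B\<close> represent distinct elements of \<open>L\<^sup>2(M)\<close>.\<close>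

definition L2_orthonormal_basis :: "'a measure \<Rightarrow> ('a \<Rightarrow> complex) set \<Rightarrow> bool" where
  "L2_orthonormal_basis M B \<longleftrightarrow>
     B \<subseteq> L2_space M \<and>
     (\<forall>e\<in>B. \<forall>e'\<in>B. L2_inner M e e' = (if e = e' then 1 else 0)) \<and>
     (\<forall>f\<in>L2_space M. (\<forall>e\<in>B. L2_inner M f e = 0) \<longrightarrow> (AE x in M. f x = 0))"

text \<open>
  \<open>T\<close> is of trace class if \<open>|T|\<close> has finite trace. The trace of a positive operator
  does not depend on the orthonormal basis, so one basis suffices.
\<close>

definition L2_trace_class :: "'a measure \<Rightarrow> (('a \<Rightarrow> complex) \<Rightarrow> 'a \<Rightarrow> complex) \<Rightarrow> bool" where
  "L2_trace_class M T \<longleftrightarrow>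
     L2_operator M T \<and>
     (\<exists>P B. L2_abs M T P \<and> L2_orthonormal_basis M B \<and>
        (\<lambda>e. L2_inner M (P e) e) summable_on B)"

definition fourier_integral :: "(real \<Rightarrow> complex) \<Rightarrow> real \<Rightarrow> complex" where
  "fourier_integral x t =
     complex_of_real (1 / sqrt (2 * pi)) *
     (LINT \<xi>|lebesgue. exp (\<i> * complex_of_real (t * \<xi>)) * x \<xi>)"

text \<open>
  The Fourier-Plancherel transform is unique up to almost-everywhere equality of its values,
  since \<open>L\<^sup>1 \<inter> L\<^sup>2\<close> is dense in \<open>L\<^sup>2\<close>; the choice operator merely picks representatives.
\<close>

definition is_fourier_plancherel :: "((real \<Rightarrow> complex) \<Rightarrow> real \<Rightarrow> complex) \<Rightarrow> bool" where
  "is_fourier_plancherel U \<longleftrightarrow>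
     L2_unitary lebesgue U \<and>
     (\<forall>x\<in>L2_space lebesgue. integrable lebesgue x \<longrightarrow>
        (AE t in lebesgue. U x t = fourier_integral x t))"

definition fourier_plancherel :: "(real \<Rightarrow> complex) \<Rightarrow> real \<Rightarrow> complex" where
  "fourier_plancherel = (SOME U. is_fourier_plancherel U)"

text \<open>
  To be read as an operator on \<open>L\<^sup>2(E)\<close>, i.e. on \<open>L2_space (lebesgue_on E)\<close>: only the values
  for \<open>t \<in> E\<close> matter, which is the restriction to \<open>E\<close>.
\<close>

definition truncated_fourier :: "real set \<Rightarrow> (real \<Rightarrow> complex) \<Rightarrow> real \<Rightarrow> complex" where
  "truncated_fourier E x = fourier_plancherel (\<lambda>\<xi>. if \<xi> \<in> E then x \<xi> else 0)"

end

theory Submission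
  imports Defs "HOL-Probability.Probability" "HOL-Complex_Analysis.Great_Picard"
begin

text \<open>
  The condition forces \<open>mes E < \<infinity>\<close>, so on \<open>L\<^sup>2(E)\<close> the operator has the kernel \<open>exp (i t x)\<close> up to a
  constant. For \<open>t\<close> near \<open>k\<close> and \<open>x\<close> near \<open>j\<close> the Taylor expansion of \<open>exp (i (t - k) (x - j))\<close> writes
  the kernel as a sum, over triples \<open>(j, k, n)\<close>, of rank one kernels \<open>u\<^sub>i \<otimes> v\<^sub>i\<close> with
  \<open>\<parallel>u\<^sub>i\<parallel> \<parallel>v\<^sub>i\<parallel> \<le> (mes E\<^sub>j)\<^bsup>1/2\<^esup> (mes E\<^sub>k)\<^bsup>1/2\<^esup> / n!\<close>, which is summable.

  Such a nuclear operator \<open>T\<close> is compact, and \<open>T\<^sup>*T\<close> has an orthonormal basis of eigenvectors \<open>e\<close>. In this basis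
  \<open>|T|\<close> is diagonal with entries \<open>\<parallel>T e\<parallel>\<close>. Since \<open>\<parallel>T e\<parallel> = \<langle>T e, g\<^sub>e\<rangle>\<close> with \<open>g\<^sub>e = T e / \<parallel>T e\<parallel>\<close> orthonormal,
  Bessel's inequality bounds the trace of \<open>|T|\<close> by \<open>\<Sum>\<^sub>i \<parallel>u\<^sub>i\<parallel> \<parallel>v\<^sub>i\<parallel>\<close>.

  The Fourier--Plancherel transform is obtained by extending the Fourier integral, a contraction on
  \<open>L\<^sup>1 \<inter> L\<^sup>2\<close>; it is unitary because it is inverted by its conjugate on modulated Gaussians.
\<close>

section \<open>Square-integrable functions\<close>

text \<open>Trace class is a condition on \<open>|T|\<close>, so the modulus has to be exhibited
  together with a basis; both come from diagonalizing, which is why compactness and eigenvectors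
  enter. Elements of the space are functions, not classes, and several operators are built from
  chosen representatives. Their properties are therefore proved weakly, by inner products against
  all test functions, and then turned into almost everywhere statements. The exponent 1/2 in the
  hypothesis is that of the L2 norm of the indicator of a cell. With cells of length 1 the Taylor
  variable \<open>(t - k) * (x - j)\<close> is at most 1/4 in modulus, so its powers cost nothing,
  and the sum of the norms over all triples is at most the product of the sums over
  \<open>j\<close>, over \<open>k\<close> and of the exponential series. The remaining phases have
  modulus 1 and leave the norms unchanged. \<open>fourier_plancherel\<close> is a choice, about
  which nothing can be said before some operator meeting its specification has been constructed;
  this accounts for the long Fourier part.\<close>

lemma L2_spaceD:
  assumes "f \<in> L2_space M"
  shows "f \<in> borel_measurable M" "integrable M (\<lambda>x. (cmod (f x))\<^sup>2)"
  using assms by (auto simp: L2_space_def)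

lemma L2_spaceI:
  assumes "f \<in> borel_measurable M" "integrable M (\<lambda>x. (cmod (f x))\<^sup>2)"
  shows "f \<in> L2_space M"
  using assms by (auto simp: L2_space_def)

lemma borel_measurable_cnj [measurable (raw)]:
  "f \<in> borel_measurable M \<Longrightarrow> (\<lambda>x. cnj (f x)) \<in> borel_measurable M"
  by (rule borel_measurable_continuous_on[OF continuous_on_cnj[OF continuous_on_id]])

lemma mult_le_sum_squares: "a * b \<le> (a\<^sup>2 + b\<^sup>2) / 2" for a b :: real
  using sum_squares_bound[of a b] by simp

lemma L2_integrable_norm_mult:
  assumes "f \<in> L2_space M" "g \<in> L2_space M"
  shows "integrable M (\<lambda>x. cmod (f x) * cmod (g x))"
proof (rule Bochner_Integration.integrable_bound)
  note [measurable] = L2_spaceD(1)[OF assms(1)] L2_spaceD(1)[OF assms(2)]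
  show "integrable M (\<lambda>x. ((cmod (f x))\<^sup>2 + (cmod (g x))\<^sup>2) / 2)"
    using assms[THEN L2_spaceD(2)] by simp
  show "(\<lambda>x. cmod (f x) * cmod (g x)) \<in> borel_measurable M" by measurable
  show "AE x in M. norm (cmod (f x) * cmod (g x)) \<le> norm (((cmod (f x))\<^sup>2 + (cmod (g x))\<^sup>2) / 2)"
    using mult_le_sum_squares by (auto simp: abs_mult)
qed

lemma L2_integrable_mult_cnj:
  assumes "f \<in> L2_space M" "g \<in> L2_space M"
  shows "integrable M (\<lambda>x. f x * cnj (g x))"
proof (rule Bochner_Integration.integrable_bound[OF L2_integrable_norm_mult[OF assms]])
  note [measurable] = L2_spaceD(1)[OF assms(1)] L2_spaceD(1)[OF assms(2)]
  show "(\<lambda>x. f x * cnj (g x)) \<in> borel_measurable M" by measurable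
qed (auto simp: norm_mult)

lemma L2_space_zero [simp]: "(\<lambda>x. 0) \<in> L2_space M"
  by (auto simp: L2_space_def)

lemma L2_space_scale:
  assumes "f \<in> L2_space M"
  shows "(\<lambda>x. c * f x) \<in> L2_space M"
  using assms by (auto simp: L2_space_def norm_mult power_mult_distrib)

lemma L2_space_add:
  assumes "f \<in> L2_space M" "g \<in> L2_space M"
  shows "(\<lambda>x. f x + g x) \<in> L2_space M"
proof (rule L2_spaceI)
  note [measurable] = L2_spaceD(1)[OF assms(1)] L2_spaceD(1)[OF assms(2)]
  show "(\<lambda>x. f x + g x) \<in> borel_measurable M" by measurable
  show "integrable M (\<lambda>x. (cmod (f x + g x))\<^sup>2)"
  proof (rule Bochner_Integration.integrable_bound)
    show "integrable M (\<lambda>x. 2 * (cmod (f x))\<^sup>2 + 2 * (cmod (g x))\<^sup>2)"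
      using assms[THEN L2_spaceD(2)] by simp
    have "(cmod (a + b))\<^sup>2 \<le> 2 * (cmod a)\<^sup>2 + 2 * (cmod b)\<^sup>2" for a b :: complex
    proof -
      have "(cmod (a + b))\<^sup>2 \<le> (cmod a + cmod b)\<^sup>2"
        by (intro power_mono norm_triangle_ineq) auto
      also have "\<dots> \<le> 2 * (cmod a)\<^sup>2 + 2 * (cmod b)\<^sup>2"
        using mult_le_sum_squares[of "cmod a" "cmod b"] by (simp add: power2_sum)
      finally show ?thesis .
    qed
    then show "AE x in M. norm ((cmod (f x + g x))\<^sup>2) \<le> norm (2 * (cmod (f x))\<^sup>2 + 2 * (cmod (g x))\<^sup>2)"
      by auto
  qed measurable
qed

lemma L2_space_uminus:
  "f \<in> L2_space M \<Longrightarrow> (\<lambda>x. - f x) \<in> L2_space M"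
  by (auto simp: L2_space_def)

lemma L2_space_diff:
  assumes "f \<in> L2_space M" "g \<in> L2_space M"
  shows "(\<lambda>x. f x - g x) \<in> L2_space M"
  using L2_space_add[OF assms(1) L2_space_uminus[OF assms(2)]] by simp

lemma L2_space_cnj:
  "f \<in> L2_space M \<Longrightarrow> (\<lambda>x. cnj (f x)) \<in> L2_space M"
  by (auto simp: L2_space_def)

lemmas L2_space_intros = L2_space_scale L2_space_add L2_space_diff L2_space_uminus L2_space_cnj

lemma L2_space_sum:
  assumes "\<And>i. i \<in> F \<Longrightarrow> f i \<in> L2_space M"
  shows "(\<lambda>x. \<Sum>i\<in>F. f i x) \<in> L2_space M"
  using assms by (induction F rule: infinite_finite_induct) (auto intro: L2_space_add)

section \<open>Inner product and norm\<close>

lemma L2_inner_add_left: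
  assumes "f \<in> L2_space M" "g \<in> L2_space M" "h \<in> L2_space M"
  shows "L2_inner M (\<lambda>x. f x + g x) h = L2_inner M f h + L2_inner M g h"
  using assms by (simp add: L2_inner_def algebra_simps Bochner_Integration.integral_add L2_integrable_mult_cnj)

lemma L2_inner_scale_left: "L2_inner M (\<lambda>x. c * f x) h = c * L2_inner M f h"
  by (simp add: L2_inner_def algebra_simps)

lemma L2_inner_cnj: "cnj (L2_inner M f g) = L2_inner M g f"
  unfolding L2_inner_def by (subst Bochner_Integration.integral_cnj[symmetric]) (simp add: mult.commute)

lemma L2_inner_diff_left:
  assumes "f \<in> L2_space M" "g \<in> L2_space M" "h \<in> L2_space M"
  shows "L2_inner M (\<lambda>x. f x - g x) h = L2_inner M f h - L2_inner M g h"
  using assms by (simp add: L2_inner_def algebra_simps Bochner_Integration.integral_diff L2_integrable_mult_cnj)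

lemma L2_inner_sum_left:
  assumes "\<And>i. i \<in> F \<Longrightarrow> f i \<in> L2_space M" "h \<in> L2_space M"
  shows "L2_inner M (\<lambda>x. \<Sum>i\<in>F. f i x) h = (\<Sum>i\<in>F. L2_inner M (f i) h)"
  using assms by (simp add: L2_inner_def sum_distrib_right Bochner_Integration.integral_sum L2_integrable_mult_cnj)

lemma L2_inner_scale_right: "L2_inner M f (\<lambda>x. c * h x) = cnj c * L2_inner M f h"
  by (subst (1 2) L2_inner_cnj[symmetric]) (simp add: L2_inner_scale_left)

lemma L2_inner_diff_right:
  assumes "f \<in> L2_space M" "g \<in> L2_space M" "h \<in> L2_space M"
  shows "L2_inner M h (\<lambda>x. f x - g x) = L2_inner M h f - L2_inner M h g"
  using assms by (subst (1 2 3) L2_inner_cnj[symmetric]) (simp add: L2_inner_diff_left)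

lemma L2_inner_cong_AE:
  assumes "f \<in> L2_space M" "f' \<in> L2_space M" "g \<in> L2_space M" "g' \<in> L2_space M"
    and "AE x in M. f x = f' x" "AE x in M. g x = g' x"
  shows "L2_inner M f g = L2_inner M f' g'"
  unfolding L2_inner_def
  using assms(5,6) L2_integrable_mult_cnj[OF assms(1,3)] L2_integrable_mult_cnj[OF assms(2,4)]
  by (intro integral_cong_AE) (auto simp: borel_measurable_integrable)

lemma L2_norm_nonneg [simp]: "L2_norm M f \<ge> 0"
  by (simp add: L2_norm_def)

lemma L2_norm_square: "(L2_norm M f)\<^sup>2 = (LINT x|M. (cmod (f x))\<^sup>2)"
  by (simp add: L2_norm_def)

lemma L2_inner_self: "L2_inner M f f = complex_of_real ((L2_norm M f)\<^sup>2)"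
  unfolding L2_norm_square L2_inner_def
  by (subst integral_complex_of_real[symmetric]) (simp add: complex_mult_cnj cmod_def)

lemma L2_norm_cong_AE:
  assumes "f \<in> L2_space M" "g \<in> L2_space M" "AE x in M. f x = g x"
  shows "L2_norm M f = L2_norm M g"
  unfolding L2_norm_def using assms
  by (intro arg_cong[where f = sqrt] integral_cong_AE) (auto dest: L2_spaceD(1))

lemma L2_norm_scale: "L2_norm M (\<lambda>x. c * f x) = cmod c * L2_norm M f"
  by (simp add: L2_norm_def norm_mult power_mult_distrib real_sqrt_mult)

lemma L2_norm_eq_0_iff:
  assumes "f \<in> L2_space M"
  shows "L2_norm M f = 0 \<longleftrightarrow> (AE x in M. f x = 0)"
  using integral_nonneg_eq_0_iff_AE[OF L2_spaceD(2)[OF assms]] by (simp add: L2_norm_def)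

lemma L2_norm_diff_square:
  assumes "f \<in> L2_space M" "g \<in> L2_space M"
  shows "(L2_norm M (\<lambda>x. f x - g x))\<^sup>2 = (L2_norm M f)\<^sup>2 - 2 * Re (L2_inner M f g) + (L2_norm M g)\<^sup>2"
proof -
  have "complex_of_real ((L2_norm M (\<lambda>x. f x - g x))\<^sup>2)
      = L2_inner M f f - L2_inner M f g - L2_inner M g f + L2_inner M g g"
    unfolding L2_inner_self[symmetric] using assms
    by (simp add: L2_inner_diff_left L2_inner_diff_right L2_space_diff)
  then have "Re (complex_of_real ((L2_norm M (\<lambda>x. f x - g x))\<^sup>2))
      = Re (L2_inner M f f - L2_inner M f g - L2_inner M g f + L2_inner M g g)" by simp
  moreover have "Re (L2_inner M g f) = Re (L2_inner M f g)"
    by (subst L2_inner_cnj[symmetric]) simp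
  ultimately show ?thesis by (simp add: L2_inner_self)
qed

lemma L2_Cauchy_Schwarz:
  assumes f: "f \<in> L2_space M" and g: "g \<in> L2_space M"
  shows "cmod (L2_inner M f g) \<le> L2_norm M f * L2_norm M g"
proof (cases "L2_norm M g = 0")
  case True
  then have "AE x in M. g x = 0" using L2_norm_eq_0_iff g by blast
  then have "L2_inner M f g = L2_inner M f (\<lambda>x. 0)" by (intro L2_inner_cong_AE f g) auto
  then show ?thesis by (simp add: L2_inner_def)
next
  case False
  \<comment> \<open>The orthogonal projection of \<open>f\<close> onto the line through
    \<open>g\<close> is \<open>c * g\<close>; that the remainder has nonnegative squared norm is the
    inequality.\<close>
  define c where "c = L2_inner M f g / (L2_norm M g)\<^sup>2"
  have "0 \<le> (L2_norm M (\<lambda>x. f x - c * g x))\<^sup>2" by simp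
  also have "\<dots> = (L2_norm M f)\<^sup>2 - 2 * Re (cnj c * L2_inner M f g) + (cmod c * L2_norm M g)\<^sup>2"
    using f g by (simp add: L2_norm_diff_square L2_space_scale L2_inner_scale_right L2_norm_scale)
  also have "cnj c * L2_inner M f g = complex_of_real ((cmod (L2_inner M f g))\<^sup>2 / (L2_norm M g)\<^sup>2)"
    by (simp add: c_def complex_norm_square[symmetric] mult.commute)
  also have "(cmod c * L2_norm M g)\<^sup>2 = (cmod (L2_inner M f g))\<^sup>2 / (L2_norm M g)\<^sup>2"
    using False unfolding c_def norm_divide norm_of_real
    by (simp add: power_divide power_mult_distrib) (simp add: field_simps power2_eq_square power4_eq_xxxx)
  finally have "(cmod (L2_inner M f g))\<^sup>2 / (L2_norm M g)\<^sup>2 \<le> (L2_norm M f)\<^sup>2" by simp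
  then have "(cmod (L2_inner M f g))\<^sup>2 \<le> (L2_norm M f * L2_norm M g)\<^sup>2"
    using False by (simp add: field_simps power_mult_distrib)
  then show ?thesis by (rule power2_le_imp_le) simp
qed

text \<open>Cauchy-Schwarz for the moduli: interchanging sums and integrals requires a bound on the
  integral of the absolute value, not only on the absolute value of the integral.\<close>

lemma L2_integral_norm_mult_le:
  assumes f: "f \<in> L2_space M" and g: "g \<in> L2_space M"
  shows "(LINT x|M. cmod (f x) * cmod (g x)) \<le> L2_norm M f * L2_norm M g"
proof -
  have *: "(\<lambda>x. complex_of_real (cmod (f x))) \<in> L2_space M" if "f \<in> L2_space M" for f
    using that by (auto simp: L2_space_def)
  have "(LINT x|M. cmod (f x) * cmod (g x)) \<le> cmod (complex_of_real (LINT x|M. cmod (f x) * cmod (g x)))"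
    by simp
  also have "\<dots> = cmod (L2_inner M (\<lambda>x. complex_of_real (cmod (f x))) (\<lambda>x. complex_of_real (cmod (g x))))"
    by (simp add: L2_inner_def integral_complex_of_real[symmetric])
  also have "\<dots> \<le> L2_norm M f * L2_norm M g"
    using L2_Cauchy_Schwarz[OF *[OF f] *[OF g]] by (simp add: L2_norm_def)
  finally show ?thesis .
qed

lemma L2_norm_triangle:
  assumes f: "f \<in> L2_space M" and g: "g \<in> L2_space M"
  shows "L2_norm M (\<lambda>x. f x + g x) \<le> L2_norm M f + L2_norm M g"
proof (rule power2_le_imp_le)
  have "(L2_norm M (\<lambda>x. f x + g x))\<^sup>2 = (L2_norm M (\<lambda>x. f x - (-1) * g x))\<^sup>2" by simp
  also have "\<dots> = (L2_norm M f)\<^sup>2 + 2 * Re (L2_inner M f g) + (L2_norm M g)\<^sup>2"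
    using f g by (subst L2_norm_diff_square) (auto simp: L2_space_uminus L2_norm_scale[of _ "-1", simplified]
        L2_inner_scale_right[of _ _ "-1", simplified])
  also have "Re (L2_inner M f g) \<le> L2_norm M f * L2_norm M g"
    using complex_Re_le_cmod L2_Cauchy_Schwarz[OF f g] order_trans by blast
  finally show "(L2_norm M (\<lambda>x. f x + g x))\<^sup>2 \<le> (L2_norm M f + L2_norm M g)\<^sup>2"
    by (simp add: power2_sum)
qed simp

lemma L2_norm_minus_commute: "L2_norm M (\<lambda>x. f x - g x) = L2_norm M (\<lambda>x. g x - f x)"
  by (simp add: L2_norm_def norm_minus_commute)

lemma L2_norm_triangle_diff:
  assumes "f \<in> L2_space M" "g \<in> L2_space M" "h \<in> L2_space M"
  shows "L2_norm M (\<lambda>x. f x - h x) \<le> L2_norm M (\<lambda>x. f x - g x) + L2_norm M (\<lambda>x. g x - h x)"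
  using L2_norm_triangle[OF L2_space_diff[OF assms(1,2)] L2_space_diff[OF assms(2,3)]] by simp

text \<open>Testing with \<open>h = f\<close> turns the weak bound into a norm bound. This is how
  norms are estimated when only inner products of an element are known.\<close>

lemma L2_norm_le_iff_inner:
  assumes f: "f \<in> L2_space M" and C: "C \<ge> 0"
    and le: "\<And>h. h \<in> L2_space M \<Longrightarrow> cmod (L2_inner M f h) \<le> C * L2_norm M h"
  shows "L2_norm M f \<le> C"
proof (cases "L2_norm M f = 0")
  case False
  have "L2_norm M f * L2_norm M f \<le> C * L2_norm M f"
    using le[OF f] unfolding L2_inner_self norm_of_real by (simp add: power2_eq_square)
  with False show ?thesis using L2_norm_nonneg[of M f] by (simp add: less_le)
qed (use C in simp)

text \<open>Passes from weak identities to the almost everywhere identities in which the definitions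
  are phrased; the difference of the two functions serves as test function.\<close>

lemma L2_AE_eqI:
  assumes f: "f \<in> L2_space M" and g: "g \<in> L2_space M"
    and eq: "\<And>h. h \<in> L2_space M \<Longrightarrow> L2_inner M f h = L2_inner M g h"
  shows "AE x in M. f x = g x"
proof -
  have d: "(\<lambda>x. f x - g x) \<in> L2_space M" using f g by (rule L2_space_diff)
  have "L2_inner M (\<lambda>x. f x - g x) (\<lambda>x. f x - g x) = 0"
    using eq[OF d] L2_inner_diff_left[OF f g d] by simp
  then have "L2_norm M (\<lambda>x. f x - g x) = 0" by (simp add: L2_inner_self)
  then have "AE x in M. f x - g x = 0" using L2_norm_eq_0_iff[OF d] by blast
  then show ?thesis by simp
qed

lemma L2_inner_tendsto:
  assumes f: "\<And>n. f n \<in> L2_space M" and g: "g \<in> L2_space M" and h: "h \<in> L2_space M"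
    and lim: "(\<lambda>n. L2_norm M (\<lambda>x. f n x - g x)) \<longlonglongrightarrow> 0"
  shows "(\<lambda>n. L2_inner M (f n) h) \<longlonglongrightarrow> L2_inner M g h"
proof (rule LIM_zero_cancel, rule tendsto_norm_zero_cancel, rule tendsto_sandwich[OF _ _ tendsto_const])
  show "(\<lambda>n. L2_norm M (\<lambda>x. f n x - g x) * L2_norm M h) \<longlonglongrightarrow> 0"
    using tendsto_mult_right[OF lim, of "L2_norm M h"] by simp
  show "\<forall>\<^sub>F n in sequentially. norm (L2_inner M (f n) h - L2_inner M g h)
      \<le> L2_norm M (\<lambda>x. f n x - g x) * L2_norm M h"
    using L2_Cauchy_Schwarz[OF L2_space_diff[OF f g] h] by (simp add: L2_inner_diff_left f g h)
qed auto

lemma L2_norm_tendsto: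
  assumes f: "\<And>n. f n \<in> L2_space M" and g: "g \<in> L2_space M"
    and lim: "(\<lambda>n. L2_norm M (\<lambda>x. f n x - g x)) \<longlonglongrightarrow> 0"
  shows "(\<lambda>n. L2_norm M (f n)) \<longlonglongrightarrow> L2_norm M g"
proof (rule LIM_zero_cancel, rule tendsto_rabs_zero_cancel, rule tendsto_sandwich[OF _ _ tendsto_const lim])
  have "\<bar>L2_norm M (f n) - L2_norm M g\<bar> \<le> L2_norm M (\<lambda>x. f n x - g x)" for n
    using L2_norm_triangle_diff[OF f[of n] g L2_space_zero]
      L2_norm_triangle_diff[OF g f[of n] L2_space_zero] L2_norm_minus_commute[of M g "f n"]
    by (simp add: abs_le_iff)
  then show "\<forall>\<^sub>F n in sequentially. \<bar>L2_norm M (f n) - L2_norm M g\<bar> \<le> L2_norm M (\<lambda>x. f n x - g x)" by simp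
qed auto

section \<open>Completeness\<close>

text \<open>Padding with zeros outside the image of the enumeration treats finite and infinite
  \<open>I\<close> alike and makes theorems on series over \<open>nat\<close> available for
  unordered sums.\<close>

lemma has_sum_from_nat_into:
  assumes "countable I"
  shows "((\<lambda>n. if n \<in> to_nat_on I ` I then g (from_nat_into I n) else 0) has_sum s) UNIV \<longleftrightarrow> (g has_sum s) I"
    (is "(?g has_sum s) UNIV \<longleftrightarrow> _")
proof -
  have "(?g has_sum s) UNIV \<longleftrightarrow> (?g has_sum s) (to_nat_on I ` I)"
    by (intro has_sum_cong_neutral) auto
  also have "\<dots> \<longleftrightarrow> (g has_sum s) I"
    using assms by (subst has_sum_reindex) (auto intro!: has_sum_cong inj_on_to_nat_on)
  finally show ?thesis .
qed

text \<open>The hypotheses are moved along the enumeration to \<open>sums_integral\<close>; absolute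
  convergence of the integrals then makes the resulting series an unordered sum again.\<close>

lemma has_sum_integral_countable:
  fixes f :: "'i \<Rightarrow> 'a \<Rightarrow> 'b :: {banach, second_countable_topology}"
  assumes I: "countable I"
    and int: "\<And>i. i \<in> I \<Longrightarrow> integrable M (f i)"
    and AE: "AE x in M. (\<lambda>i. norm (f i x)) summable_on I"
    and sum: "(\<lambda>i. LINT x|M. norm (f i x)) summable_on I"
    and F: "F \<in> borel_measurable M" "AE x in M. ((\<lambda>i. f i x) has_sum F x) I"
  shows "((\<lambda>i. integral\<^sup>L M (f i)) has_sum integral\<^sup>L M F) I"
proof -
  define f' where "f' n x = (if n \<in> to_nat_on I ` I then f (from_nat_into I n) x else 0)" for n x
  have f'_eq: "f' n = (if n \<in> to_nat_on I ` I then f (from_nat_into I n) else (\<lambda>x. 0))" for n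
    by (auto simp: f'_def fun_eq_iff)
  have sum_norm: "summable (\<lambda>n. norm (f' n x))" if "(\<lambda>i. norm (f i x)) summable_on I" for x
  proof -
    from that have "((\<lambda>i. norm (f i x)) has_sum (\<Sum>\<^sub>\<infinity>i\<in>I. norm (f i x))) I" by (rule has_sum_infsum)
    moreover have "(\<lambda>n. norm (f' n x)) =
        (\<lambda>n. if n \<in> to_nat_on I ` I then norm (f (from_nat_into I n) x) else 0)"
      by (auto simp: f'_def fun_eq_iff)
    ultimately have "((\<lambda>n. norm (f' n x)) has_sum (\<Sum>\<^sub>\<infinity>i\<in>I. norm (f i x))) UNIV"
      using has_sum_from_nat_into[OF I, of "\<lambda>i. norm (f i x)"] by simp
    then show ?thesis by (rule has_sum_imp_sums[THEN sums_summable])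
  qed
  have eq: "(\<Sum>n. f' n x) = F x" if "(\<lambda>i. norm (f i x)) summable_on I" "((\<lambda>i. f i x) has_sum F x) I" for x
  proof -
    have "((\<lambda>n. f' n x) has_sum (\<Sum>n. f' n x)) UNIV"
      by (rule norm_summable_imp_has_sum[OF sum_norm[OF that(1)] summable_sums[OF summable_norm_cancel[OF sum_norm[OF that(1)]]]])
    moreover have "((\<lambda>n. f' n x) has_sum F x) UNIV"
      unfolding f'_def using has_sum_from_nat_into[OF I, of "\<lambda>i. f i x"] that(2) by simp
    ultimately show ?thesis by (rule has_sum_unique)
  qed
  have int': "integrable M (f' n)" for n
    using int I by (auto simp: f'_eq)
  have AE': "AE x in M. summable (\<lambda>n. norm (f' n x))" using AE sum_norm by auto
  have sum': "summable (\<lambda>n. LINT x|M. norm (f' n x))"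
  proof -
    obtain s where "((\<lambda>i. LINT x|M. norm (f i x)) has_sum s) I" using sum by (auto simp: summable_on_def)
    moreover have "(\<lambda>n. LINT x|M. norm (f' n x)) =
        (\<lambda>n. if n \<in> to_nat_on I ` I then (LINT x|M. norm (f (from_nat_into I n) x)) else 0)"
      by (auto simp: f'_def fun_eq_iff)
    ultimately have "((\<lambda>n. LINT x|M. norm (f' n x)) has_sum s) UNIV"
      using has_sum_from_nat_into[OF I, of "\<lambda>i. LINT x|M. norm (f i x)"] by simp
    then show ?thesis by (rule has_sum_imp_sums[THEN sums_summable])
  qed
  have "(\<lambda>n. integral\<^sup>L M (f' n)) sums (LINT x|M. (\<Sum>n. f' n x))"
    by (intro sums_integral int' AE' sum')
  moreover have "summable (\<lambda>n. norm (integral\<^sup>L M (f' n)))"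
    by (rule summable_comparison_test'[OF sum', of 0]) (simp add: integral_norm_bound)
  ultimately have "((\<lambda>n. integral\<^sup>L M (f' n)) has_sum (LINT x|M. (\<Sum>n. f' n x))) UNIV"
    by (intro norm_summable_imp_has_sum)
  moreover have "(\<lambda>n. integral\<^sup>L M (f' n)) =
      (\<lambda>n. if n \<in> to_nat_on I ` I then integral\<^sup>L M (f (from_nat_into I n)) else 0)"
    by (auto simp: f'_eq fun_eq_iff)
  moreover have "(LINT x|M. (\<Sum>n. f' n x)) = integral\<^sup>L M F"
  proof (rule integral_cong_AE)
    show "(\<lambda>x. \<Sum>n. f' n x) \<in> borel_measurable M"
      using int' by (intro borel_measurable_suminf) auto
    show "AE x in M. (\<Sum>n. f' n x) = F x" using AE F(2) eq by auto
  qed (rule F(1))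
  ultimately show ?thesis
    using has_sum_from_nat_into[OF I, of "\<lambda>i. integral\<^sup>L M (f i)"] by simp
qed

lemma L2_norm_sum_le:
  assumes "\<And>i. i \<in> F \<Longrightarrow> f i \<in> L2_space M"
  shows "L2_norm M (\<lambda>x. \<Sum>i\<in>F. f i x) \<le> (\<Sum>i\<in>F. L2_norm M (f i))"
  using assms
proof (induction F rule: infinite_finite_induct)
  case (insert i F)
  have "L2_norm M (\<lambda>x. f i x + (\<Sum>i\<in>F. f i x)) \<le> L2_norm M (f i) + L2_norm M (\<lambda>x. \<Sum>i\<in>F. f i x)"
    using insert.prems by (intro L2_norm_triangle L2_space_sum) auto
  with insert show ?case by force
qed (auto simp: L2_norm_def)

text \<open>
  Riesz--Fischer: the partial sums of the moduli are bounded in \<open>L\<^sup>2\<close>, so by monotone convergence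
  the series converges absolutely almost everywhere.
\<close>

lemma L2_weak_suminf:
  fixes g :: "nat \<Rightarrow> 'a \<Rightarrow> complex"
  assumes g: "\<And>n. g n \<in> L2_space M" and sum: "summable (\<lambda>n. L2_norm M (g n))"
  shows "\<exists>s\<in>L2_space M. \<forall>h\<in>L2_space M. (\<lambda>n. L2_inner M (g n) h) sums L2_inner M s h \<and>
    summable (\<lambda>n. norm (L2_inner M (g n) h))"
proof -
  note [measurable] = L2_spaceD(1)[OF g]
  define C where "C = (\<Sum>n. L2_norm M (g n))"
  define G where "G n x = (\<Sum>i<n. cmod (g i x))" for n x
  have meas_G [measurable]: "G n \<in> borel_measurable M" for n unfolding G_def by measurable
  have G_bound: "(\<integral>\<^sup>+x. ennreal ((G n x)\<^sup>2) \<partial>M) \<le> ennreal (C\<^sup>2)" for n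
  proof -
    have ng: "(\<lambda>x. complex_of_real (cmod (g i x))) \<in> L2_space M" for i
      using g[of i] by (auto simp: L2_space_def)
    have G2: "(\<lambda>x. \<Sum>i<n. complex_of_real (cmod (g i x))) \<in> L2_space M"
      by (intro L2_space_sum ng)
    have eq: "cmod (\<Sum>i<n. complex_of_real (cmod (g i x))) = G n x" for x
      unfolding G_def of_real_sum[symmetric] norm_of_real by (simp add: sum_nonneg)
    have "L2_norm M (\<lambda>x. \<Sum>i<n. complex_of_real (cmod (g i x)))
        \<le> (\<Sum>i<n. L2_norm M (\<lambda>x. complex_of_real (cmod (g i x))))"
      by (intro L2_norm_sum_le ng)
    also have "\<dots> = (\<Sum>i<n. L2_norm M (g i))" by (simp add: L2_norm_def)
    also have "\<dots> \<le> C" unfolding C_def by (intro sum_le_suminf sum) auto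
    finally have "(L2_norm M (\<lambda>x. \<Sum>i<n. complex_of_real (cmod (g i x))))\<^sup>2 \<le> C\<^sup>2"
      by (intro power_mono) auto
    then have "(LINT x|M. (G n x)\<^sup>2) \<le> C\<^sup>2" by (simp add: L2_norm_square eq)
    moreover have "(\<integral>\<^sup>+x. ennreal ((G n x)\<^sup>2) \<partial>M) = ennreal (LINT x|M. (G n x)\<^sup>2)"
      using L2_spaceD(2)[OF G2] by (intro nn_integral_eq_integral) (auto simp: eq)
    ultimately show ?thesis by (simp add: ennreal_leI)
  qed
  define S where "S x = (SUP n. ennreal ((G n x)\<^sup>2))" for x
  have meas_S [measurable]: "S \<in> borel_measurable M" unfolding S_def by measurable
  have mono_G: "G m x \<le> G n x" if "m \<le> n" for m n x
    unfolding G_def using that by (intro sum_mono2) auto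
  have G_nonneg: "G n x \<ge> 0" for n x by (simp add: G_def sum_nonneg)
  have "(\<integral>\<^sup>+x. S x \<partial>M) = (SUP n. \<integral>\<^sup>+x. ennreal ((G n x)\<^sup>2) \<partial>M)"
    unfolding S_def using mono_G G_nonneg
    by (intro nn_integral_monotone_convergence_SUP)
       (auto simp: incseq_def le_fun_def intro!: ennreal_leI power_mono)
  also have "\<dots> \<le> ennreal (C\<^sup>2)" by (intro SUP_least G_bound)
  finally have S_fin: "(\<integral>\<^sup>+x. S x \<partial>M) < \<infinity>" using ennreal_less_top le_less_trans by fastforce
  have AE_S: "AE x in M. S x \<noteq> \<infinity>" using S_fin by (intro nn_integral_PInf_AE) auto
  have G_le_S: "ennreal ((G n x)\<^sup>2) \<le> S x" for n x unfolding S_def by (intro SUP_upper) auto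
  have summ: "summable (\<lambda>n. cmod (g n x))" if S: "S x \<noteq> \<infinity>" for x
  proof (rule bounded_imp_summable)
    fix n
    have "ennreal ((G (Suc n) x)\<^sup>2) \<le> ennreal (enn2real (S x))"
      using G_le_S[of "Suc n" x] S by (cases "S x") auto
    then have "(G (Suc n) x)\<^sup>2 \<le> enn2real (S x)" by (simp add: ennreal_le_iff)
    then have "G (Suc n) x \<le> sqrt (enn2real (S x))" by (simp add: real_le_rsqrt)
    then show "(\<Sum>i\<le>n. cmod (g i x)) \<le> sqrt (enn2real (S x))"
      by (simp add: G_def lessThan_Suc_atMost)
  qed auto
  \<comment> \<open>Where the series diverges, \<open>s x\<close> is an unspecified value; this can
    happen only where \<open>S x\<close> is infinite, which is a null set.\<close>
  define s where "s x = (\<Sum>n. g n x)" for x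
  have meas_s [measurable]: "s \<in> borel_measurable M" unfolding s_def by measurable
  have s_le: "ennreal ((cmod (s x))\<^sup>2) \<le> S x" if S: "S x \<noteq> \<infinity>" for x
  proof -
    have "(\<lambda>n. (cmod (\<Sum>i<n. g i x))\<^sup>2) \<longlonglongrightarrow> (cmod (s x))\<^sup>2" unfolding s_def
      by (intro tendsto_intros summable_LIMSEQ summable_norm_cancel[OF summ[OF S]])
    then have lim: "(\<lambda>n. ennreal ((cmod (\<Sum>i<n. g i x))\<^sup>2)) \<longlonglongrightarrow> ennreal ((cmod (s x))\<^sup>2)"
      by (intro tendsto_ennrealI)
    have "ennreal ((cmod (\<Sum>i<n. g i x))\<^sup>2) \<le> S x" for n
    proof -
      have "(cmod (\<Sum>i<n. g i x))\<^sup>2 \<le> (G n x)\<^sup>2" unfolding G_def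
        by (intro power_mono norm_sum) auto
      then show ?thesis using G_le_S order_trans ennreal_leI by blast
    qed
    then show ?thesis using LIMSEQ_le_const2[OF lim] by blast
  qed
  have s: "s \<in> L2_space M"
  proof (rule L2_spaceI[OF meas_s], rule integrableI_bounded)
    have "(\<integral>\<^sup>+x. ennreal (norm ((cmod (s x))\<^sup>2)) \<partial>M) \<le> (\<integral>\<^sup>+x. S x \<partial>M)"
      using AE_S s_le by (intro nn_integral_mono_AE) auto
    then show "(\<integral>\<^sup>+x. ennreal (norm ((cmod (s x))\<^sup>2)) \<partial>M) < \<infinity>" using S_fin by (rule le_less_trans)
  qed measurable
  have int_bound: "(LINT x|M. norm (g n x * cnj (h x))) \<le> L2_norm M (g n) * L2_norm M h"
    if "h \<in> L2_space M" for n h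
    using L2_integral_norm_mult_le[OF g that] by (simp add: norm_mult)
  have sum_int: "summable (\<lambda>n. LINT x|M. norm (g n x * cnj (h x)))" if h: "h \<in> L2_space M" for h
    using int_bound[OF h]
    by (intro summable_comparison_test'[OF summable_mult2[OF sum, of "L2_norm M h"], of 0]) auto
  have "(\<lambda>n. L2_inner M (g n) h) sums L2_inner M s h" if h: "h \<in> L2_space M" for h
  proof -
    have "(\<lambda>n. LINT x|M. g n x * cnj (h x)) sums (LINT x|M. (\<Sum>n. g n x * cnj (h x)))"
    proof (rule sums_integral)
      show "AE x in M. summable (\<lambda>n. norm (g n x * cnj (h x)))"
        using AE_S by eventually_elim (auto simp: norm_mult intro!: summable_mult2 summ)
    qed (use L2_integrable_mult_cnj[OF g h] sum_int[OF h] in auto)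
    also have "(LINT x|M. (\<Sum>n. g n x * cnj (h x))) = L2_inner M s h"
      unfolding L2_inner_def
    proof (rule integral_cong_AE)
      show "AE x in M. (\<Sum>n. g n x * cnj (h x)) = s x * cnj (h x)"
        using AE_S by eventually_elim
          (auto simp: s_def intro!: suminf_mult2[symmetric] summable_norm_cancel[OF summ])
    qed (use L2_spaceD(1)[OF h] in measurable)
    finally show ?thesis by (simp add: L2_inner_def)
  qed
  moreover have "summable (\<lambda>n. norm (L2_inner M (g n) h))" if h: "h \<in> L2_space M" for h
    by (rule summable_comparison_test'[OF sum_int[OF h], of 0])
       (simp add: L2_inner_def integral_norm_bound[of M "\<lambda>x. g _ x * cnj (h x)", simplified])
  ultimately show ?thesis using s by blast
qed

text \<open>The sum is characterized only by its inner products, which is all that the constructions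
  of the adjoint and of the modulus use.\<close>

lemma L2_weak_sum:
  assumes I: "countable I" and g: "\<And>i. i \<in> I \<Longrightarrow> g i \<in> L2_space M"
    and sum: "(\<lambda>i. L2_norm M (g i)) summable_on I"
  shows "\<exists>s\<in>L2_space M. \<forall>h\<in>L2_space M. ((\<lambda>i. L2_inner M (g i) h) has_sum L2_inner M s h) I"
proof -
  define g' where "g' n = (if n \<in> to_nat_on I ` I then g (from_nat_into I n) else (\<lambda>x. 0))" for n
  have g': "g' n \<in> L2_space M" for n using g I by (auto simp: g'_def)
  have inner: "L2_inner M (g' n) h =
      (if n \<in> to_nat_on I ` I then L2_inner M (g (from_nat_into I n)) h else 0)" for n h
    by (simp add: g'_def L2_inner_def)
  have norm: "L2_norm M (g' n) =
      (if n \<in> to_nat_on I ` I then L2_norm M (g (from_nat_into I n)) else 0)" for n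
    by (simp add: g'_def L2_norm_def)
  obtain t where "((\<lambda>i. L2_norm M (g i)) has_sum t) I" using sum by (auto simp: summable_on_def)
  then have "((\<lambda>n. L2_norm M (g' n)) has_sum t) UNIV"
    unfolding norm has_sum_from_nat_into[OF I, of "\<lambda>i. L2_norm M (g i)"] .
  then have "summable (\<lambda>n. L2_norm M (g' n))" by (rule has_sum_imp_sums[THEN sums_summable])
  from L2_weak_suminf[OF g' this] obtain s where s: "s \<in> L2_space M"
    and "\<forall>h\<in>L2_space M. (\<lambda>n. L2_inner M (g' n) h) sums L2_inner M s h \<and>
      summable (\<lambda>n. norm (L2_inner M (g' n) h))"
    by (elim bexE)
  then have "((\<lambda>n. L2_inner M (g' n) h) has_sum L2_inner M s h) UNIV" if "h \<in> L2_space M" for h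
    using that by (intro norm_summable_imp_has_sum) auto
  then have "((\<lambda>i. L2_inner M (g i) h) has_sum L2_inner M s h) I" if "h \<in> L2_space M" for h
    using that unfolding inner
    by (intro has_sum_from_nat_into[OF I, of "\<lambda>i. L2_inner M (g i) h", THEN iffD1]) auto
  with s show ?thesis by blast
qed

text \<open>Differences along a fast subsequence have summable norms and telescope, so Riesz-Fischer
  gives a limit. At first this limit is only weak; the Cauchy estimate, uniform in the test
  function, upgrades it to a limit in norm.\<close>

lemma L2_complete:
  fixes f :: "nat \<Rightarrow> 'a \<Rightarrow> complex"
  assumes f: "\<And>n. f n \<in> L2_space M"
    and Cauchy: "\<And>e. e > 0 \<Longrightarrow> \<exists>N. \<forall>m\<ge>N. \<forall>n\<ge>N. L2_norm M (\<lambda>x. f m x - f n x) \<le> e"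
  shows "\<exists>g\<in>L2_space M. (\<lambda>n. L2_norm M (\<lambda>x. f n x - g x)) \<longlonglongrightarrow> 0"
proof -
  have "\<forall>j. \<exists>N. \<forall>m\<ge>N. \<forall>n\<ge>N. L2_norm M (\<lambda>x. f m x - f n x) \<le> (1/2)^j"
    using Cauchy by simp
  then obtain N where N: "\<And>j m n. m \<ge> N j \<Longrightarrow> n \<ge> N j \<Longrightarrow> L2_norm M (\<lambda>x. f m x - f n x) \<le> (1/2)^j"
    by metis
  \<comment> \<open>The thresholds \<open>N j\<close> need not increase; their partial sums do and
    dominate all earlier thresholds.\<close>
  define r where "r j = (\<Sum>i\<le>j. N i)" for j
  have r: "r k \<ge> N j" if "j \<le> k" for j k
  proof -
    have "N j \<le> (\<Sum>i\<le>j. N i)" by (rule member_le_sum) auto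
    also have "\<dots> \<le> r k" unfolding r_def using that by (intro sum_mono2) auto
    finally show ?thesis .
  qed
  define d where "d j = (\<lambda>x. f (r (Suc j)) x - f (r j) x)" for j
  have d: "d j \<in> L2_space M" for j unfolding d_def by (intro L2_space_diff f)
  have "summable (\<lambda>j. L2_norm M (d j))"
  proof (rule summable_comparison_test'[of "\<lambda>j. (1/2)^j" 0])
    show "norm (L2_norm M (d j)) \<le> (1/2)^j" for j
      unfolding d_def using N[of j "r (Suc j)" "r j"] r by simp
  qed (simp add: summable_geometric)
  from L2_weak_suminf[OF d this] obtain s where s: "s \<in> L2_space M"
    and sums: "\<And>h. h \<in> L2_space M \<Longrightarrow> (\<lambda>j. L2_inner M (d j) h) sums L2_inner M s h"
    by blast
  define g where "g = (\<lambda>x. f (r 0) x + s x)"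
  have g: "g \<in> L2_space M" unfolding g_def by (intro L2_space_add f s)
  have weak: "(\<lambda>j. L2_inner M (f (r j)) h) \<longlonglongrightarrow> L2_inner M g h" if h: "h \<in> L2_space M" for h
  proof -
    have "(\<Sum>i<j. L2_inner M (d i) h) = L2_inner M (f (r j)) h - L2_inner M (f (r 0)) h" for j
      unfolding d_def by (simp add: L2_inner_diff_left f h sum_lessThan_telescope[of "\<lambda>i. L2_inner M (f (r i)) h"])
    then have "(\<lambda>j. L2_inner M (f (r j)) h - L2_inner M (f (r 0)) h) \<longlonglongrightarrow> L2_inner M s h"
      using sums[OF h] by (simp add: sums_def)
    from tendsto_add[OF this tendsto_const[of "L2_inner M (f (r 0)) h"]]
    show ?thesis by (simp add: g_def L2_inner_add_left f s h add.commute)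
  qed
  have bound: "L2_norm M (\<lambda>x. f n x - g x) \<le> (1/2)^j" if n: "n \<ge> N j" for n j
  proof (rule L2_norm_le_iff_inner)
    fix h assume h: "h \<in> L2_space M"
    have "(\<lambda>m. cmod (L2_inner M (f n) h - L2_inner M (f (r m)) h)) \<longlonglongrightarrow>
        cmod (L2_inner M (f n) h - L2_inner M g h)"
      by (intro tendsto_intros weak h)
    moreover have "cmod (L2_inner M (f n) h - L2_inner M (f (r m)) h) \<le> (1/2)^j * L2_norm M h"
      if "m \<ge> j" for m
    proof -
      have "cmod (L2_inner M (f n) h - L2_inner M (f (r m)) h)
          = cmod (L2_inner M (\<lambda>x. f n x - f (r m) x) h)" by (simp add: L2_inner_diff_left f h)
      also have "\<dots> \<le> L2_norm M (\<lambda>x. f n x - f (r m) x) * L2_norm M h"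
        by (intro L2_Cauchy_Schwarz L2_space_diff f h)
      also have "\<dots> \<le> (1/2)^j * L2_norm M h"
        by (intro mult_right_mono N n r that) auto
      finally show ?thesis .
    qed
    ultimately have "cmod (L2_inner M (f n) h - L2_inner M g h) \<le> (1/2)^j * L2_norm M h"
      using LIMSEQ_le_const2 by blast
    then show "cmod (L2_inner M (\<lambda>x. f n x - g x) h) \<le> (1/2)^j * L2_norm M h"
      by (simp add: L2_inner_diff_left f g h)
  qed (auto intro: L2_space_diff f g)
  have "(\<lambda>n. L2_norm M (\<lambda>x. f n x - g x)) \<longlonglongrightarrow> 0"
  proof (rule LIMSEQ_I)
    fix e :: real assume "e > 0"
    then obtain j where j: "(1/2::real)^j < e" using real_arch_pow_inv[of e "1/2"] by auto
    show "\<exists>no. \<forall>n\<ge>no. norm (L2_norm M (\<lambda>x. f n x - g x) - 0) < e"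
      using bound[of j] j by (intro exI[of _ "N j"]) (auto intro: le_less_trans)
  qed
  with g show ?thesis by blast
qed

section \<open>Operators with a nuclear expansion\<close>

lemma norm_has_sum_le:
  fixes f :: "'i \<Rightarrow> 'b::banach"
  assumes "(f has_sum a) A" "(g has_sum b) A" "\<And>x. x \<in> A \<Longrightarrow> norm (f x) \<le> g x"
  shows "norm a \<le> b"
proof -
  have "g summable_on A" using assms(2) unfolding summable_on_def by (rule exI)
  then have "(\<lambda>x. norm (f x)) summable_on A"
    by (rule summable_on_comparison_test) (use assms(3) in auto)
  then have sum: "((\<lambda>x. norm (f x)) has_sum (\<Sum>\<^sub>\<infinity>x\<in>A. norm (f x))) A" by (rule has_sum_infsum)
  show ?thesis
    using norm_has_sum_bound[OF sum assms(1)] has_sum_mono[OF sum assms(2) assms(3)] by (rule order_trans)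
qed

section \<open>Operators known through their inner products\<close>

lemma L2_operatorD:
  assumes "L2_operator M T"
  shows "f \<in> L2_space M \<Longrightarrow> T f \<in> L2_space M"
    and "f \<in> L2_space M \<Longrightarrow> g \<in> L2_space M \<Longrightarrow>
      AE x in M. T (\<lambda>y. a * f y + b * g y) x = a * T f x + b * T g x"
  using assms by (auto simp: L2_operator_def)

lemma L2_operator_bound:
  assumes "L2_operator M T"
  obtains C where "C \<ge> 0" "\<And>f. f \<in> L2_space M \<Longrightarrow> L2_norm M (T f) \<le> C * L2_norm M f"
proof -
  obtain C where C: "\<And>f. f \<in> L2_space M \<Longrightarrow> L2_norm M (T f) \<le> C * L2_norm M f"
    using assms unfolding L2_operator_def by blast
  have "L2_norm M (T f) \<le> max C 0 * L2_norm M f" if "f \<in> L2_space M" for f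
    using C[OF that] mult_right_mono[OF max.cobounded1[of C 0] L2_norm_nonneg[of M f]] by linarith
  then show ?thesis using that[of "max C 0"] by simp
qed

text \<open>\<open>L2_AE_eqI\<close> and \<open>L2_norm_le_iff_inner\<close> recover linearity
  almost everywhere and boundedness, so an operator whose values are arbitrary representatives has
  to be controlled only against test functions.\<close>

lemma L2_operatorI_weak:
  assumes T: "\<And>f. f \<in> L2_space M \<Longrightarrow> T f \<in> L2_space M"
    and lin: "\<And>f g h a b. f \<in> L2_space M \<Longrightarrow> g \<in> L2_space M \<Longrightarrow> h \<in> L2_space M \<Longrightarrow>
      L2_inner M (T (\<lambda>y. a * f y + b * g y)) h = a * L2_inner M (T f) h + b * L2_inner M (T g) h"
    and bound: "\<And>f h. f \<in> L2_space M \<Longrightarrow> h \<in> L2_space M \<Longrightarrow>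
      cmod (L2_inner M (T f) h) \<le> C * L2_norm M f * L2_norm M h"
    and C: "C \<ge> 0"
  shows "L2_operator M T"
  unfolding L2_operator_def
proof (intro conjI ballI allI exI)
  fix f assume f: "f \<in> L2_space M"
  show "T f \<in> L2_space M" using f by (rule T)
  show "L2_norm M (T f) \<le> C * L2_norm M f"
    using C bound[OF f] by (intro L2_norm_le_iff_inner T f) auto
  fix g a b assume g: "g \<in> L2_space M"
  show "AE x in M. T (\<lambda>y. a * f y + b * g y) x = a * T f x + b * T g x"
  proof (rule L2_AE_eqI)
    show "T (\<lambda>y. a * f y + b * g y) \<in> L2_space M" by (intro T L2_space_intros f g)
    show "(\<lambda>x. a * T f x + b * T g x) \<in> L2_space M" by (intro T L2_space_intros f g)
    fix h assume h: "h \<in> L2_space M"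
    have "L2_inner M (\<lambda>x. a * T f x + b * T g x) h = a * L2_inner M (T f) h + b * L2_inner M (T g) h"
      by (simp add: L2_inner_add_left L2_inner_scale_left L2_space_scale T f g h)
    then show "L2_inner M (T (\<lambda>y. a * f y + b * g y)) h = L2_inner M (\<lambda>x. a * T f x + b * T g x) h"
      by (simp only: lin[OF f g h])
  qed
qed

text \<open>Moved to the other side of the inner product, \<open>S\<close> inherits linearity and
  the operator bound from \<open>T\<close>; beyond square-integrability of its values only the
  adjoint identity has to be verified.\<close>

lemma L2_adjointI:
  assumes T: "L2_operator M T" and S: "\<And>g. g \<in> L2_space M \<Longrightarrow> S g \<in> L2_space M"
    and adj: "\<And>f g. f \<in> L2_space M \<Longrightarrow> g \<in> L2_space M \<Longrightarrow> L2_inner M (T f) g = L2_inner M f (S g)"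
  shows "L2_adjoint M T S"
proof -
  obtain C where C: "C \<ge> 0" "\<And>f. f \<in> L2_space M \<Longrightarrow> L2_norm M (T f) \<le> C * L2_norm M f"
    using T L2_operator_bound by blast
  have S_inner: "L2_inner M (S g) h = L2_inner M g (T h)" if "g \<in> L2_space M" "h \<in> L2_space M" for g h
    using arg_cong[OF adj[OF that(2,1)], of cnj] by (simp add: L2_inner_cnj)
  have "L2_operator M S"
  proof (rule L2_operatorI_weak[OF S _ _ C(1)])
    fix g h assume g: "g \<in> L2_space M" and h: "h \<in> L2_space M"
    have "cmod (L2_inner M (S g) h) \<le> L2_norm M g * L2_norm M (T h)"
      unfolding S_inner[OF g h] by (intro L2_Cauchy_Schwarz L2_operatorD(1)[OF T] g h)
    also have "\<dots> \<le> L2_norm M g * (C * L2_norm M h)" by (intro mult_left_mono C h) simp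
    finally show "cmod (L2_inner M (S g) h) \<le> C * L2_norm M g * L2_norm M h" by (simp add: mult_ac)
  next
    fix f g h a b assume "f \<in> L2_space M" "g \<in> L2_space M" "h \<in> L2_space M"
    then show "L2_inner M (S (\<lambda>y. a * f y + b * g y)) h = a * L2_inner M (S f) h + b * L2_inner M (S g) h"
      using L2_operatorD(1)[OF T]
      by (simp add: S_inner L2_space_intros L2_inner_add_left L2_inner_scale_left)
  qed
  then show ?thesis using adj by (simp add: L2_adjoint_def)
qed

text \<open>Stated for an indexed family because it is applied both to singular vectors themselves
  and to their normalized images under \<open>T\<close>.\<close>

lemma L2_Bessel:
  assumes F: "finite F" and x: "\<And>e. e \<in> F \<Longrightarrow> x e \<in> L2_space M"
    and on: "\<And>e e'. e \<in> F \<Longrightarrow> e' \<in> F \<Longrightarrow> L2_inner M (x e) (x e') = (if e = e' then 1 else 0)"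
    and h: "h \<in> L2_space M"
  shows "(\<Sum>e\<in>F. (cmod (L2_inner M h (x e)))\<^sup>2) \<le> (L2_norm M h)\<^sup>2"
proof -
  \<comment> \<open>The orthogonal projection of \<open>h\<close> onto the span. Its inner product
    with \<open>h\<close> is its own squared norm, so the squared distance from \<open>h\<close> to
    \<open>p\<close> is the difference of the squared norms.\<close>
  define p where "p = (\<lambda>y. \<Sum>e\<in>F. L2_inner M h (x e) * x e y)"
  have p: "p \<in> L2_space M" unfolding p_def using x by (intro L2_space_sum L2_space_scale)
  have p_inner: "L2_inner M p g = (\<Sum>e\<in>F. L2_inner M h (x e) * L2_inner M (x e) g)" if "g \<in> L2_space M" for g
    unfolding p_def using x that by (subst L2_inner_sum_left) (auto simp: L2_inner_scale_left intro: L2_space_scale)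
  have ph: "L2_inner M p h = of_real (\<Sum>e\<in>F. (cmod (L2_inner M h (x e)))\<^sup>2)"
    unfolding p_inner[OF h] of_real_sum
    by (intro sum.cong refl) (simp add: complex_norm_square L2_inner_cnj del: of_real_power)
  have "L2_inner M p (x e) = L2_inner M h (x e)" if "e \<in> F" for e
    using that F by (simp add: p_inner x on if_distrib[of "\<lambda>z. _ * z"] cong: if_cong)
  then have "L2_inner M p p = L2_inner M p h"
    unfolding p_inner[OF p] p_inner[OF h]
    by (intro sum.cong refl arg_cong2[where f = "(*)"]) (metis L2_inner_cnj)
  then have np: "(L2_norm M p)\<^sup>2 = (\<Sum>e\<in>F. (cmod (L2_inner M h (x e)))\<^sup>2)"
    unfolding L2_inner_self ph of_real_eq_iff .
  have "Re (L2_inner M h p) = (\<Sum>e\<in>F. (cmod (L2_inner M h (x e)))\<^sup>2)"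
    by (subst L2_inner_cnj[symmetric]) (simp add: ph)
  then show ?thesis
    using L2_norm_diff_square[OF h p] np zero_le_power2[of "L2_norm M (\<lambda>y. h y - p y)"] by linarith
qed

text \<open>\<open>T f\<close> is the sum over \<open>i\<close> of \<open>L2_inner M f (v i)\<close>
  times \<open>u i\<close>, required only weakly: integrating the kernel expansion term by term
  delivers exactly such inner products.\<close>

locale L2_nuclear =
  fixes M :: "'a measure" and T :: "('a \<Rightarrow> complex) \<Rightarrow> 'a \<Rightarrow> complex"
    and I :: "'i set" and u v :: "'i \<Rightarrow> 'a \<Rightarrow> complex"
  assumes T: "L2_operator M T"
    and I: "countable I"
    and u: "\<And>i. i \<in> I \<Longrightarrow> u i \<in> L2_space M"
    and v: "\<And>i. i \<in> I \<Longrightarrow> v i \<in> L2_space M"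
    and summable_norms: "(\<lambda>i. L2_norm M (u i) * L2_norm M (v i)) summable_on I"
    and expansion: "\<And>f g. f \<in> L2_space M \<Longrightarrow> g \<in> L2_space M \<Longrightarrow>
      ((\<lambda>i. L2_inner M f (v i) * L2_inner M (u i) g) has_sum L2_inner M (T f) g) I"
begin

section \<open>Adjoint and compactness of a nuclear operator\<close>

definition nuclear_bound :: real where
  "nuclear_bound = (\<Sum>\<^sub>\<infinity>i\<in>I. L2_norm M (u i) * L2_norm M (v i))"

lemma has_sum_nuclear_bound: "((\<lambda>i. L2_norm M (u i) * L2_norm M (v i)) has_sum nuclear_bound) I"
  unfolding nuclear_bound_def using summable_norms by (rule has_sum_infsum)

lemmas T_space = L2_operatorD(1)[OF T]

text \<open>The expansion names the adjoint: its value at \<open>g\<close> is the sum of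
  \<open>L2_inner M g (u i)\<close> times \<open>v i\<close>, whose norms are dominated by
  \<open>L2_norm M g\<close> times the terms of the nuclear sum.\<close>

lemma adjoint_exists: "\<exists>S. L2_adjoint M T S"
proof -
  have "\<exists>s\<in>L2_space M. \<forall>f\<in>L2_space M. L2_inner M (T f) g = L2_inner M f s" if g: "g \<in> L2_space M" for g
  proof -
    have space: "(\<lambda>x. cnj (L2_inner M (u i) g) * v i x) \<in> L2_space M" if "i \<in> I" for i
      using that by (intro L2_space_scale v)
    have "(\<lambda>i. L2_norm M (\<lambda>x. cnj (L2_inner M (u i) g) * v i x)) summable_on I"
    proof (rule summable_on_comparison_test)
      show "(\<lambda>i. L2_norm M g * (L2_norm M (u i) * L2_norm M (v i))) summable_on I"
        using has_sum_cmult_right[OF has_sum_nuclear_bound, of "L2_norm M g"] by (auto simp: summable_on_def)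
      fix i assume i: "i \<in> I"
      have "cmod (L2_inner M (u i) g) * L2_norm M (v i) \<le> (L2_norm M (u i) * L2_norm M g) * L2_norm M (v i)"
        using u[OF i] g by (intro mult_right_mono L2_Cauchy_Schwarz) auto
      then show "L2_norm M (\<lambda>x. cnj (L2_inner M (u i) g) * v i x) \<le> L2_norm M g * (L2_norm M (u i) * L2_norm M (v i))"
        unfolding L2_norm_scale complex_mod_cnj by (simp add: mult_ac)
    qed auto
    from L2_weak_sum[OF I space this] obtain s where s: "s \<in> L2_space M" and sum:
      "\<forall>h\<in>L2_space M. ((\<lambda>i. L2_inner M (\<lambda>x. cnj (L2_inner M (u i) g) * v i x) h) has_sum L2_inner M s h) I"
      by blast
    have "L2_inner M (T f) g = L2_inner M f s" if f: "f \<in> L2_space M" for f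
    proof -
      have "((\<lambda>i. L2_inner M (\<lambda>x. cnj (L2_inner M (u i) g) * v i x) f) has_sum cnj (L2_inner M f s)) I"
        using sum f by (simp add: L2_inner_cnj)
      moreover have "(\<lambda>i. L2_inner M (\<lambda>x. cnj (L2_inner M (u i) g) * v i x) f)
          = (\<lambda>i. cnj (L2_inner M f (v i) * L2_inner M (u i) g))"
        unfolding L2_inner_scale_left complex_cnj_mult L2_inner_cnj by (simp add: mult.commute)
      ultimately have "((\<lambda>i. L2_inner M f (v i) * L2_inner M (u i) g) has_sum L2_inner M f s) I"
        by (simp only: has_sum_cnj_iff)
      with expansion[OF f g] show ?thesis by (rule has_sum_unique)
    qed
    with s show ?thesis by blast
  qed
  then obtain S where "\<And>g. g \<in> L2_space M \<Longrightarrow> S g \<in> L2_space M \<and> (\<forall>f\<in>L2_space M. L2_inner M (T f) g = L2_inner M f (S g))"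
    by metis
  then have "L2_adjoint M T S" by (intro L2_adjointI T) auto
  then show ?thesis by blast
qed

text \<open>Along a diagonal subsequence all coefficients \<open>L2_inner M (f n) (v i)\<close>
  converge. Finitely many terms of the expansion are then close to each other, and the remaining
  ones are small because the norms are summable.\<close>

lemma compact_subsequence:
  fixes f :: "nat \<Rightarrow> 'a \<Rightarrow> complex"
  assumes f: "\<And>n. f n \<in> L2_space M" and unit: "\<And>n. L2_norm M (f n) \<le> 1"
  shows "\<exists>k::nat \<Rightarrow> nat. strict_mono k \<and>
    (\<forall>e>0. \<exists>N. \<forall>m\<ge>N. \<forall>n\<ge>N. L2_norm M (\<lambda>x. T (f (k m)) x - T (f (k n)) x) \<le> e)"
proof -
  have bound_inner: "cmod (L2_inner M (f n) (v i)) \<le> L2_norm M (v i)" if "i \<in> I" for n i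
    using L2_Cauchy_Schwarz[OF f[of n] v[OF that]] mult_right_mono[OF unit[of n] L2_norm_nonneg[of M "v i"]] by simp
  have pos: "1 + L2_norm M (v i) > 0" for i by (simp add: add_pos_nonneg)
  \<comment> \<open>The diagonal argument wants one bound for all \<open>i\<close>; dividing by
    \<open>1 + L2_norm M (v i)\<close> provides the bound 1 without a zero denominator.\<close>
  define c where "c n i = L2_inner M (f n) (v i) / complex_of_real (1 + L2_norm M (v i))" for n i
  have c_bound: "cmod (c n i) \<le> 1" if "i \<in> I" for n i
    using bound_inner[OF that, of n] pos[of i]
    unfolding c_def norm_divide norm_of_real by (simp add: divide_le_eq)
  obtain k :: "nat \<Rightarrow> nat" where k: "strict_mono k"
    and lim: "\<And>i. i \<in> I \<Longrightarrow> \<exists>l. (\<lambda>n. c (k n) i) \<longlonglongrightarrow> l"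
    using function_convergent_subsequence[OF I, of c 1] c_bound by metis
  have conv: "Cauchy (\<lambda>n. L2_inner M (f (k n)) (v i))" if i: "i \<in> I" for i
  proof -
    obtain l where "(\<lambda>n. c (k n) i) \<longlonglongrightarrow> l" using lim[OF i] by blast
    from tendsto_mult_right[OF this, of "complex_of_real (1 + L2_norm M (v i))"]
    have "(\<lambda>n. L2_inner M (f (k n)) (v i)) \<longlonglongrightarrow> l * complex_of_real (1 + L2_norm M (v i))"
      using pos[of i] by (simp add: c_def less_le del: of_real_add)
    then show ?thesis by (rule LIMSEQ_imp_Cauchy)
  qed
  have "\<exists>N. \<forall>m\<ge>N. \<forall>n\<ge>N. L2_norm M (\<lambda>x. T (f (k m)) x - T (f (k n)) x) \<le> e" if e: "e > 0" for e
  proof -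
    define w where "w i = L2_norm M (u i) * L2_norm M (v i)" for i
    have "\<forall>\<^sub>F F in finite_subsets_at_top I. dist (sum w F) nuclear_bound < e / 4"
      using has_sum_nuclear_bound e unfolding has_sum_def w_def by (intro tendstoD) auto
    then obtain F where F: "finite F" "F \<subseteq> I" and "dist (sum w F) nuclear_bound < e / 4"
      unfolding eventually_finite_subsets_at_top by blast
    moreover have tail: "(w has_sum (nuclear_bound - sum w F)) (I - F)"
      using has_sum_nuclear_bound F unfolding w_def by (intro has_sum_Diff) auto
    ultimately have small: "nuclear_bound - sum w F < e / 4" unfolding dist_real_def by linarith
    \<comment> \<open>Chosen so that the finite part contributes at most \<open>e / 2\<close>;
      adding 1 keeps the denominator positive. In the tail the coefficient differences are bounded
      by twice the norm of \<open>v i\<close>, which is why it was cut at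
      \<open>e / 4\<close>.\<close>
    define \<delta> where "\<delta> = e / (2 * (1 + (\<Sum>i\<in>F. L2_norm M (u i))))"
    have pos: "1 + (\<Sum>i\<in>F. L2_norm M (u i)) > 0" by (intro add_pos_nonneg sum_nonneg) auto
    then have \<delta>: "\<delta> > 0" using e by (simp add: \<delta>_def)
    have "\<forall>i\<in>F. \<exists>N. \<forall>m\<ge>N. \<forall>n\<ge>N. dist (L2_inner M (f (k m)) (v i)) (L2_inner M (f (k n)) (v i)) < \<delta>"
      using conv F \<delta> unfolding Cauchy_def by blast
    then obtain N where N: "\<And>i m n. i \<in> F \<Longrightarrow> m \<ge> N i \<Longrightarrow> n \<ge> N i \<Longrightarrow>
        cmod (L2_inner M (f (k m)) (v i) - L2_inner M (f (k n)) (v i)) < \<delta>"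
      unfolding dist_norm by metis
    have "L2_norm M (\<lambda>x. T (f (k m)) x - T (f (k n)) x) \<le> e"
      if m: "m \<ge> (\<Sum>i\<in>F. N i)" and n: "n \<ge> (\<Sum>i\<in>F. N i)" for m n
    proof (rule L2_norm_le_iff_inner)
      show "(\<lambda>x. T (f (k m)) x - T (f (k n)) x) \<in> L2_space M" by (intro L2_space_diff T_space f)
      fix g assume g: "g \<in> L2_space M"
      define d where "d i = L2_inner M (f (k m)) (v i) - L2_inner M (f (k n)) (v i)" for i
      have sum: "((\<lambda>i. d i * L2_inner M (u i) g) has_sum L2_inner M (\<lambda>x. T (f (k m)) x - T (f (k n)) x) g) I"
        using has_sum_add[OF expansion[OF f g] has_sum_cmult_right[OF expansion[OF f g], of "-1"], of "k m" "k n"]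
        by (simp add: L2_inner_diff_left T_space f g d_def algebra_simps)
      have "((\<lambda>i. if i \<in> F then \<delta> * L2_norm M (u i) * L2_norm M g else 2 * L2_norm M g * w i)
          has_sum ((\<Sum>i\<in>F. \<delta> * L2_norm M (u i) * L2_norm M g) + 2 * L2_norm M g * (nuclear_bound - sum w F))) (F \<union> (I - F))"
        (is "(?b has_sum _) _")
      proof (rule has_sum_Un_disjoint)
        show "(?b has_sum (\<Sum>i\<in>F. \<delta> * L2_norm M (u i) * L2_norm M g)) F"
          using F by (intro has_sum_finiteI) auto
        have "((\<lambda>i. 2 * L2_norm M g * w i) has_sum 2 * L2_norm M g * (nuclear_bound - sum w F)) (I - F)"
          by (intro has_sum_cmult_right tail)
        then show "(?b has_sum 2 * L2_norm M g * (nuclear_bound - sum w F)) (I - F)"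
          by (subst has_sum_cong[where g = "\<lambda>i. 2 * L2_norm M g * w i"]) auto
      qed auto
      then have b: "(?b has_sum (\<delta> * (\<Sum>i\<in>F. L2_norm M (u i)) + 2 * (nuclear_bound - sum w F)) * L2_norm M g) I"
        using F(2) by (simp add: Un_absorb1 sum_distrib_left sum_distrib_right algebra_simps)
      have "norm (L2_inner M (\<lambda>x. T (f (k m)) x - T (f (k n)) x) g)
          \<le> (\<delta> * (\<Sum>i\<in>F. L2_norm M (u i)) + 2 * (nuclear_bound - sum w F)) * L2_norm M g"
      proof (rule norm_has_sum_le[OF sum b])
        fix i assume i: "i \<in> I"
        have ug: "cmod (L2_inner M (u i) g) \<le> L2_norm M (u i) * L2_norm M g"
          using u[OF i] g by (rule L2_Cauchy_Schwarz)
        show "norm (d i * L2_inner M (u i) g) \<le> ?b i"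
        proof (cases "i \<in> F")
          case True
          then have "N i \<le> (\<Sum>i\<in>F. N i)" using F by (intro member_le_sum) auto
          then have "cmod (d i) \<le> \<delta>" unfolding d_def using N[OF True, of m n] m n by simp
          with True show ?thesis
            using mult_mono[OF _ ug, of "cmod (d i)" \<delta>] \<delta> by (simp add: norm_mult mult_ac)
        next
          case False
          have "cmod (d i) \<le> 2 * L2_norm M (v i)"
            unfolding d_def using norm_triangle_ineq4 bound_inner[OF i]
            by (smt (verit, best))
          from mult_mono[OF this ug] False show ?thesis by (simp add: norm_mult w_def mult_ac)
        qed
      qed
      also have "\<delta> * (\<Sum>i\<in>F. L2_norm M (u i)) \<le> e / 2"
        using pos e by (simp add: \<delta>_def field_simps)
      then have "(\<delta> * (\<Sum>i\<in>F. L2_norm M (u i)) + 2 * (nuclear_bound - sum w F)) * L2_norm M g \<le> e * L2_norm M g"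
        using small by (intro mult_right_mono) auto
      finally show "cmod (L2_inner M (\<lambda>x. T (f (k m)) x - T (f (k n)) x) g) \<le> e * L2_norm M g" .
    qed (use e in simp)
    then show ?thesis by blast
  qed
  with k show ?thesis by blast
qed


text \<open>
  An eigenvector of \<open>T\<^sup>*T\<close> for the eigenvalue \<open>\<parallel>T e\<parallel>\<^sup>2\<close>, expressed without mentioning the adjoint;
  the eigenvalue is found by taking \<open>g = e\<close>.
\<close>

definition singular_vector :: "('a \<Rightarrow> complex) \<Rightarrow> bool" where
  "singular_vector e \<longleftrightarrow> e \<in> L2_space M \<and> L2_norm M e = 1 \<and>
     (\<forall>g\<in>L2_space M. L2_inner M (T e) (T g) = complex_of_real ((L2_norm M (T e))\<^sup>2) * L2_inner M e g)"

section \<open>Existence of singular vectors\<close>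

lemma singular_vectorI:
  assumes "e \<in> L2_space M" "L2_norm M e = 1"
    and eig: "\<And>g. g \<in> L2_space M \<Longrightarrow> L2_inner M (T e) (T g) = c * L2_inner M e g"
  shows "singular_vector e"
  using assms eig[OF assms(1)] by (auto simp: singular_vector_def L2_inner_self)

lemma normalize:
  assumes f: "f \<in> L2_space M" "L2_norm M f \<noteq> 0"
  shows "(\<lambda>x. complex_of_real (1 / L2_norm M f) * f x) \<in> L2_space M"
    and "L2_norm M (\<lambda>x. complex_of_real (1 / L2_norm M f) * f x) = 1"
  using f by (auto simp: L2_norm_scale L2_space_scale simp del: of_real_divide)

lemma T_norm_scale:
  assumes "f \<in> L2_space M"
  shows "L2_norm M (T (\<lambda>x. c * f x)) = cmod c * L2_norm M (T f)"
proof -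
  have "AE x in M. T (\<lambda>x. c * f x) x = c * T f x"
    using L2_operatorD(2)[OF T assms assms, of c 0] by simp
  then have "L2_norm M (T (\<lambda>x. c * f x)) = L2_norm M (\<lambda>x. c * T f x)"
    using assms by (intro L2_norm_cong_AE T_space L2_space_scale) auto
  then show ?thesis by (simp add: L2_norm_scale)
qed

text \<open>
  On the orthogonal complement \<open>N\<close> of \<open>B\<close>, which \<open>T\<^sup>*T\<close> leaves invariant, \<open>\<mu> = sup \<parallel>T f\<parallel>\<^sup>2\<close> over unit vectors
  bounds \<open>T\<^sup>*T\<close>; hence a maximizing sequence satisfies \<open>\<parallel>T\<^sup>*T f\<^sub>n - \<mu> f\<^sub>n\<parallel> \<rightarrow> 0\<close>, and compactness yields
  an eigenvector in the limit.
\<close>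

lemma singular_vector_exists:
  assumes B: "\<And>e. e \<in> B \<Longrightarrow> singular_vector e"
    and f0: "f0 \<in> L2_space M" "L2_norm M f0 \<noteq> 0" "\<And>e. e \<in> B \<Longrightarrow> L2_inner M f0 e = 0"
  shows "\<exists>f. singular_vector f \<and> (\<forall>e\<in>B. L2_inner M f e = 0)"
proof -
  have B_space: "e \<in> L2_space M" if "e \<in> B" for e using B[OF that] by (simp add: singular_vector_def)
  obtain S where S: "L2_adjoint M T S" using adjoint_exists by blast
  have S_space: "S g \<in> L2_space M" if "g \<in> L2_space M" for g
    using S that L2_operatorD(1) by (auto simp: L2_adjoint_def)
  have adj: "L2_inner M f (S g) = L2_inner M (T f) g" if "f \<in> L2_space M" "g \<in> L2_space M" for f g
    using S that by (auto simp: L2_adjoint_def)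
  have adj': "L2_inner M (S g) f = L2_inner M g (T f)" if "f \<in> L2_space M" "g \<in> L2_space M" for f g
    using arg_cong[OF adj[OF that], of cnj] by (simp add: L2_inner_cnj)
  obtain C where C: "C \<ge> 0" "\<And>f. f \<in> L2_space M \<Longrightarrow> L2_norm M (T f) \<le> C * L2_norm M f"
    using T L2_operator_bound by blast
  define N where "N = {f \<in> L2_space M. \<forall>e\<in>B. L2_inner M f e = 0}"
  define N1 where "N1 = {f \<in> N. L2_norm M f = 1}"
  have N_space: "f \<in> L2_space M" if "f \<in> N" for f using that by (simp add: N_def)
  have N1_space: "f \<in> L2_space M" "L2_norm M f = 1" "f \<in> N" if "f \<in> N1" for f
    using that by (simp_all add: N1_def N_def)
  have scale_N: "(\<lambda>x. c * f x) \<in> N" if "f \<in> N" for c f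
    using that by (simp add: N_def L2_space_scale L2_inner_scale_left)
  have N1_normalize: "(\<lambda>x. complex_of_real (1 / L2_norm M f) * f x) \<in> N1" if "f \<in> N" "L2_norm M f \<noteq> 0" for f
    using scale_N[OF that(1)] normalize(2)[OF N_space[OF that(1)] that(2)]
    unfolding N1_def mem_Collect_eq by blast
  define X where "X = (\<lambda>f. (L2_norm M (T f))\<^sup>2) ` N1"
  have "f0 \<in> N" using f0 by (simp add: N_def)
  then have N1_ne: "N1 \<noteq> {}" using N1_normalize f0(2) by blast
  have "(L2_norm M (T f))\<^sup>2 \<le> C\<^sup>2" if "f \<in> N1" for f
    using C(2)[OF N1_space(1)[OF that]] N1_space(2)[OF that] by (intro power_mono) auto
  then have bdd: "bdd_above X" unfolding X_def by (intro bdd_aboveI2)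
  define \<mu> where "\<mu> = Sup X"
  have le_\<mu>1: "(L2_norm M (T f))\<^sup>2 \<le> \<mu>" if "f \<in> N1" for f
    unfolding \<mu>_def X_def using bdd that by (intro cSUP_upper) (auto simp: X_def)
  have \<mu>_nonneg: "\<mu> \<ge> 0" using N1_ne le_\<mu>1 zero_le_power2 order_trans by blast
  have le_\<mu>: "L2_norm M (T f) \<le> sqrt \<mu> * L2_norm M f" if f: "f \<in> N" for f
  proof (cases "L2_norm M f = 0")
    case True
    then show ?thesis using C(2)[OF N_space[OF f]] by simp
  next
    case False
    have "L2_norm M (T (\<lambda>x. complex_of_real (1 / L2_norm M f) * f x)) \<le> sqrt \<mu>"
      using le_\<mu>1[OF N1_normalize[OF f False]] by (rule real_le_rsqrt)
    then have "L2_norm M (T f) / L2_norm M f \<le> sqrt \<mu>"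
      unfolding T_norm_scale[OF N_space[OF f]] norm_of_real by simp
    then show ?thesis using False L2_norm_nonneg[of M f] by (simp add: divide_le_eq)
  qed
  have "\<exists>f\<in>N. L2_norm M f = 1 \<and> (\<forall>g\<in>L2_space M. L2_inner M (T f) (T g) = complex_of_real \<mu> * L2_inner M f g)"
  \<comment> \<open>If the supremum is 0, then \<open>T\<close> maps \<open>N\<close> to zero and
    any unit vector of \<open>N\<close> will do. The limit argument of the other case divides by
    \<open>\<mu>\<close>.\<close>
  proof (cases "\<mu> = 0")
    case True
    obtain f where f: "f \<in> N1" using N1_ne by blast
    have "L2_norm M (T f) = 0" using le_\<mu>[OF N1_space(3)[OF f]] True L2_norm_nonneg[of M "T f"] by simp
    then have "L2_inner M (T f) (T g) = 0" if "g \<in> L2_space M" for g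
      using L2_Cauchy_Schwarz[OF T_space T_space, OF N1_space(1)[OF f] that] by simp
    then show ?thesis using N1_space[OF f] True by auto
  next
    case False
    then have \<mu>: "\<mu> > 0" using \<mu>_nonneg by simp
    have "\<exists>f\<in>N1. \<mu> - 1 / real (Suc n) < (L2_norm M (T f))\<^sup>2" for n
    proof -
      have "\<mu> - 1 / real (Suc n) < Sup X" by (simp add: \<mu>_def)
      then show ?thesis using less_cSup_iff[of X] N1_ne bdd by (auto simp: X_def)
    qed
    then obtain f where f: "\<And>n. f n \<in> N1" and f_max: "\<And>n. \<mu> - 1 / real (Suc n) < (L2_norm M (T (f n)))\<^sup>2"
      by metis
    note f_space = N1_space(1)[OF f] and f_unit = N1_space(2)[OF f]
    have A_N: "S (T h) \<in> N" if h: "h \<in> N" for h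
    proof -
      have "L2_inner M (S (T h)) e = 0" if e: "e \<in> B" for e
      proof -
        have "L2_inner M (S (T h)) e = cnj (L2_inner M (T e) (T h))"
          using h e B_space by (simp add: adj' T_space N_space L2_inner_cnj)
        also have "L2_inner M (T e) (T h) = complex_of_real ((L2_norm M (T e))\<^sup>2) * L2_inner M e h"
          using B[OF e] N_space[OF h] by (auto simp: singular_vector_def)
        also have "L2_inner M e h = cnj (L2_inner M h e)" by (simp add: L2_inner_cnj)
        also have "L2_inner M h e = 0" using h e by (simp add: N_def)
        finally show ?thesis by simp
      qed
      then show ?thesis using N_space[OF h] S_space T_space by (simp add: N_def)
    qed
    \<comment> \<open>The squared norm of \<open>S (T h)\<close> is the inner product of
      \<open>T h\<close> and \<open>T (S (T h))\<close>. Both \<open>h\<close> and, by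
      \<open>A_N\<close>, \<open>S (T h)\<close> lie in \<open>N\<close>, so \<open>le_\<mu>\<close>
      contributes a factor \<open>sqrt \<mu>\<close> twice.\<close>
    have A_bound: "L2_norm M (S (T h)) \<le> \<mu> * L2_norm M h" if h: "h \<in> N" for h
    proof (cases "L2_norm M (S (T h)) = 0")
      case True
      then show ?thesis using \<mu> by simp
    next
      case False
      have Ah: "S (T h) \<in> L2_space M" using N_space[OF h] S_space T_space by blast
      have "complex_of_real ((L2_norm M (S (T h)))\<^sup>2) = L2_inner M (T h) (T (S (T h)))"
        unfolding L2_inner_self[symmetric] using N_space[OF h] Ah by (simp add: adj' T_space)
      then have "(L2_norm M (S (T h)))\<^sup>2 = cmod (L2_inner M (T h) (T (S (T h))))"
        by (metis abs_of_nonneg norm_of_real zero_le_power2)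
      also have "\<dots> \<le> L2_norm M (T h) * L2_norm M (T (S (T h)))"
        using N_space[OF h] Ah by (intro L2_Cauchy_Schwarz T_space)
      also have "\<dots> \<le> (sqrt \<mu> * L2_norm M h) * (sqrt \<mu> * L2_norm M (S (T h)))"
        using \<mu> by (intro mult_mono le_\<mu> h A_N mult_nonneg_nonneg) auto
      also have "\<dots> = (\<mu> * L2_norm M h) * L2_norm M (S (T h))"
        using \<mu> by (simp add: mult_ac flip: real_sqrt_mult)
      finally show ?thesis using False L2_norm_nonneg[of M "S (T h)"]
        by (simp add: power2_eq_square less_le)
    qed
    have A_space: "S (T (f n)) \<in> L2_space M" for n using f_space S_space T_space by blast
    \<comment> \<open>With \<open>A_bound\<close> for the first term, the expanded square is at most
      \<open>2 * \<mu>\<close> times the gap between \<open>\<mu>\<close> and the value attained at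
      \<open>f n\<close>.\<close>
    have approx: "(L2_norm M (\<lambda>x. S (T (f n)) x - complex_of_real \<mu> * f n x))\<^sup>2 \<le> 2 * \<mu> / real (Suc n)" for n
    proof -
      have "L2_inner M (S (T (f n))) (f n) = complex_of_real ((L2_norm M (T (f n)))\<^sup>2)"
        by (simp only: adj'[OF f_space T_space[OF f_space]] L2_inner_self)
      then have "(L2_norm M (\<lambda>x. S (T (f n)) x - complex_of_real \<mu> * f n x))\<^sup>2
          = (L2_norm M (S (T (f n))))\<^sup>2 - 2 * \<mu> * (L2_norm M (T (f n)))\<^sup>2 + \<mu>\<^sup>2"
        using \<mu> by (subst L2_norm_diff_square[OF A_space L2_space_scale[OF f_space]])
          (simp add: L2_inner_scale_right L2_norm_scale f_unit del: of_real_power)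
      also have "(L2_norm M (S (T (f n))))\<^sup>2 \<le> \<mu>\<^sup>2"
        using A_bound[OF N1_space(3)[OF f]] f_unit by (intro power_mono) auto
      also have "\<mu>\<^sup>2 - 2 * \<mu> * (L2_norm M (T (f n)))\<^sup>2 + \<mu>\<^sup>2 = 2 * \<mu> * (\<mu> - (L2_norm M (T (f n)))\<^sup>2)"
        by (simp add: power2_eq_square algebra_simps)
      also have "\<dots> \<le> 2 * \<mu> * (1 / real (Suc n))"
        using f_max[of n] \<mu> by (intro mult_left_mono) auto
      finally show ?thesis by simp
    qed
    have "\<exists>k::nat \<Rightarrow> nat. strict_mono k \<and>
        (\<forall>e>0. \<exists>N. \<forall>m\<ge>N. \<forall>n\<ge>N. L2_norm M (\<lambda>x. T (f (k m)) x - T (f (k n)) x) \<le> e)"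
      by (rule compact_subsequence) (simp_all add: f_space f_unit)
    then obtain k :: "nat \<Rightarrow> nat" where k: "strict_mono k" and
      k_Cauchy: "\<And>e. e > 0 \<Longrightarrow> \<exists>N. \<forall>m\<ge>N. \<forall>n\<ge>N. L2_norm M (\<lambda>x. T (f (k m)) x - T (f (k n)) x) \<le> e"
      by blast
    have A_diff: "L2_norm M (\<lambda>x. S (T (f m)) x - S (T (f n)) x) \<le> C * L2_norm M (\<lambda>x. T (f m) x - T (f n) x)" for m n
    proof (rule L2_norm_le_iff_inner)
      fix h assume h: "h \<in> L2_space M"
      have "L2_inner M (\<lambda>x. S (T (f m)) x - S (T (f n)) x) h = L2_inner M (\<lambda>x. T (f m) x - T (f n) x) (T h)"
        by (simp add: L2_inner_diff_left A_space T_space f_space h adj')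
      also have "cmod \<dots> \<le> L2_norm M (\<lambda>x. T (f m) x - T (f n) x) * L2_norm M (T h)"
        by (intro L2_Cauchy_Schwarz L2_space_diff T_space f_space h)
      also have "\<dots> \<le> L2_norm M (\<lambda>x. T (f m) x - T (f n) x) * (C * L2_norm M h)"
        by (intro mult_left_mono C h) simp
      finally show "cmod (L2_inner M (\<lambda>x. S (T (f m)) x - S (T (f n)) x) h)
          \<le> C * L2_norm M (\<lambda>x. T (f m) x - T (f n) x) * L2_norm M h" by (simp add: mult_ac)
    qed (auto intro!: L2_space_diff A_space mult_nonneg_nonneg C(1))
    have "\<exists>w\<in>L2_space M. (\<lambda>n. L2_norm M (\<lambda>x. S (T (f (k n))) x - w x)) \<longlonglongrightarrow> 0"
    proof (rule L2_complete[OF A_space])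
      fix e :: real assume e: "e > 0"
      then obtain N' where N': "\<And>m n. m \<ge> N' \<Longrightarrow> n \<ge> N' \<Longrightarrow> L2_norm M (\<lambda>x. T (f (k m)) x - T (f (k n)) x) \<le> e / (C + 1)"
        using k_Cauchy[of "e / (C + 1)"] C(1) by force
      have "L2_norm M (\<lambda>x. S (T (f (k m))) x - S (T (f (k n))) x) \<le> e" if "m \<ge> N'" "n \<ge> N'" for m n
      proof -
        have "L2_norm M (\<lambda>x. S (T (f (k m))) x - S (T (f (k n))) x) \<le> C * (e / (C + 1))"
          using A_diff[of "k m" "k n"] mult_left_mono[OF N'[OF that] C(1)] by linarith
        also have "\<dots> \<le> e" using C(1) e by (simp add: field_simps)
        finally show ?thesis .
      qed
      then show "\<exists>N. \<forall>m\<ge>N. \<forall>n\<ge>N. L2_norm M (\<lambda>x. S (T (f (k m))) x - S (T (f (k n))) x) \<le> e" by blast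
    qed
    then obtain w where w: "w \<in> L2_space M" and w_lim: "(\<lambda>n. L2_norm M (\<lambda>x. S (T (f (k n))) x - w x)) \<longlonglongrightarrow> 0"
      by blast
    \<comment> \<open>Compactness only makes the images \<open>S (T (f (k n)))\<close> converge, to
      \<open>w\<close>. Since they differ from \<open>\<mu>\<close> times \<open>f (k n)\<close> by
      a null sequence, \<open>f (k n)\<close> itself converges to \<open>w / \<mu>\<close>.\<close>
    define z where "z = (\<lambda>x. complex_of_real (1 / \<mu>) * w x)"
    have z: "z \<in> L2_space M" unfolding z_def using w by (rule L2_space_scale)
    have z_lim: "(\<lambda>n. L2_norm M (\<lambda>x. f (k n) x - z x)) \<longlonglongrightarrow> 0"
    proof (rule tendsto_sandwich[OF _ _ tendsto_const])
      define a where "a n = sqrt (2 * \<mu> / real (Suc n))" for n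
      define b where "b n = L2_norm M (\<lambda>x. S (T (f (k n))) x - w x)" for n
      have "(\<lambda>n. 2 * \<mu> / real (Suc n)) \<longlonglongrightarrow> 0"
        by (rule LIMSEQ_Suc[OF lim_const_over_n[where 'a = real]])
      from tendsto_real_sqrt[OF this] have "a \<longlonglongrightarrow> 0" unfolding a_def by simp
      then have "(\<lambda>n. a (k n)) \<longlonglongrightarrow> 0" using LIMSEQ_subseq_LIMSEQ[OF _ k, of a 0] by (simp add: o_def)
      then show "(\<lambda>n. (a (k n) + b n) / \<mu>) \<longlonglongrightarrow> 0"
        using tendsto_divide[OF tendsto_add[OF _ w_lim] tendsto_const[of \<mu>], of "\<lambda>n. a (k n)" 0] \<mu> by (simp add: b_def)
      have "L2_norm M (\<lambda>x. f (k n) x - z x) \<le> (a (k n) + b n) / \<mu>" for n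
      proof -
        have mf: "(\<lambda>x. complex_of_real \<mu> * f (k n) x) \<in> L2_space M" by (intro L2_space_scale f_space)
        have "(\<lambda>x. f (k n) x - z x) = (\<lambda>x. complex_of_real (1 / \<mu>) * (complex_of_real \<mu> * f (k n) x - w x))"
          using \<mu> by (auto simp: z_def fun_eq_iff field_simps)
        then have "L2_norm M (\<lambda>x. f (k n) x - z x) = L2_norm M (\<lambda>x. complex_of_real \<mu> * f (k n) x - w x) / \<mu>"
          using \<mu> by (simp only: L2_norm_scale norm_of_real) simp
        also have "L2_norm M (\<lambda>x. complex_of_real \<mu> * f (k n) x - w x)
            \<le> L2_norm M (\<lambda>x. complex_of_real \<mu> * f (k n) x - S (T (f (k n))) x) + b n"
          unfolding b_def by (intro L2_norm_triangle_diff mf A_space w)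
        also have "L2_norm M (\<lambda>x. complex_of_real \<mu> * f (k n) x - S (T (f (k n))) x) \<le> a (k n)"
          unfolding a_def L2_norm_minus_commute[of M "\<lambda>x. complex_of_real \<mu> * f (k n) x"]
          using approx by (rule real_le_rsqrt)
        finally show ?thesis using \<mu> by (simp add: divide_right_mono)
      qed
      then show "\<forall>\<^sub>F n in sequentially. L2_norm M (\<lambda>x. f (k n) x - z x) \<le> (a (k n) + b n) / \<mu>" by simp
    qed auto
    have "z \<in> N"
    proof -
      have "L2_inner M z e = 0" if e: "e \<in> B" for e
      proof -
        have "(\<lambda>n. L2_inner M (f (k n)) e) \<longlonglongrightarrow> L2_inner M z e"
          by (intro L2_inner_tendsto f_space z B_space[OF e] z_lim)
        moreover have "L2_inner M (f (k n)) e = 0" for n using N1_space(3)[OF f] e by (auto simp: N_def)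
        ultimately show ?thesis by (simp add: LIMSEQ_const_iff)
      qed
      then show ?thesis using z by (simp add: N_def)
    qed
    moreover have "L2_norm M z = 1"
      using L2_norm_tendsto[OF f_space z z_lim] f_unit by (simp add: LIMSEQ_const_iff)
    moreover have "L2_inner M (T z) (T g) = complex_of_real \<mu> * L2_inner M z g" if g: "g \<in> L2_space M" for g
    proof -
      have "(\<lambda>n. L2_inner M (f (k n)) (S (T g))) \<longlonglongrightarrow> L2_inner M z (S (T g))"
        using g by (intro L2_inner_tendsto f_space z S_space T_space z_lim)
      moreover have "L2_inner M (f (k n)) (S (T g)) = L2_inner M (S (T (f (k n)))) g" for n
        using g by (simp add: adj adj' T_space f_space)
      moreover have "(\<lambda>n. L2_inner M (S (T (f (k n)))) g) \<longlonglongrightarrow> L2_inner M w g"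
        by (intro L2_inner_tendsto A_space w g w_lim)
      ultimately have "L2_inner M z (S (T g)) = L2_inner M w g" by (simp add: LIMSEQ_unique)
      also have "\<dots> = complex_of_real \<mu> * L2_inner M z g"
        using \<mu> unfolding z_def L2_inner_scale_left by simp
      finally show ?thesis using g z by (simp add: adj T_space)
    qed
    ultimately show ?thesis by blast
  qed
  then show ?thesis using singular_vectorI N_space unfolding N_def by blast
qed

end

lemma has_sum_finite_sum:
  fixes f :: "'b \<Rightarrow> 'i \<Rightarrow> 'c :: topological_comm_monoid_add"
  assumes "\<And>e. e \<in> F \<Longrightarrow> (f e has_sum s e) A"
  shows "((\<lambda>i. \<Sum>e\<in>F. f e i) has_sum (\<Sum>e\<in>F. s e)) A"
  using assms by (induction F rule: infinite_finite_induct) (auto intro: has_sum_add has_sum_0)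

section \<open>Singular basis, modulus and trace\<close>

context L2_nuclear
begin

text \<open>Zorn's lemma gives a maximal orthonormal family of singular vectors; were some nonzero
  element orthogonal to it, \<open>singular_vector_exists\<close> would enlarge the family. Unit
  vectors that \<open>T\<close> sends to zero count as singular, so the kernel is covered
  too.\<close>

lemma singular_basis_exists:
  "\<exists>B. L2_orthonormal_basis M B \<and> (\<forall>e\<in>B. singular_vector e)"
proof -
  define \<B> where "\<B> = {B. (\<forall>e\<in>B. singular_vector e) \<and>
    (\<forall>e\<in>B. \<forall>e'\<in>B. L2_inner M e e' = (if e = e' then 1 else 0))}"
  have "\<Union>\<C> \<in> \<B>" if chain: "subset.chain \<B> \<C>" for \<C>
  proof -
    have sub: "\<C> \<subseteq> \<B>" using chain by (simp add: subset.chain_def)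
    have "L2_inner M e e' = (if e = e' then 1 else 0)" if "e \<in> \<Union>\<C>" "e' \<in> \<Union>\<C>" for e e'
    proof -
      obtain B1 B2 where "B1 \<in> \<C>" "e \<in> B1" "B2 \<in> \<C>" "e' \<in> B2" using \<open>e \<in> \<Union>\<C>\<close> \<open>e' \<in> \<Union>\<C>\<close> by blast
      moreover have "B1 \<subseteq> B2 \<or> B2 \<subseteq> B1"
        using chain \<open>B1 \<in> \<C>\<close> \<open>B2 \<in> \<C>\<close> by (auto simp: subset.chain_def)
      ultimately obtain B where "B \<in> \<C>" "e \<in> B" "e' \<in> B" by blast
      then show ?thesis using sub unfolding \<B>_def by blast
    qed
    then show ?thesis using sub unfolding \<B>_def by blast
  qed
  from subset_Zorn'[of \<B>, OF this] obtain B where B: "B \<in> \<B>" and max: "\<And>X. X \<in> \<B> \<Longrightarrow> B \<subseteq> X \<Longrightarrow> X = B"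
    by blast
  have sing: "singular_vector e" if "e \<in> B" for e using B that by (simp add: \<B>_def)
  have on: "L2_inner M e e' = (if e = e' then 1 else 0)" if "e \<in> B" "e' \<in> B" for e e'
    using B that unfolding \<B>_def by blast
  have "AE x in M. f x = 0" if f: "f \<in> L2_space M" and orth: "\<And>e. e \<in> B \<Longrightarrow> L2_inner M f e = 0" for f
  proof (rule ccontr)
    assume "\<not> (AE x in M. f x = 0)"
    then have "L2_norm M f \<noteq> 0" using L2_norm_eq_0_iff[OF f] by blast
    then obtain h where h: "singular_vector h" "\<forall>e\<in>B. L2_inner M h e = 0"
      using singular_vector_exists[OF sing f _ orth] by blast
    have hh: "L2_inner M h h = 1" using h(1) by (simp add: singular_vector_def L2_inner_self)
    have eh: "L2_inner M e h = 0" if "e \<in> B" for e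
      using h(2) that L2_inner_cnj[of M h e] by simp
    have "h \<notin> B" using h(2) hh by auto
    have "insert h B \<in> \<B>"
      using h hh eh on sing \<open>h \<notin> B\<close> unfolding \<B>_def mem_Collect_eq by (metis insert_iff)
    then have "insert h B = B" by (rule max) blast
    with \<open>h \<notin> B\<close> show False by blast
  qed
  then have "L2_orthonormal_basis M B"
    using sing on unfolding L2_orthonormal_basis_def singular_vector_def by blast
  with sing show ?thesis by blast
qed

text \<open>For fixed \<open>i\<close>, Cauchy-Schwarz over \<open>F\<close> and then Bessel for
  both families, \<open>e\<close> and \<open>g e\<close>, bound the contribution of the rank one
  term by \<open>L2_norm M (u i) * L2_norm M (v i)\<close>, independently of
  \<open>F\<close>.\<close>

lemma sum_singular_values_le:
  assumes F: "finite F" and sing: "\<And>e. e \<in> F \<Longrightarrow> singular_vector e" and nz: "\<And>e. e \<in> F \<Longrightarrow> L2_norm M (T e) \<noteq> 0"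
    and on: "\<And>e e'. e \<in> F \<Longrightarrow> e' \<in> F \<Longrightarrow> L2_inner M e e' = (if e = e' then 1 else 0)"
  shows "(\<Sum>e\<in>F. L2_norm M (T e)) \<le> nuclear_bound"
proof -
  have F_space: "e \<in> L2_space M" if "e \<in> F" for e using sing[OF that] by (simp add: singular_vector_def)
  define g where "g e = (\<lambda>x. complex_of_real (1 / L2_norm M (T e)) * T e x)" for e
  have g_space: "g e \<in> L2_space M" if "e \<in> F" for e
    unfolding g_def by (intro L2_space_scale T_space F_space that)
  \<comment> \<open>Orthogonality of the \<open>e\<close> passes to their images because they are
    eigenvectors.\<close>
  have T_inner: "L2_inner M (T e) (T e') = complex_of_real ((L2_norm M (T e))\<^sup>2) * (if e = e' then 1 else 0)"
    if "e \<in> F" "e' \<in> F" for e e'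
    using sing[OF that(1)] F_space[OF that(2)] on[OF that] by (simp add: singular_vector_def)
  have g_on: "L2_inner M (g e) (g e') = (if e = e' then 1 else 0)" if "e \<in> F" "e' \<in> F" for e e'
    using T_inner[OF that] nz[OF that(1)] unfolding g_def L2_inner_scale_left L2_inner_scale_right
    by (auto simp: power2_eq_square)
  have T_g: "L2_inner M (T e) (g e) = complex_of_real (L2_norm M (T e))" if "e \<in> F" for e
    using T_inner[OF that that] nz[OF that] unfolding g_def L2_inner_scale_right
    by (simp add: power2_eq_square)
  have "((\<lambda>i. \<Sum>e\<in>F. L2_inner M e (v i) * L2_inner M (u i) (g e)) has_sum (\<Sum>e\<in>F. L2_inner M (T e) (g e))) I"
    using F_space g_space by (intro has_sum_finite_sum expansion)
  then have sum: "((\<lambda>i. \<Sum>e\<in>F. L2_inner M e (v i) * L2_inner M (u i) (g e))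
      has_sum complex_of_real (\<Sum>e\<in>F. L2_norm M (T e))) I"
    by (simp add: T_g)
  have "norm (complex_of_real (\<Sum>e\<in>F. L2_norm M (T e))) \<le> nuclear_bound"
  proof (rule norm_has_sum_le[OF sum has_sum_nuclear_bound])
    fix i assume i: "i \<in> I"
    have "norm (\<Sum>e\<in>F. L2_inner M e (v i) * L2_inner M (u i) (g e))
        \<le> (\<Sum>e\<in>F. \<bar>cmod (L2_inner M (v i) e)\<bar> * \<bar>cmod (L2_inner M (u i) (g e))\<bar>)"
    proof (rule sum_norm_le)
      fix e
      have "cmod (L2_inner M e (v i)) = cmod (L2_inner M (v i) e)"
        by (metis L2_inner_cnj complex_mod_cnj)
      then show "norm (L2_inner M e (v i) * L2_inner M (u i) (g e))
          \<le> \<bar>cmod (L2_inner M (v i) e)\<bar> * \<bar>cmod (L2_inner M (u i) (g e))\<bar>" by (simp add: norm_mult)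
    qed
    also have "\<dots> \<le> L2_set (\<lambda>e. cmod (L2_inner M (v i) e)) F * L2_set (\<lambda>e. cmod (L2_inner M (u i) (g e))) F"
      by (rule L2_set_mult_ineq)
    also have "\<dots> \<le> L2_norm M (v i) * L2_norm M (u i)"
      unfolding L2_set_def
      using L2_Bessel[OF F F_space on v[OF i]] L2_Bessel[OF F g_space g_on u[OF i]]
      by (intro mult_mono real_le_lsqrt real_sqrt_ge_zero sum_nonneg) auto
    finally show "norm (\<Sum>e\<in>F. L2_inner M e (v i) * L2_inner M (u i) (g e)) \<le> L2_norm M (u i) * L2_norm M (v i)"
      by (simp add: mult.commute)
  qed
  then show ?thesis unfolding norm_of_real by linarith
qed

lemma trace_class: "L2_trace_class M T"
proof -
  obtain S where S: "L2_adjoint M T S" using adjoint_exists by blast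
  have S_space: "S g \<in> L2_space M" if "g \<in> L2_space M" for g
    using S that L2_operatorD(1) by (auto simp: L2_adjoint_def)
  have adj: "L2_inner M (S g) f = L2_inner M g (T f)" if "f \<in> L2_space M" "g \<in> L2_space M" for f g
    using S that L2_inner_cnj unfolding L2_adjoint_def by metis
  obtain B where basis: "L2_orthonormal_basis M B" and sing: "\<And>e. e \<in> B \<Longrightarrow> singular_vector e"
    using singular_basis_exists by blast
  have B_space: "e \<in> L2_space M" if "e \<in> B" for e
    using basis that by (auto simp: L2_orthonormal_basis_def)
  have B_unit: "L2_norm M e = 1" if "e \<in> B" for e
    using sing[OF that] by (simp add: singular_vector_def)
  have on: "L2_inner M e e' = (if e = e' then 1 else 0)" if "e \<in> B" "e' \<in> B" for e e'
    using basis that by (auto simp: L2_orthonormal_basis_def)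
  have complete: "AE x in M. f x = 0" if "f \<in> L2_space M" "\<And>e. e \<in> B \<Longrightarrow> L2_inner M f e = 0" for f
    using basis that by (auto simp: L2_orthonormal_basis_def)
  define s where "s e = L2_norm M (T e)" for e
  have s_nonneg: "s e \<ge> 0" for e by (simp add: s_def)
  \<comment> \<open>The basis may be uncountable, but summability leaves only countably many nonzero
    singular values, and over these \<open>L2_weak_sum\<close> applies.\<close>
  define B' where "B' = {e \<in> B. s e \<noteq> 0}"
  have B'_sub: "B' \<subseteq> B" by (auto simp: B'_def)
  have "s summable_on B'"
  proof (rule nonneg_bdd_above_summable_on)
    show "bdd_above (sum s ` {F. F \<subseteq> B' \<and> finite F})"
    proof (rule bdd_aboveI2)
      fix F assume "F \<in> {F. F \<subseteq> B' \<and> finite F}"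
      then have F: "finite F" "\<And>e. e \<in> F \<Longrightarrow> e \<in> B" "\<And>e. e \<in> F \<Longrightarrow> L2_norm M (T e) \<noteq> 0"
        by (auto simp: B'_def s_def)
      show "sum s F \<le> nuclear_bound"
        unfolding s_def by (rule sum_singular_values_le[OF F(1)]) (simp_all add: F sing on)
    qed
  qed (rule s_nonneg)
  then have s_B: "s summable_on B"
    by (subst summable_on_cong_neutral[where T = B' and g = s]) (auto simp: B'_def)
  have B'_countable: "countable B'" unfolding B'_def using s_B by (rule summable_countable_real)
  define D where "D = (\<Sum>\<^sub>\<infinity>e\<in>B'. s e)"
  have D: "(s has_sum D) B'" unfolding D_def using \<open>s summable_on B'\<close> by (rule has_sum_infsum)
  have D_nonneg: "D \<ge> 0" using D s_nonneg by (rule has_sum_nonneg)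
  \<comment> \<open>The modulus is diagonal in the singular basis: \<open>P f\<close> is the sum of
    \<open>s e * L2_inner M f e\<close> times \<open>e\<close>.\<close>
  have "\<exists>p\<in>L2_space M. \<forall>h\<in>L2_space M.
      ((\<lambda>e. complex_of_real (s e) * L2_inner M f e * L2_inner M e h) has_sum L2_inner M p h) B'"
    if f: "f \<in> L2_space M" for f
  proof -
    have "(\<lambda>e. L2_norm M (\<lambda>x. (complex_of_real (s e) * L2_inner M f e) * e x)) summable_on B'"
    proof (rule summable_on_comparison_test)
      show "(\<lambda>e. s e * L2_norm M f) summable_on B'"
        using \<open>s summable_on B'\<close> by (rule summable_on_cmult_left)
      fix e assume "e \<in> B'"
      then have e: "e \<in> B" using B'_sub by blast
      have "cmod (L2_inner M f e) \<le> L2_norm M f"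
        using L2_Cauchy_Schwarz[OF f B_space[OF e]] B_unit[OF e] by simp
      then show "L2_norm M (\<lambda>x. (complex_of_real (s e) * L2_inner M f e) * e x) \<le> s e * L2_norm M f"
        unfolding L2_norm_scale norm_mult norm_of_real using B_unit[OF e] s_nonneg
        by (simp add: mult_left_mono)
    qed simp
    from L2_weak_sum[OF B'_countable _ this] show ?thesis
      using B_space B'_sub unfolding L2_inner_scale_left by (auto intro: L2_space_scale)
  qed
  then obtain P where P_space: "\<And>f. f \<in> L2_space M \<Longrightarrow> P f \<in> L2_space M"
    and P: "\<And>f h. f \<in> L2_space M \<Longrightarrow> h \<in> L2_space M \<Longrightarrow>
      ((\<lambda>e. complex_of_real (s e) * L2_inner M f e * L2_inner M e h) has_sum L2_inner M (P f) h) B'"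
    by metis
  have B'_on: "e \<in> L2_space M" "L2_norm M e = 1" if "e \<in> B'" for e
    using that B'_sub B_space B_unit by auto
  have P_op: "L2_operator M P"
  proof (rule L2_operatorI_weak[OF P_space _ _ D_nonneg])
    fix f g h a b assume f: "f \<in> L2_space M" and g: "g \<in> L2_space M" and h: "h \<in> L2_space M"
    have fg: "(\<lambda>y. a * f y + b * g y) \<in> L2_space M" by (intro L2_space_intros f g)
    have "((\<lambda>e. a * (complex_of_real (s e) * L2_inner M f e * L2_inner M e h) +
        b * (complex_of_real (s e) * L2_inner M g e * L2_inner M e h)) has_sum
        (a * L2_inner M (P f) h + b * L2_inner M (P g) h)) B'"
      by (intro has_sum_add has_sum_cmult_right P f g h)
    moreover have "a * (complex_of_real (s e) * L2_inner M f e * L2_inner M e h) +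
        b * (complex_of_real (s e) * L2_inner M g e * L2_inner M e h) =
        complex_of_real (s e) * L2_inner M (\<lambda>y. a * f y + b * g y) e * L2_inner M e h" if "e \<in> B'" for e
      using B'_on[OF that] f g
      by (simp add: L2_inner_add_left L2_inner_scale_left L2_space_scale algebra_simps)
    ultimately have "((\<lambda>e. complex_of_real (s e) * L2_inner M (\<lambda>y. a * f y + b * g y) e * L2_inner M e h) has_sum
        (a * L2_inner M (P f) h + b * L2_inner M (P g) h)) B'"
      by (simp cong: has_sum_cong)
    from has_sum_unique[OF P[OF fg h] this]
    show "L2_inner M (P (\<lambda>y. a * f y + b * g y)) h = a * L2_inner M (P f) h + b * L2_inner M (P g) h" .
  next
    fix f h assume f: "f \<in> L2_space M" and h: "h \<in> L2_space M"
    have "norm (L2_inner M (P f) h) \<le> D * (L2_norm M f * L2_norm M h)"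
    proof (rule norm_has_sum_le[OF P[OF f h] has_sum_cmult_left[OF D]])
      fix e assume e: "e \<in> B'"
      have "cmod (L2_inner M f e) \<le> L2_norm M f" "cmod (L2_inner M e h) \<le> L2_norm M h"
        using L2_Cauchy_Schwarz[OF f B'_on(1)[OF e]] L2_Cauchy_Schwarz[OF B'_on(1)[OF e] h] B'_on(2)[OF e] by auto
      then show "norm (complex_of_real (s e) * L2_inner M f e * L2_inner M e h) \<le> s e * (L2_norm M f * L2_norm M h)"
        unfolding norm_mult norm_of_real using s_nonneg[of e]
        by (simp add: mult.assoc mult_left_mono mult_mono)
    qed
    then show "cmod (L2_inner M (P f) h) \<le> D * L2_norm M f * L2_norm M h" by (simp add: mult.assoc)
  qed
  have P_pos: "L2_inner M (P f) f \<in> \<real>\<^sub>\<ge>\<^sub>0" if f: "f \<in> L2_space M" for f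
  proof -
    have "complex_of_real (s e) * L2_inner M f e * L2_inner M e f = complex_of_real (s e * (cmod (L2_inner M f e))\<^sup>2)" for e
      by (simp add: complex_norm_square L2_inner_cnj mult.assoc del: of_real_power)
    then have sum: "((\<lambda>e. complex_of_real (s e * (cmod (L2_inner M f e))\<^sup>2)) has_sum L2_inner M (P f) f) B'"
      using P[OF f f] by (simp only:)
    have "Re (L2_inner M (P f) f) \<ge> 0"
      using has_sum_Re[OF sum] by (rule has_sum_nonneg) (simp add: s_nonneg del: of_real_mult)
    moreover have "Im (L2_inner M (P f) f) = 0"
      by (rule has_sum_unique[OF has_sum_Im[OF sum] has_sum_0]) simp
    ultimately show ?thesis by (simp add: complex_nonneg_Reals_iff)
  qed
  have P_e: "L2_inner M (P f) e = complex_of_real (s e) * L2_inner M f e" if f: "f \<in> L2_space M" and e: "e \<in> B" for f e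
  proof -
    have "((\<lambda>e'. complex_of_real (s e') * L2_inner M f e' * L2_inner M e' e) has_sum
        complex_of_real (s e) * L2_inner M f e) B'"
    proof (rule has_sum_finite_neutralI[where B = "{e} \<inter> B'"])
      show "complex_of_real (s e') * L2_inner M f e' * L2_inner M e' e = 0" if "e' \<in> B' - {e} \<inter> B'" for e'
        using that e B'_sub by (subst on) auto
      show "complex_of_real (s e) * L2_inner M f e =
          (\<Sum>e'\<in>{e} \<inter> B'. complex_of_real (s e') * L2_inner M f e' * L2_inner M e' e)"
        using e on[OF e e] by (cases "e \<in> B'") (auto simp: B'_def)
    qed auto
    with P[OF f B_space[OF e]] show ?thesis by (rule has_sum_unique)
  qed
  \<comment> \<open>Both sides have the coordinate \<open>(s e)\<^sup>2 * L2_inner M f e\<close> at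
    each basis vector \<open>e\<close>, and completeness of the basis concludes.\<close>
  have PP: "AE x in M. P (P f) x = S (T f) x" if f: "f \<in> L2_space M" for f
  proof -
    have PPf: "P (P f) \<in> L2_space M" and STf: "S (T f) \<in> L2_space M"
      using f P_space S_space T_space by auto
    have "AE x in M. P (P f) x - S (T f) x = 0"
    proof (rule complete)
      show "(\<lambda>x. P (P f) x - S (T f) x) \<in> L2_space M" by (intro L2_space_diff PPf STf)
      fix e assume e: "e \<in> B"
      have "L2_inner M (P (P f)) e = complex_of_real ((s e)\<^sup>2) * L2_inner M f e"
        using f e by (simp add: P_e P_space power2_eq_square)
      also have "\<dots> = cnj (complex_of_real ((s e)\<^sup>2) * L2_inner M e f)"
        by (simp add: L2_inner_cnj)
      also have "complex_of_real ((s e)\<^sup>2) * L2_inner M e f = L2_inner M (T e) (T f)"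
        using sing[OF e] f by (auto simp: singular_vector_def s_def)
      also have "cnj \<dots> = L2_inner M (S (T f)) e"
        using f B_space[OF e] by (simp add: adj T_space L2_inner_cnj)
      finally show "L2_inner M (\<lambda>x. P (P f) x - S (T f) x) e = 0"
        by (simp add: L2_inner_diff_left PPf STf B_space[OF e])
    qed
    then show ?thesis by simp
  qed
  have "L2_abs M T P"
    unfolding L2_abs_def L2_positive_def using P_op P_pos S PP by blast
  moreover have "(\<lambda>e. L2_inner M (P e) e) summable_on B"
  proof -
    have "(\<lambda>e. complex_of_real (s e)) summable_on B" using s_B by (rule summable_on_of_real)
    then show ?thesis using on by (subst summable_on_cong[where g = "\<lambda>e. complex_of_real (s e)"]) (auto simp: P_e B_space)
  qed
  ultimately show ?thesis unfolding L2_trace_class_def using T basis by blast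
qed

end

section \<open>Uniqueness for the Fourier transform\<close>

text \<open>\<open>lebesgue\<close> is the completion of \<open>lborel\<close>, and Fubini for
  \<open>lebesgue\<close> needs sigma-finiteness.\<close>

lemma sigma_finite_measure_completion:
  assumes "sigma_finite_measure M"
  shows "sigma_finite_measure (completion M)"
proof -
  interpret sigma_finite_measure M by (rule assms)
  obtain A where "countable A" "A \<subseteq> sets M" "\<Union>A = space M" "\<forall>a\<in>A. emeasure M a \<noteq> \<infinity>"
    using sigma_finite_countable by blast
  then show ?thesis
    by (intro sigma_finite_measure.intro exI[of _ A]) auto
qed

lemma pair_sigma_finite_lebesgue: "pair_sigma_finite (lebesgue :: real measure) (lebesgue :: real measure)"
  by (intro pair_sigma_finite.intro sigma_finite_measure_completion sigma_finite_lborel)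

lemma ident_lebesgue_borel_measurable:
  "(\<lambda>x :: 'b::euclidean_space. x) \<in> lebesgue \<rightarrow>\<^sub>M borel"
  by (rule measurable_completion) simp

text \<open>Coarsening the target sigma-algebra makes the projections of
  \<open>lebesgue \<Otimes>\<^sub>M lebesgue\<close> Borel functions, so that continuous kernels on
  the product are measurable.\<close>

lemma measurable_lebesgue_imp_borel:
  "f \<in> N \<rightarrow>\<^sub>M lebesgue \<Longrightarrow> f \<in> borel_measurable N" for f :: "'a \<Rightarrow> 'b::euclidean_space"
  using measurable_comp[OF _ ident_lebesgue_borel_measurable] by (simp add: o_def)

lemma iexp_kernel_measurable [measurable]:
  "(\<lambda>p. exp (\<i> * complex_of_real (fst p * snd p))) \<in> borel_measurable (lebesgue \<Otimes>\<^sub>M lebesgue)"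
proof -
  have [measurable]: "fst \<in> borel_measurable (lebesgue \<Otimes>\<^sub>M (lebesgue :: real measure))"
    "snd \<in> borel_measurable ((lebesgue :: real measure) \<Otimes>\<^sub>M lebesgue)"
    by (auto intro: measurable_lebesgue_imp_borel)
  show ?thesis by measurable
qed

lemma iexp_lebesgue_measurable [measurable]:
  "(\<lambda>x. exp (\<i> * complex_of_real (t * x))) \<in> borel_measurable lebesgue"
  by (rule measurable_completion) measurable

lemma norm_iexp [simp]: "cmod (exp (\<i> * complex_of_real x)) = 1"
  by simp

lemma integrable_iexp_mult:
  assumes "integrable lebesgue f"
  shows "integrable lebesgue (\<lambda>x. exp (\<i> * complex_of_real (t * x)) * f x)"
proof (rule Bochner_Integration.integrable_bound[OF assms])
  have [measurable]: "f \<in> borel_measurable lebesgue" using assms by simp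
  show "(\<lambda>x. exp (\<i> * complex_of_real (t * x)) * f x) \<in> borel_measurable lebesgue" by measurable
qed (simp add: norm_mult)

text \<open>The positive and negative parts of \<open>r\<close> have the same Fourier transform, in
  particular the same mass \<open>c\<close>. If \<open>c\<close> is 0 both vanish; otherwise,
  divided by \<open>c\<close>, they are probability densities with equal characteristic functions,
  and Levy's uniqueness theorem identifies them.\<close>

lemma iexp_integral_real_eq_0_imp:
  assumes r: "integrable lborel r" and zero: "\<And>t. (LINT x|lborel. exp (\<i> * complex_of_real (t * x)) * complex_of_real (r x)) = 0"
  shows "AE x in lborel. r x = (0::real)"
proof -
  have [measurable]: "r \<in> borel_measurable borel" using r by auto
  define p where "p x = max 0 (r x)" for x
  define n where "n x = max 0 (- r x)" for x
  have [measurable]: "p \<in> borel_measurable borel" "n \<in> borel_measurable borel"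
    by (simp_all add: p_def[abs_def] n_def[abs_def])
  have p: "integrable lborel p" and n: "integrable lborel n"
    using r by (simp_all add: p_def[abs_def] n_def[abs_def])
  have pos: "p x \<ge> 0" "n x \<ge> 0" for x by (simp_all add: p_def n_def)
  have r_eq: "r x = p x - n x" for x by (simp add: p_def n_def)
  have int: "integrable lborel (\<lambda>x. exp (\<i> * complex_of_real (t * x)) * complex_of_real (q x))"
    if "integrable lborel q" for q t
  proof (rule Bochner_Integration.integrable_bound[OF that])
    have [measurable]: "q \<in> borel_measurable borel" using that by auto
    show "(\<lambda>x. exp (\<i> * complex_of_real (t * x)) * complex_of_real (q x)) \<in> borel_measurable lborel" by measurable
  qed (simp add: norm_mult)
  have eq: "(LINT x|lborel. exp (\<i> * complex_of_real (t * x)) * complex_of_real (p x)) =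
      (LINT x|lborel. exp (\<i> * complex_of_real (t * x)) * complex_of_real (n x))" for t
    using zero[of t] int[OF p, of t] int[OF n, of t]
    by (simp add: r_eq algebra_simps Bochner_Integration.integral_diff)
  define c where "c = integral\<^sup>L lborel p"
  have c_n: "c = integral\<^sup>L lborel n"
    using eq[of 0] by (simp add: c_def integral_complex_of_real)
  have c_nonneg: "c \<ge> 0" unfolding c_def using pos by simp
  show ?thesis
  proof (cases "c = 0")
    case True
    then have "AE x in lborel. p x = 0" "AE x in lborel. n x = 0"
      using integral_nonneg_eq_0_iff_AE[OF p] integral_nonneg_eq_0_iff_AE[OF n] pos c_n by (auto simp: c_def)
    then show ?thesis by eventually_elim (simp add: r_eq)
  next
    case False
    then have c: "c > 0" using c_nonneg by simp
    define D where "D q = density lborel (\<lambda>x. ennreal (q x / c))" for q :: "real \<Rightarrow> real"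
    have D_char: "char (D q) t = (LINT x|lborel. exp (\<i> * complex_of_real (t * x)) * complex_of_real (q x)) / c"
      if [measurable]: "q \<in> borel_measurable borel" and q: "\<And>x. q x \<ge> 0" for q t
    proof -
      have "char (D q) t = (LINT x|lborel. (q x / c) *\<^sub>R exp (\<i> * complex_of_real (t * x)))"
        unfolding char_def D_def using q c by (intro integral_density) auto
      also have "\<dots> = (LINT x|lborel. exp (\<i> * complex_of_real (t * x)) * complex_of_real (q x) / c)"
        by (intro Bochner_Integration.integral_cong) (auto simp: scaleR_conv_of_real)
      finally show ?thesis by simp
    qed
    have D_dist: "real_distribution (D q)"
      if q_int: "integrable lborel q" and q: "\<And>x. q x \<ge> 0" and "c = integral\<^sup>L lborel q" for q
    proof -
      have [measurable]: "q \<in> borel_measurable borel" using q_int by auto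
      have "(\<integral>\<^sup>+x. ennreal (q x / c) \<partial>lborel) = ennreal (LINT x|lborel. q x / c)"
        using q_int q c by (intro nn_integral_eq_integral) auto
      also have "(LINT x|lborel. q x / c) = 1" using that(3) c by simp
      finally have "prob_space (D q)"
        by (intro prob_spaceI) (simp add: D_def emeasure_density)
      then show ?thesis by (auto simp: real_distribution_def real_distribution_axioms_def D_def)
    qed
    have "D p = D n"
    proof (rule Levy_uniqueness)
      show "char (D p) = char (D n)" by (rule ext) (simp only: D_char[OF _ pos(1)] D_char[OF _ pos(2)] eq \<open>p \<in> borel_measurable borel\<close> \<open>n \<in> borel_measurable borel\<close>)
    qed (use D_dist p n pos c_def c_n in auto)
    then have "AE x in lborel. ennreal (p x / c) = ennreal (n x / c)"
      unfolding D_def by (intro sigma_finite_measure.density_unique[OF sigma_finite_lborel]) auto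
    then show ?thesis by eventually_elim (use pos c in \<open>simp add: r_eq\<close>)
  qed
qed

text \<open>Real and imaginary parts reduce to the real case, because conjugating \<open>q\<close>
  only replaces \<open>t\<close> by \<open>- t\<close>. The passage from \<open>lebesgue\<close> to
  \<open>lborel\<close> goes through a Borel representative.\<close>

lemma iexp_integral_eq_0_imp:
  fixes q :: "real \<Rightarrow> complex"
  assumes q: "integrable lebesgue q" and zero: "\<And>t. (LINT x|lebesgue. exp (\<i> * complex_of_real (t * x)) * q x) = 0"
  shows "AE x in lebesgue. q x = 0"
proof -
  have real_case: "AE x in lebesgue. r x = 0"
    if r: "integrable lebesgue r"
      and r_zero: "\<And>t. (LINT x|lebesgue. exp (\<i> * complex_of_real (t * x)) * complex_of_real (r x)) = 0"
    for r :: "real \<Rightarrow> real"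
  proof -
    obtain r' where [measurable]: "r' \<in> borel_measurable lborel" and ae: "AE x in lborel. r x = r' x"
      using completion_ex_borel_measurable_real[of r lborel] r by auto
    have ae': "AE x in lebesgue. r x = r' x" using ae by (rule AE_completion)
    have [measurable]: "r \<in> borel_measurable lebesgue" using r by auto
    have "r' \<in> borel_measurable lebesgue" by (rule measurable_completion) simp
    then have "integrable lebesgue r'" using ae' r by (subst integrable_cong_AE[where g = r]) auto
    then have "integrable lborel r'" by (simp add: integrable_completion)
    moreover have "(LINT x|lborel. exp (\<i> * complex_of_real (t * x)) * complex_of_real (r' x)) = 0" for t
    proof -
      have [measurable]: "r' \<in> borel_measurable lebesgue" by fact
      have "(LINT x|lborel. exp (\<i> * complex_of_real (t * x)) * complex_of_real (r' x))
          = (LINT x|lebesgue. exp (\<i> * complex_of_real (t * x)) * complex_of_real (r' x))"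
        by (subst integral_completion) auto
      also have "\<dots> = (LINT x|lebesgue. exp (\<i> * complex_of_real (t * x)) * complex_of_real (r x))"
        using ae' by (intro integral_cong_AE) (measurable, auto)
      finally show ?thesis by (simp only: r_zero)
    qed
    ultimately have "AE x in lborel. r' x = 0" by (rule iexp_integral_real_eq_0_imp)
    then have "AE x in lebesgue. r' x = 0" by (rule AE_completion)
    with ae' show ?thesis by eventually_elim simp
  qed
  have cq: "integrable lebesgue (\<lambda>x. cnj (q x))" using q by simp
  have zero_cnj: "(LINT x|lebesgue. exp (\<i> * complex_of_real (t * x)) * cnj (q x)) = 0" for t
  proof -
    have "(LINT x|lebesgue. exp (\<i> * complex_of_real (t * x)) * cnj (q x))
        = cnj (LINT x|lebesgue. exp (\<i> * complex_of_real (- t * x)) * q x)"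
      by (subst Bochner_Integration.integral_cnj[symmetric]) (simp add: exp_cnj)
    then show ?thesis using zero[of "- t"] by simp
  qed
  have "(LINT x|lebesgue. exp (\<i> * complex_of_real (t * x)) * complex_of_real (Re (q x))) = 0" for t
  proof -
    have "(\<lambda>x. exp (\<i> * complex_of_real (t * x)) * complex_of_real (Re (q x))) =
        (\<lambda>x. (exp (\<i> * complex_of_real (t * x)) * q x + exp (\<i> * complex_of_real (t * x)) * cnj (q x)) / 2)"
      by (simp add: complex_add_cnj fun_eq_iff flip: distrib_left)
    then show ?thesis
      using zero[of t] zero_cnj[of t] integrable_iexp_mult[OF q, of t] integrable_iexp_mult[OF cq, of t] by simp
  qed
  moreover have "(LINT x|lebesgue. exp (\<i> * complex_of_real (t * x)) * complex_of_real (Im (q x))) = 0" for t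
  proof -
    have "(\<lambda>x. exp (\<i> * complex_of_real (t * x)) * complex_of_real (Im (q x))) =
        (\<lambda>x. (exp (\<i> * complex_of_real (t * x)) * q x - exp (\<i> * complex_of_real (t * x)) * cnj (q x)) / (2 * \<i>))"
    proof
      fix x
      have "complex_of_real (Im (q x)) = (q x - cnj (q x)) / (2 * \<i>)" by (simp add: complex_eq_iff)
      then show "exp (\<i> * complex_of_real (t * x)) * complex_of_real (Im (q x)) =
          (exp (\<i> * complex_of_real (t * x)) * q x - exp (\<i> * complex_of_real (t * x)) * cnj (q x)) / (2 * \<i>)"
        by (simp only: right_diff_distrib times_divide_eq_right)
    qed
    then show ?thesis
      using zero[of t] zero_cnj[of t] integrable_iexp_mult[OF q, of t] integrable_iexp_mult[OF cq, of t] by simp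
  qed
  ultimately have "AE x in lebesgue. Re (q x) = 0" "AE x in lebesgue. Im (q x) = 0"
    using q by (intro real_case; simp)+
  then show ?thesis by eventually_elim (simp add: complex_eq_iff)
qed

section \<open>The Fourier integral of integrable functions\<close>

lemma fourier_integral_measurable:
  assumes "integrable lebesgue f"
  shows "fourier_integral f \<in> borel_measurable lebesgue"
proof -
  interpret pair_sigma_finite "lebesgue :: real measure" "lebesgue :: real measure"
    by (rule pair_sigma_finite_lebesgue)
  have [measurable]: "f \<in> borel_measurable lebesgue" using assms by simp
  have "(\<lambda>t. LINT \<xi>|lebesgue. exp (\<i> * complex_of_real (t * \<xi>)) * f \<xi>) \<in> borel_measurable lebesgue"
    by (rule sigma_finite_measure.borel_measurable_lebesgue_integral[OF sigma_finite_measure_completion[OF sigma_finite_lborel]])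
      (simp add: case_prod_beta' del: of_real_mult)
  then show ?thesis unfolding fourier_integral_def by measurable
qed

lemma fourier_integral_bound:
  assumes "integrable lebesgue f"
  shows "cmod (fourier_integral f t) \<le> (LINT x|lebesgue. cmod (f x)) / sqrt (2 * pi)"
proof -
  have "cmod (LINT \<xi>|lebesgue. exp (\<i> * complex_of_real (t * \<xi>)) * f \<xi>)
      \<le> (LINT \<xi>|lebesgue. cmod (exp (\<i> * complex_of_real (t * \<xi>)) * f \<xi>))"
    by (rule integral_norm_bound)
  then have "cmod (LINT \<xi>|lebesgue. exp (\<i> * complex_of_real (t * \<xi>)) * f \<xi>) \<le> (LINT x|lebesgue. cmod (f x))"
    by (simp add: norm_mult)
  then show ?thesis unfolding fourier_integral_def by (simp add: norm_mult norm_divide divide_right_mono)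
qed

lemma integrable_fourier_integral_mult:
  assumes f: "integrable lebesgue f" and h: "integrable lebesgue h"
  shows "integrable lebesgue (\<lambda>t. fourier_integral f t * h t)"
proof (rule Bochner_Integration.integrable_bound)
  show "integrable lebesgue (\<lambda>t. complex_of_real ((LINT x|lebesgue. cmod (f x)) / sqrt (2 * pi)) * h t)"
    using h by simp
  show "(\<lambda>t. fourier_integral f t * h t) \<in> borel_measurable lebesgue"
    using fourier_integral_measurable[OF f] h by auto
  show "AE t in lebesgue. norm (fourier_integral f t * h t)
      \<le> norm (complex_of_real ((LINT x|lebesgue. cmod (f x)) / sqrt (2 * pi)) * h t)"
    unfolding norm_mult norm_of_real
    using fourier_integral_bound[OF f] by (intro AE_I2 mult_right_mono) (auto intro: order_trans)
qed

text \<open>The kernel is symmetric in \<open>t\<close> and \<open>\<xi>\<close> and of modulus 1,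
  so Fubini applies to its product with \<open>f\<close> and \<open>h\<close>.\<close>

lemma fourier_integral_multiplication:
  assumes f: "integrable lebesgue f" and h: "integrable lebesgue h"
  shows "(LINT t|lebesgue. fourier_integral f t * h t) = (LINT \<xi>|lebesgue. f \<xi> * fourier_integral h \<xi>)"
proof -
  interpret pair_sigma_finite "lebesgue :: real measure" "lebesgue :: real measure"
    by (rule pair_sigma_finite_lebesgue)
  have [measurable]: "f \<in> borel_measurable lebesgue" "h \<in> borel_measurable lebesgue" using f h by auto
  define K where "K p = exp (\<i> * complex_of_real (fst p * snd p)) * f (snd p) * h (fst p)" for p
  have K: "integrable (lebesgue \<Otimes>\<^sub>M lebesgue) K"
  proof (rule Fubini_integrable)
    show "K \<in> borel_measurable (lebesgue \<Otimes>\<^sub>M lebesgue)" unfolding K_def by measurable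
    show "integrable lebesgue (\<lambda>x. LINT y|lebesgue. norm (K (x, y)))"
      using h by (simp add: K_def norm_mult)
    show "AE x in lebesgue. integrable lebesgue (\<lambda>y. K (x, y))"
      using integrable_iexp_mult[OF f] by (simp add: K_def)
  qed
  have "(LINT t|lebesgue. (LINT \<xi>|lebesgue. exp (\<i> * complex_of_real (t * \<xi>)) * f \<xi>) * h t)
      = (LINT t|lebesgue. LINT \<xi>|lebesgue. K (t, \<xi>))"
    by (simp add: K_def)
  also have "\<dots> = (LINT \<xi>|lebesgue. LINT t|lebesgue. K (t, \<xi>))"
    using Fubini_integral[of "\<lambda>x y. K (x, y)"] K by simp
  also have "\<dots> = (LINT \<xi>|lebesgue. LINT t|lebesgue. f \<xi> * (exp (\<i> * complex_of_real (\<xi> * t)) * h t))"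
    by (simp add: K_def mult_ac)
  also have "\<dots> = (LINT \<xi>|lebesgue. f \<xi> * (LINT t|lebesgue. exp (\<i> * complex_of_real (\<xi> * t)) * h t))"
    by simp
  finally show ?thesis
    unfolding fourier_integral_def by (simp add: mult.assoc mult.left_commute[of "f _"])
qed

lemma lebesgue_integral_affine:
  fixes f :: "real \<Rightarrow> complex"
  assumes "f \<in> borel_measurable borel" "c \<noteq> 0"
  shows "(LINT x|lebesgue. f x) = complex_of_real \<bar>c\<bar> * (LINT x|lebesgue. f (t + c * x))"
proof -
  have "(\<lambda>x. f (t + c * x)) \<in> borel_measurable lborel" using assms(1) by measurable
  then show ?thesis
    using assms lborel_integral_real_affine[OF assms(2), of f t]
    by (simp add: integral_completion scaleR_conv_of_real)
qed

text \<open>Rescaling by \<open>\<sigma>\<close> reduces to the characteristic function of the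
  standard normal distribution. For \<open>\<sigma> = 1\<close> the Gaussian is its own
  transform.\<close>

lemma fourier_integral_gaussian:
  assumes \<sigma>: "\<sigma> > 0"
  shows "fourier_integral (\<lambda>x. complex_of_real (exp (- (x / \<sigma>)\<^sup>2 / 2))) t
    = complex_of_real (\<sigma> * exp (- (\<sigma> * t)\<^sup>2 / 2))"
proof -
  have "(LINT x|lebesgue. exp (\<i> * complex_of_real (t * x)) * complex_of_real (exp (- (x / \<sigma>)\<^sup>2 / 2)))
      = complex_of_real \<sigma> * (LINT x|lebesgue. exp (\<i> * complex_of_real (t * (\<sigma> * x))) * complex_of_real (exp (- x\<^sup>2 / 2)))"
    using \<sigma> by (subst lebesgue_integral_affine[of _ \<sigma> 0]) auto
  also have "(LINT x|lebesgue. exp (\<i> * complex_of_real (t * (\<sigma> * x))) * complex_of_real (exp (- x\<^sup>2 / 2)))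
      = (LINT x|lborel. complex_of_real (sqrt (2 * pi)) * (exp (\<i> * complex_of_real (\<sigma> * t * x)) * complex_of_real (std_normal_density x)))"
    by (subst integral_completion)
       (auto simp: std_normal_density_def scaleR_conv_of_real mult_ac intro!: Bochner_Integration.integral_cong)
  also have "\<dots> = complex_of_real (sqrt (2 * pi)) * char std_normal_distribution (\<sigma> * t)"
    unfolding char_def by (subst integral_density) (auto simp: scaleR_conv_of_real mult.commute)
  also have "char std_normal_distribution (\<sigma> * t) = complex_of_real (exp (- (\<sigma> * t)\<^sup>2 / 2))"
    by (simp add: char_std_normal_distribution)
  finally show ?thesis unfolding fourier_integral_def by (simp add: mult_ac)
qed

section \<open>The Plancherel transform\<close>

lemma fourier_integral_modulation:
  "fourier_integral (\<lambda>x. g x * exp (\<i> * complex_of_real (b * x))) t = fourier_integral g (t + b)"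
proof -
  have "exp (\<i> * complex_of_real (t * x)) * (g x * exp (\<i> * complex_of_real (b * x)))
      = exp (\<i> * complex_of_real ((t + b) * x)) * g x" for x
    by (simp add: algebra_simps exp_add)
  then show ?thesis by (simp only: fourier_integral_def)
qed

lemma fourier_integral_shift:
  assumes [measurable]: "g \<in> borel_measurable borel"
  shows "fourier_integral (\<lambda>x. g (x + b)) t = exp (- \<i> * complex_of_real (b * t)) * fourier_integral g t"
proof -
  have "(LINT x|lebesgue. exp (\<i> * complex_of_real (t * x)) * g (x + b))
      = (LINT x|lebesgue. exp (\<i> * complex_of_real (t * (- b + x))) * g (- b + x + b))"
    by (subst lebesgue_integral_affine[of _ 1 "- b"]) auto
  also have "\<dots> = (LINT x|lebesgue. exp (- \<i> * complex_of_real (b * t)) * (exp (\<i> * complex_of_real (t * x)) * g x))"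
    by (intro Bochner_Integration.integral_cong) (auto simp: algebra_simps exp_add exp_diff exp_minus field_simps)
  also have "\<dots> = exp (- \<i> * complex_of_real (b * t)) * (LINT x|lebesgue. exp (\<i> * complex_of_real (t * x)) * g x)"
    by (rule integral_mult_right_zero)
  finally show ?thesis unfolding fourier_integral_def by (simp only: mult.left_commute)
qed

lemma normal_density_lebesgue:
  assumes "\<sigma> > 0"
  shows "integrable lebesgue (normal_density \<mu> \<sigma>)"
    and "(\<integral>\<^sup>+x. ennreal (normal_density \<mu> \<sigma> x) \<partial>lebesgue) = 1"
proof -
  show "integrable lebesgue (normal_density \<mu> \<sigma>)"
    using assms by (simp add: integrable_completion)
  have "(\<integral>\<^sup>+x. ennreal (normal_density \<mu> \<sigma> x) \<partial>lborel) = ennreal (integral\<^sup>L lborel (normal_density \<mu> \<sigma>))"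
    using assms by (intro nn_integral_eq_integral) (auto simp: normal_density_nonneg)
  then show "(\<integral>\<^sup>+x. ennreal (normal_density \<mu> \<sigma> x) \<partial>lebesgue) = 1"
    using assms by (simp add: nn_integral_completion)
qed

lemma gaussian_conv_normal_density:
  assumes "\<sigma> > 0"
  shows "exp (- ((x - \<mu>) / \<sigma>)\<^sup>2 / 2) = \<sigma> * sqrt (2 * pi) * normal_density \<mu> \<sigma> x"
  using assms by (simp add: normal_density_def real_sqrt_mult power_divide mult.commute)

lemma gaussian_integrable:
  assumes "\<sigma> > 0"
  shows "integrable lebesgue (\<lambda>x. complex_of_real (exp (- ((x - \<mu>) / \<sigma>)\<^sup>2 / 2)))"
  unfolding gaussian_conv_normal_density[OF assms] using normal_density_lebesgue(1)[OF assms] by simp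

text \<open>Schur's test: split the product of the moduli by the inequality between arithmetic and
  geometric mean and use that the symmetric kernel has integral 1 in each variable.\<close>

lemma normal_convolution_form_le:
  assumes [measurable]: "g \<in> borel_measurable lebesgue" and \<sigma>: "\<sigma> > 0"
  shows "(\<integral>\<^sup>+x. ennreal (cmod (g x)) * (\<integral>\<^sup>+y. ennreal (cmod (g y)) * ennreal (normal_density x \<sigma> y) \<partial>lebesgue) \<partial>lebesgue)
    \<le> (\<integral>\<^sup>+x. ennreal ((cmod (g x))\<^sup>2) \<partial>lebesgue)"
proof -
  interpret pair_sigma_finite "lebesgue :: real measure" "lebesgue :: real measure"
    by (rule pair_sigma_finite_lebesgue)
  have [measurable]: "fst \<in> borel_measurable (lebesgue \<Otimes>\<^sub>M (lebesgue :: real measure))"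
    "snd \<in> borel_measurable ((lebesgue :: real measure) \<Otimes>\<^sub>M lebesgue)"
    by (auto intro: measurable_lebesgue_imp_borel)
  define k where "k p = ennreal (normal_density (fst p) \<sigma> (snd p))" for p
  have k_meas [measurable]: "k \<in> borel_measurable (lebesgue \<Otimes>\<^sub>M lebesgue)"
    unfolding k_def normal_density_def by measurable
  have k_sym: "k (x, y) = k (y, x)" for x y by (simp add: k_def normal_density_def power2_commute)
  have k_int: "(\<integral>\<^sup>+y. k (x, y) \<partial>lebesgue) = 1" for x
    using normal_density_lebesgue(2)[OF \<sigma>] by (simp add: k_def)
  have k_meas1 [measurable]: "(\<lambda>y. k (x, y)) \<in> borel_measurable lebesgue" for x by measurable
  define a where "a x = ennreal ((cmod (g x))\<^sup>2 / 2)" for x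
  have [measurable]: "a \<in> borel_measurable lebesgue" unfolding a_def by measurable
  have le: "ennreal (cmod (g x)) * (ennreal (cmod (g y)) * k (x, y)) \<le> a x * k (x, y) + a y * k (x, y)" for x y
  proof -
    have "ennreal (cmod (g x)) * ennreal (cmod (g y)) \<le> a x + a y"
      unfolding a_def using mult_le_sum_squares[of "cmod (g x)" "cmod (g y)"]
      by (simp add: ennreal_leI add_divide_distrib flip: ennreal_mult ennreal_plus)
    then have "ennreal (cmod (g x)) * ennreal (cmod (g y)) * k (x, y) \<le> (a x + a y) * k (x, y)"
      by (rule mult_right_mono) simp
    then show ?thesis by (simp add: distrib_right mult.assoc)
  qed
  have one: "(\<integral>\<^sup>+x. \<integral>\<^sup>+y. a x * k (x, y) \<partial>lebesgue \<partial>lebesgue) = (\<integral>\<^sup>+x. a x \<partial>lebesgue)"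
    by (simp add: nn_integral_cmult k_int)
  have "(\<integral>\<^sup>+x. \<integral>\<^sup>+y. a y * k (x, y) \<partial>lebesgue \<partial>lebesgue) = (\<integral>\<^sup>+y. \<integral>\<^sup>+x. a y * k (x, y) \<partial>lebesgue \<partial>lebesgue)"
    by (rule Fubini'[symmetric]) (simp add: case_prod_beta')
  then have two: "(\<integral>\<^sup>+x. \<integral>\<^sup>+y. a y * k (x, y) \<partial>lebesgue \<partial>lebesgue) = (\<integral>\<^sup>+x. a x \<partial>lebesgue)"
    using one by (simp add: k_sym)
  have "(\<integral>\<^sup>+x. ennreal (cmod (g x)) * (\<integral>\<^sup>+y. ennreal (cmod (g y)) * k (x, y) \<partial>lebesgue) \<partial>lebesgue)
      = (\<integral>\<^sup>+x. \<integral>\<^sup>+y. ennreal (cmod (g x)) * (ennreal (cmod (g y)) * k (x, y)) \<partial>lebesgue \<partial>lebesgue)"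
    by (simp add: nn_integral_cmult)
  also have "\<dots> \<le> (\<integral>\<^sup>+x. \<integral>\<^sup>+y. a x * k (x, y) + a y * k (x, y) \<partial>lebesgue \<partial>lebesgue)"
    by (intro nn_integral_mono le)
  also have "\<dots> = (\<integral>\<^sup>+x. (\<integral>\<^sup>+y. a x * k (x, y) \<partial>lebesgue) + (\<integral>\<^sup>+y. a y * k (x, y) \<partial>lebesgue) \<partial>lebesgue)"
    by (intro nn_integral_cong nn_integral_add) auto
  also have "\<dots> = (\<integral>\<^sup>+x. \<integral>\<^sup>+y. a x * k (x, y) \<partial>lebesgue \<partial>lebesgue) + (\<integral>\<^sup>+x. \<integral>\<^sup>+y. a y * k (x, y) \<partial>lebesgue \<partial>lebesgue)"
    by (intro nn_integral_add sigma_finite_measure.borel_measurable_nn_integral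
        sigma_finite_measure_completion sigma_finite_lborel) (auto simp: case_prod_beta')
  also have "\<dots> = (\<integral>\<^sup>+x. a x + a x \<partial>lebesgue)"
    unfolding one two by (rule nn_integral_add[symmetric]) auto
  also have "\<dots> = (\<integral>\<^sup>+x. ennreal ((cmod (g x))\<^sup>2) \<partial>lebesgue)"
    by (simp add: a_def flip: ennreal_plus)
  finally show ?thesis by (simp add: k_def)
qed

text \<open>
  The multiplication formula for \<open>f\<close> and the Gaussian weight times the conjugated transform of \<open>f\<close>
  turns the left-hand side into the quadratic form of a convolution with a normal density.
\<close>

lemma fourier_integral_gaussian_weight:
  assumes f: "integrable lebesgue f" and f2: "f \<in> L2_space lebesgue" and \<sigma>: "\<sigma> > 0"
  shows "(\<integral>\<^sup>+t. ennreal ((cmod (fourier_integral f t))\<^sup>2 * exp (- (t / \<sigma>)\<^sup>2 / 2)) \<partial>lebesgue)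
    \<le> ennreal ((L2_norm lebesgue f)\<^sup>2)"
proof -
  define w where "w t = complex_of_real (exp (- (t / \<sigma>)\<^sup>2 / 2))" for t
  have w: "integrable lebesgue w" unfolding w_def using gaussian_integrable[OF \<sigma>, of 0] by simp
  have [measurable]: "f \<in> borel_measurable lebesgue" "w \<in> borel_measurable lebesgue" using f w by auto
  have F_meas [measurable]: "fourier_integral f \<in> borel_measurable lebesgue" using f by (rule fourier_integral_measurable)
  have "integrable lebesgue (\<lambda>t. cnj (fourier_integral f t * cnj (w t)))"
    by (intro integrable_cnj integrable_fourier_integral_mult f) (use w in simp)
  then have h: "integrable lebesgue (\<lambda>t. w t * cnj (fourier_integral f t))" by (simp add: mult.commute)
  have hat: "fourier_integral (\<lambda>t. w t * cnj (fourier_integral f t)) \<xi>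
      = cnj (LINT \<eta>|lebesgue. f \<eta> * complex_of_real (normal_density \<xi> (1 / \<sigma>) \<eta>))" for \<xi>
  proof -
    define c where "c = complex_of_real (1 / sqrt (2 * pi))"
    \<comment> \<open>Chosen so that pairing it with the transform of \<open>f\<close> gives the
      conjugate of the outer transform at \<open>\<xi>\<close>, whose constant is \<open>c\<close>.
      A second use of the multiplication formula moves the transform onto \<open>m\<close>, where it
      is a normal density centred at \<open>\<xi>\<close>.\<close>
    define m where "m t = c * (w t * exp (\<i> * complex_of_real (- \<xi> * t)))" for t
    have m_int: "integrable lebesgue m"
      unfolding m_def using integrable_iexp_mult[OF w, of "- \<xi>"] by (simp add: mult.commute)
    have m_hat: "fourier_integral m \<eta> = complex_of_real (normal_density \<xi> (1 / \<sigma>) \<eta>)" for \<eta>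
    proof -
      have "fourier_integral m \<eta> = c * fourier_integral (\<lambda>t. w t * exp (\<i> * complex_of_real (- \<xi> * t))) \<eta>"
        by (simp add: fourier_integral_def m_def mult.left_commute[of _ c] del: of_real_mult)
      also have "\<dots> = c * fourier_integral w (\<eta> + - \<xi>)" by (simp only: fourier_integral_modulation)
      also have "\<dots> = complex_of_real (1 / sqrt (2 * pi) * (\<sigma> * exp (- (\<sigma> * (\<eta> + - \<xi>))\<^sup>2 / 2)))"
        unfolding w_def fourier_integral_gaussian[OF \<sigma>] c_def by simp
      also have "1 / sqrt (2 * pi) * (\<sigma> * exp (- (\<sigma> * (\<eta> + - \<xi>))\<^sup>2 / 2)) = normal_density \<xi> (1 / \<sigma>) \<eta>"
        using \<sigma> by (simp add: normal_density_def real_sqrt_divide real_sqrt_mult power_divide power_mult_distrib mult.commute)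
      finally show ?thesis .
    qed
    have "fourier_integral (\<lambda>t. w t * cnj (fourier_integral f t)) \<xi> = cnj (LINT t|lebesgue. fourier_integral f t * m t)"
    proof -
      have "c * (exp (\<i> * complex_of_real (\<xi> * t)) * (w t * cnj (fourier_integral f t))) = cnj (fourier_integral f t * m t)" for t
        by (simp add: m_def c_def w_def exp_cnj)
      then have "(LINT t|lebesgue. c * (exp (\<i> * complex_of_real (\<xi> * t)) * (w t * cnj (fourier_integral f t))))
          = (LINT t|lebesgue. cnj (fourier_integral f t * m t))" by (simp only:)
      then show ?thesis
        unfolding integral_mult_right_zero Bochner_Integration.integral_cnj
        by (simp only: fourier_integral_def[of "\<lambda>t. w t * cnj (fourier_integral f t)"] c_def)
    qed
    also have "(LINT t|lebesgue. fourier_integral f t * m t) = (LINT \<eta>|lebesgue. f \<eta> * fourier_integral m \<eta>)"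
      by (rule fourier_integral_multiplication[OF f m_int])
    finally show ?thesis by (simp only: m_hat)
  qed
  have hat_le: "ennreal (cmod (fourier_integral (\<lambda>t. w t * cnj (fourier_integral f t)) \<xi>))
      \<le> (\<integral>\<^sup>+\<eta>. ennreal (cmod (f \<eta>)) * ennreal (normal_density \<xi> (1 / \<sigma>) \<eta>) \<partial>lebesgue)" for \<xi>
  proof -
    have "ennreal (cmod (LINT \<eta>|lebesgue. f \<eta> * complex_of_real (normal_density \<xi> (1 / \<sigma>) \<eta>)))
        \<le> (\<integral>\<^sup>+\<eta>. ennreal (norm (f \<eta> * complex_of_real (normal_density \<xi> (1 / \<sigma>) \<eta>))) \<partial>lebesgue)"
      by (cases "integrable lebesgue (\<lambda>\<eta>. f \<eta> * complex_of_real (normal_density \<xi> (1 / \<sigma>) \<eta>))")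
        (simp_all add: integral_norm_bound_ennreal not_integrable_integral_eq)
    then show ?thesis
      unfolding hat complex_mod_cnj norm_mult norm_of_real by (simp add: ennreal_mult normal_density_nonneg)
  qed
  have sq: "fourier_integral f t * (w t * cnj (fourier_integral f t))
      = complex_of_real ((cmod (fourier_integral f t))\<^sup>2 * exp (- (t / \<sigma>)\<^sup>2 / 2))" for t
    by (simp add: w_def complex_norm_square mult_ac del: of_real_power)
  have int: "integrable lebesgue (\<lambda>t. complex_of_real ((cmod (fourier_integral f t))\<^sup>2 * exp (- (t / \<sigma>)\<^sup>2 / 2)))"
    unfolding sq[symmetric] by (rule integrable_fourier_integral_mult[OF f h])
  then have int': "integrable lebesgue (\<lambda>t. (cmod (fourier_integral f t))\<^sup>2 * exp (- (t / \<sigma>)\<^sup>2 / 2))"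
    by (simp only: complex_of_real_integrable_eq)
  have "complex_of_real (LINT t|lebesgue. (cmod (fourier_integral f t))\<^sup>2 * exp (- (t / \<sigma>)\<^sup>2 / 2))
      = (LINT t|lebesgue. fourier_integral f t * (w t * cnj (fourier_integral f t)))"
    unfolding sq by (rule integral_complex_of_real[symmetric])
  also have "\<dots> = (LINT \<xi>|lebesgue. f \<xi> * fourier_integral (\<lambda>t. w t * cnj (fourier_integral f t)) \<xi>)"
    by (rule fourier_integral_multiplication[OF f h])
  finally have eq: "complex_of_real (LINT t|lebesgue. (cmod (fourier_integral f t))\<^sup>2 * exp (- (t / \<sigma>)\<^sup>2 / 2)) = \<dots>" .
  have prod_int: "integrable lebesgue (\<lambda>\<xi>. f \<xi> * fourier_integral (\<lambda>t. w t * cnj (fourier_integral f t)) \<xi>)"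
    using integrable_fourier_integral_mult[OF h f] by (simp add: mult.commute)
  have "(\<integral>\<^sup>+t. ennreal ((cmod (fourier_integral f t))\<^sup>2 * exp (- (t / \<sigma>)\<^sup>2 / 2)) \<partial>lebesgue)
      = ennreal (LINT t|lebesgue. (cmod (fourier_integral f t))\<^sup>2 * exp (- (t / \<sigma>)\<^sup>2 / 2))"
    by (rule nn_integral_eq_integral[OF int']) simp
  also have "\<dots> \<le> ennreal (cmod (LINT \<xi>|lebesgue. f \<xi> * fourier_integral (\<lambda>t. w t * cnj (fourier_integral f t)) \<xi>))"
    unfolding eq[symmetric] norm_of_real by (intro ennreal_leI) simp
  also have "\<dots> \<le> (\<integral>\<^sup>+\<xi>. ennreal (norm (f \<xi> * fourier_integral (\<lambda>t. w t * cnj (fourier_integral f t)) \<xi>)) \<partial>lebesgue)"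
    by (rule integral_norm_bound_ennreal[OF prod_int])
  also have "\<dots> \<le> (\<integral>\<^sup>+\<xi>. ennreal (cmod (f \<xi>)) *
      (\<integral>\<^sup>+\<eta>. ennreal (cmod (f \<eta>)) * ennreal (normal_density \<xi> (1 / \<sigma>) \<eta>) \<partial>lebesgue) \<partial>lebesgue)"
    unfolding norm_mult ennreal_mult[OF norm_ge_zero norm_ge_zero]
    by (intro nn_integral_mono mult_left_mono hat_le) simp
  also have "\<dots> \<le> (\<integral>\<^sup>+x. ennreal ((cmod (f x))\<^sup>2) \<partial>lebesgue)"
    using \<sigma> by (intro normal_convolution_form_le) auto
  also have "\<dots> = ennreal ((L2_norm lebesgue f)\<^sup>2)"
    unfolding L2_norm_square using L2_spaceD(2)[OF f2] by (intro nn_integral_eq_integral) auto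
  finally show ?thesis .
qed

text \<open>Fatou's lemma removes the Gaussian weights, which tend to 1 pointwise. Only
  contractivity is obtained here; isometry follows later from inversion.\<close>

lemma fourier_integral_L2:
  assumes f: "integrable lebesgue f" and f2: "f \<in> L2_space lebesgue"
  shows "fourier_integral f \<in> L2_space lebesgue"
    and "L2_norm lebesgue (fourier_integral f) \<le> L2_norm lebesgue f"
proof -
  have F_meas [measurable]: "fourier_integral f \<in> borel_measurable lebesgue" using f by (rule fourier_integral_measurable)
  define v where "v n t = ennreal ((cmod (fourier_integral f t))\<^sup>2 * exp (- (t / real (Suc n))\<^sup>2 / 2))" for n t
  have gm [measurable]: "(\<lambda>t. exp (- (t / \<sigma>)\<^sup>2 / 2)) \<in> borel_measurable lebesgue" for \<sigma> :: real
    by (rule measurable_completion) measurable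
  have v_meas: "v n \<in> borel_measurable lebesgue" for n unfolding v_def by measurable
  have "(\<lambda>n. v n t) \<longlonglongrightarrow> ennreal ((cmod (fourier_integral f t))\<^sup>2)" for t
  proof -
    have "(\<lambda>n. t / real (Suc n)) \<longlonglongrightarrow> 0" by (rule LIMSEQ_Suc[OF lim_const_over_n[where 'a = real]])
    then have "(\<lambda>n. (cmod (fourier_integral f t))\<^sup>2 * exp (- (t / real (Suc n))\<^sup>2 / 2))
        \<longlonglongrightarrow> (cmod (fourier_integral f t))\<^sup>2 * exp (- 0\<^sup>2 / 2)"
      by (intro tendsto_intros) auto
    then show ?thesis unfolding v_def by (intro tendsto_ennrealI) simp
  qed
  then have "ennreal ((cmod (fourier_integral f t))\<^sup>2) = liminf (\<lambda>n. v n t)" for t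
    by (intro lim_imp_Liminf[symmetric]) auto
  then have "(\<integral>\<^sup>+t. ennreal ((cmod (fourier_integral f t))\<^sup>2) \<partial>lebesgue) = (\<integral>\<^sup>+t. liminf (\<lambda>n. v n t) \<partial>lebesgue)"
    by simp
  also have "\<dots> \<le> liminf (\<lambda>n. \<integral>\<^sup>+t. v n t \<partial>lebesgue)" using v_meas by (rule nn_integral_liminf)
  also have "\<dots> \<le> limsup (\<lambda>n. \<integral>\<^sup>+t. v n t \<partial>lebesgue)" by (rule Liminf_le_Limsup) simp
  also have "\<dots> \<le> ennreal ((L2_norm lebesgue f)\<^sup>2)"
    unfolding v_def by (intro Limsup_bounded always_eventually allI fourier_integral_gaussian_weight f f2) simp
  finally have le: "(\<integral>\<^sup>+t. ennreal ((cmod (fourier_integral f t))\<^sup>2) \<partial>lebesgue) \<le> ennreal ((L2_norm lebesgue f)\<^sup>2)" .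
  show space: "fourier_integral f \<in> L2_space lebesgue"
  proof (rule L2_spaceI[OF F_meas], rule integrableI_bounded)
    show "(\<integral>\<^sup>+t. ennreal (norm ((cmod (fourier_integral f t))\<^sup>2)) \<partial>lebesgue) < \<infinity>"
      using le ennreal_less_top by (simp add: le_less_trans)
  qed measurable
  have "ennreal ((L2_norm lebesgue (fourier_integral f))\<^sup>2) \<le> ennreal ((L2_norm lebesgue f)\<^sup>2)"
    unfolding L2_norm_square[of _ "fourier_integral f"]
    using le nn_integral_eq_integral[OF L2_spaceD(2)[OF space]] by simp
  then have "(L2_norm lebesgue (fourier_integral f))\<^sup>2 \<le> (L2_norm lebesgue f)\<^sup>2" by (simp add: ennreal_le_iff)
  then show "L2_norm lebesgue (fourier_integral f) \<le> L2_norm lebesgue f" by (rule power2_le_imp_le) simp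
qed

section \<open>Extension to all of L2 by cut-offs\<close>

definition truncate :: "nat \<Rightarrow> (real \<Rightarrow> complex) \<Rightarrow> real \<Rightarrow> complex" where
  "truncate n f x = indicator {- real n..real n} x * f x"

lemma truncate_measurable [measurable]:
  assumes [measurable]: "f \<in> borel_measurable lebesgue"
  shows "truncate n f \<in> borel_measurable lebesgue"
proof -
  have [measurable]: "(indicator {- real n..real n} :: real \<Rightarrow> complex) \<in> borel_measurable lebesgue"
    by (intro borel_measurable_indicator) simp
  show ?thesis unfolding truncate_def[abs_def] by measurable
qed

lemma truncate_L2:
  assumes f: "f \<in> L2_space lebesgue"
  shows "truncate n f \<in> L2_space lebesgue"
proof (rule L2_spaceI)
  have [measurable]: "f \<in> borel_measurable lebesgue" using f by (rule L2_spaceD)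
  show "truncate n f \<in> borel_measurable lebesgue" by measurable
  show "integrable lebesgue (\<lambda>x. (cmod (truncate n f x))\<^sup>2)"
    by (rule Bochner_Integration.integrable_bound[OF L2_spaceD(2)[OF f]])
       (measurable, auto simp: truncate_def indicator_def)
qed

text \<open>The cut-off is a product of two square-integrable functions, \<open>f\<close> and the
  indicator of a bounded interval.\<close>

lemma truncate_integrable:
  assumes f: "f \<in> L2_space lebesgue"
  shows "integrable lebesgue (truncate n f)"
proof (rule Bochner_Integration.integrable_bound)
  have [measurable]: "f \<in> borel_measurable lebesgue" using f by (rule L2_spaceD)
  show "truncate n f \<in> borel_measurable lebesgue" by measurable
  have "(\<lambda>x. complex_of_real (indicator {- real n..real n} x)) \<in> L2_space lebesgue"
  proof (rule L2_spaceI)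
    have "integrable lebesgue (indicator {- real n..real n} :: real \<Rightarrow> real)"
      by (rule integrable_real_indicator) auto
    moreover have "(cmod (complex_of_real (indicator {- real n..real n} x)))\<^sup>2 = indicator {- real n..real n} x" for x
      by (simp add: indicator_def)
    ultimately show "integrable lebesgue (\<lambda>x. (cmod (complex_of_real (indicator {- real n..real n} x)))\<^sup>2)"
      by (simp only:)
    have [measurable]: "(indicator {- real n..real n} :: real \<Rightarrow> real) \<in> borel_measurable lebesgue"
      by (intro borel_measurable_indicator) simp
    show "(\<lambda>x. complex_of_real (indicator {- real n..real n} x)) \<in> borel_measurable lebesgue" by measurable
  qed
  from L2_integrable_norm_mult[OF this f]
  show "integrable lebesgue (\<lambda>x. cmod (complex_of_real (indicator {- real n..real n} x)) * cmod (f x))" .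
qed (auto simp: truncate_def norm_mult indicator_def)

lemma truncate_tendsto:
  assumes f: "f \<in> L2_space lebesgue"
  shows "(\<lambda>n. L2_norm lebesgue (\<lambda>x. truncate n f x - f x)) \<longlonglongrightarrow> 0"
proof -
  have [measurable]: "f \<in> borel_measurable lebesgue" using f by (rule L2_spaceD)
  have "(\<lambda>n. LINT x|lebesgue. (cmod (truncate n f x - f x))\<^sup>2) \<longlonglongrightarrow> (LINT x|(lebesgue :: real measure). 0)"
  proof (rule integral_dominated_convergence[where w = "\<lambda>x. (cmod (f x))\<^sup>2" and f = "\<lambda>x. 0"
        and s = "\<lambda>n x. (cmod (truncate n f x - f x))\<^sup>2"])
    show "AE x in lebesgue. (\<lambda>n. (cmod (truncate n f x - f x))\<^sup>2) \<longlonglongrightarrow> 0"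
    proof (rule AE_I2)
      fix x :: real
      obtain N where N: "\<bar>x\<bar> \<le> real N" using real_arch_simple by blast
      have "\<forall>\<^sub>F n in sequentially. (cmod (truncate n f x - f x))\<^sup>2 = 0"
        using eventually_ge_at_top[of N]
      proof eventually_elim
        case (elim n)
        then have "\<bar>x\<bar> \<le> real n" using N by linarith
        then show ?case by (simp add: truncate_def abs_le_iff)
      qed
      then show "(\<lambda>n. (cmod (truncate n f x - f x))\<^sup>2) \<longlonglongrightarrow> 0" by (rule tendsto_eventually)
    qed
    show "AE x in lebesgue. norm ((cmod (truncate n f x - f x))\<^sup>2) \<le> (cmod (f x))\<^sup>2" for n
      by (auto simp: truncate_def indicator_def)
  qed (use L2_spaceD(2)[OF f] in \<open>auto simp: power2_eq_square\<close>)
  then have "(\<lambda>n. sqrt (LINT x|lebesgue. (cmod (truncate n f x - f x))\<^sup>2)) \<longlonglongrightarrow> sqrt 0"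
    by (intro tendsto_real_sqrt) simp
  then show ?thesis by (simp add: L2_norm_def)
qed

lemma fourier_integral_diff:
  assumes "integrable lebesgue f" "integrable lebesgue g"
  shows "fourier_integral (\<lambda>x. f x - g x) = (\<lambda>t. fourier_integral f t - fourier_integral g t)"
proof
  show "fourier_integral (\<lambda>x. f x - g x) t = fourier_integral f t - fourier_integral g t" for t
    using integrable_iexp_mult[OF assms(1), of t] integrable_iexp_mult[OF assms(2), of t]
    by (simp add: fourier_integral_def right_diff_distrib del: of_real_mult)
qed

text \<open>A representative of the L2 limit of the transforms of the cut-offs; it is determined
  only almost everywhere and is chosen separately for each \<open>f\<close>.\<close>

definition fourier_L2 :: "(real \<Rightarrow> complex) \<Rightarrow> real \<Rightarrow> complex" where
  "fourier_L2 f = (SOME g. g \<in> L2_space lebesgue \<and>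
     (\<lambda>n. L2_norm lebesgue (\<lambda>x. fourier_integral (truncate n f) x - g x)) \<longlonglongrightarrow> 0)"

text \<open>The Fourier integral is linear and contracts the L2 norm, so the Cauchy property of the
  cut-offs passes to their transforms.\<close>

lemma fourier_L2:
  assumes f: "f \<in> L2_space lebesgue"
  shows "fourier_L2 f \<in> L2_space lebesgue"
    and "(\<lambda>n. L2_norm lebesgue (\<lambda>x. fourier_integral (truncate n f) x - fourier_L2 f x)) \<longlonglongrightarrow> 0"
proof -
  note tr = truncate_L2[OF f] truncate_integrable[OF f]
  have le: "L2_norm lebesgue (\<lambda>x. fourier_integral (truncate m f) x - fourier_integral (truncate n f) x)
      \<le> L2_norm lebesgue (\<lambda>x. truncate m f x - truncate n f x)" for m n
    using fourier_integral_L2(2)[of "\<lambda>x. truncate m f x - truncate n f x"] tr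
    by (simp add: fourier_integral_diff L2_space_diff)
  have "\<exists>g\<in>L2_space lebesgue. (\<lambda>n. L2_norm lebesgue (\<lambda>x. fourier_integral (truncate n f) x - g x)) \<longlonglongrightarrow> 0"
  proof (rule L2_complete)
    show "fourier_integral (truncate n f) \<in> L2_space lebesgue" for n by (intro fourier_integral_L2(1) tr)
    fix e :: real assume "e > 0"
    then have "\<forall>\<^sub>F n in sequentially. L2_norm lebesgue (\<lambda>x. truncate n f x - f x) < e / 2"
      using order_tendstoD(2)[OF truncate_tendsto[OF f], of "e / 2"] by simp
    then obtain N where N: "\<And>n. n \<ge> N \<Longrightarrow> L2_norm lebesgue (\<lambda>x. truncate n f x - f x) < e / 2"
      unfolding eventually_sequentially by blast
    have "L2_norm lebesgue (\<lambda>x. fourier_integral (truncate m f) x - fourier_integral (truncate n f) x) \<le> e"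
      if "m \<ge> N" "n \<ge> N" for m n
    proof -
      have "L2_norm lebesgue (\<lambda>x. truncate m f x - truncate n f x)
          \<le> L2_norm lebesgue (\<lambda>x. truncate m f x - f x) + L2_norm lebesgue (\<lambda>x. f x - truncate n f x)"
        by (intro L2_norm_triangle_diff tr f)
      then show ?thesis
        using le[of m n] N[OF that(1)] N[OF that(2)] L2_norm_minus_commute[of lebesgue f "truncate n f"] by linarith
    qed
    then show "\<exists>N. \<forall>m\<ge>N. \<forall>n\<ge>N. L2_norm lebesgue (\<lambda>x. fourier_integral (truncate m f) x - fourier_integral (truncate n f) x) \<le> e"
      by blast
  qed
  then have "\<exists>g. g \<in> L2_space lebesgue \<and>
      (\<lambda>n. L2_norm lebesgue (\<lambda>x. fourier_integral (truncate n f) x - g x)) \<longlonglongrightarrow> 0" by blast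
  from someI_ex[OF this]
  show "fourier_L2 f \<in> L2_space lebesgue"
    and "(\<lambda>n. L2_norm lebesgue (\<lambda>x. fourier_integral (truncate n f) x - fourier_L2 f x)) \<longlonglongrightarrow> 0"
    unfolding fourier_L2_def by blast+
qed

lemma fourier_integral_truncate_L2:
  "f \<in> L2_space lebesgue \<Longrightarrow> fourier_integral (truncate n f) \<in> L2_space lebesgue"
  by (intro fourier_integral_L2(1) truncate_L2 truncate_integrable)

lemma fourier_L2_norm_le:
  assumes f: "f \<in> L2_space lebesgue"
  shows "L2_norm lebesgue (fourier_L2 f) \<le> L2_norm lebesgue f"
proof (rule LIMSEQ_le)
  show "(\<lambda>n. L2_norm lebesgue (fourier_integral (truncate n f))) \<longlonglongrightarrow> L2_norm lebesgue (fourier_L2 f)"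
    by (intro L2_norm_tendsto fourier_integral_truncate_L2 fourier_L2 f)
  show "(\<lambda>n. L2_norm lebesgue (truncate n f)) \<longlonglongrightarrow> L2_norm lebesgue f"
    by (intro L2_norm_tendsto truncate_L2 truncate_tendsto f)
  show "\<exists>N. \<forall>n\<ge>N. L2_norm lebesgue (fourier_integral (truncate n f)) \<le> L2_norm lebesgue (truncate n f)"
    by (intro exI[of _ 0] allI impI fourier_integral_L2(2) truncate_L2 truncate_integrable f)
qed

text \<open>The multiplication formula for cut-offs passes to the limit in one argument at a time.
  The conjugate in the second slot undoes the one in \<open>L2_inner\<close>, so both sides are
  bilinear pairings.\<close>

lemma fourier_L2_multiplication:
  assumes f: "f \<in> L2_space lebesgue" and g: "g \<in> L2_space lebesgue"
  shows "L2_inner lebesgue (fourier_L2 f) (\<lambda>x. cnj (g x)) = L2_inner lebesgue (fourier_L2 g) (\<lambda>x. cnj (f x))"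
proof -
  have lim: "(\<lambda>n. L2_inner lebesgue (fourier_integral (truncate n f)) (\<lambda>x. cnj (h x)))
      \<longlonglongrightarrow> L2_inner lebesgue (fourier_L2 f) (\<lambda>x. cnj (h x))"
    if "f \<in> L2_space lebesgue" "h \<in> L2_space lebesgue" for f h
    using that by (intro L2_inner_tendsto fourier_integral_truncate_L2 fourier_L2 L2_space_cnj)
  have lim_tr: "(\<lambda>n. L2_inner lebesgue (truncate n f) (\<lambda>x. cnj (h x))) \<longlonglongrightarrow> L2_inner lebesgue f (\<lambda>x. cnj (h x))"
    if "f \<in> L2_space lebesgue" "h \<in> L2_space lebesgue" for f h
    using that by (intro L2_inner_tendsto truncate_L2 truncate_tendsto L2_space_cnj)
  have comm: "L2_inner lebesgue h (\<lambda>x. cnj (k x)) = L2_inner lebesgue k (\<lambda>x. cnj (h x))" for h k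
    by (simp add: L2_inner_def mult.commute)
  have step: "L2_inner lebesgue (fourier_integral (truncate n f)) (\<lambda>x. cnj (g x))
      = L2_inner lebesgue (fourier_L2 g) (\<lambda>x. cnj (truncate n f x))" for n
  proof (rule LIMSEQ_unique)
    show "(\<lambda>m. L2_inner lebesgue (truncate m g) (\<lambda>x. cnj (fourier_integral (truncate n f) x)))
        \<longlonglongrightarrow> L2_inner lebesgue (fourier_integral (truncate n f)) (\<lambda>x. cnj (g x))"
      using lim_tr[OF g fourier_integral_truncate_L2[OF f]] by (subst comm)
    have "L2_inner lebesgue (truncate m g) (\<lambda>x. cnj (fourier_integral (truncate n f) x))
        = L2_inner lebesgue (fourier_integral (truncate m g)) (\<lambda>x. cnj (truncate n f x))" for m
      using fourier_integral_multiplication[OF truncate_integrable[OF g] truncate_integrable[OF f], of m n]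
      by (simp add: L2_inner_def)
    then show "(\<lambda>m. L2_inner lebesgue (truncate m g) (\<lambda>x. cnj (fourier_integral (truncate n f) x)))
        \<longlonglongrightarrow> L2_inner lebesgue (fourier_L2 g) (\<lambda>x. cnj (truncate n f x))"
      using lim[OF g truncate_L2[OF f]] by simp
  qed
  have "(\<lambda>n. L2_inner lebesgue (fourier_integral (truncate n f)) (\<lambda>x. cnj (g x)))
      \<longlonglongrightarrow> L2_inner lebesgue (fourier_L2 g) (\<lambda>x. cnj (f x))"
    unfolding step using lim_tr[OF f fourier_L2(1)[OF g]] by (simp only: comm[of "fourier_L2 g"])
  with lim[OF f g] show ?thesis by (rule LIMSEQ_unique)
qed

text \<open>Conjugating before and after reverses the sign in the exponent of the kernel. In this
  form the adjoint identity is the multiplication formula.\<close>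

definition inverse_fourier_L2 :: "(real \<Rightarrow> complex) \<Rightarrow> real \<Rightarrow> complex" where
  "inverse_fourier_L2 g x = cnj (fourier_L2 (\<lambda>t. cnj (g t)) x)"

lemma inverse_fourier_L2_space: "g \<in> L2_space lebesgue \<Longrightarrow> inverse_fourier_L2 g \<in> L2_space lebesgue"
  unfolding inverse_fourier_L2_def[abs_def] by (intro L2_space_cnj fourier_L2(1))

lemma fourier_L2_adjoint:
  assumes "f \<in> L2_space lebesgue" "g \<in> L2_space lebesgue"
  shows "L2_inner lebesgue (fourier_L2 f) g = L2_inner lebesgue f (inverse_fourier_L2 g)"
  using fourier_L2_multiplication[OF assms(1) L2_space_cnj[OF assms(2)]]
  by (simp add: inverse_fourier_L2_def[abs_def] L2_inner_def mult.commute)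

lemma inverse_fourier_L2_inner:
  assumes "f \<in> L2_space lebesgue" "g \<in> L2_space lebesgue"
  shows "L2_inner lebesgue (inverse_fourier_L2 g) f = L2_inner lebesgue g (fourier_L2 f)"
  using arg_cong[OF fourier_L2_adjoint[OF assms], of cnj] by (simp add: L2_inner_cnj)

text \<open>Representatives chosen for different functions are unrelated, so linearity is read off
  from the adjoint identity, where the inverse transform acts on the test function alone.\<close>

lemma fourier_L2_operator: "L2_operator lebesgue fourier_L2"
proof (rule L2_operatorI_weak[where C = 1])
  show "fourier_L2 f \<in> L2_space lebesgue" if "f \<in> L2_space lebesgue" for f using that by (rule fourier_L2(1))
  fix f h :: "real \<Rightarrow> complex" assume f: "f \<in> L2_space lebesgue" and h: "h \<in> L2_space lebesgue"
  have "cmod (L2_inner lebesgue (fourier_L2 f) h) \<le> L2_norm lebesgue (fourier_L2 f) * L2_norm lebesgue h"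
    by (intro L2_Cauchy_Schwarz fourier_L2 f h)
  also have "\<dots> \<le> 1 * L2_norm lebesgue f * L2_norm lebesgue h"
    using fourier_L2_norm_le[OF f] by (simp add: mult_right_mono)
  finally show "cmod (L2_inner lebesgue (fourier_L2 f) h) \<le> 1 * L2_norm lebesgue f * L2_norm lebesgue h" .
next
  fix f g h :: "real \<Rightarrow> complex" and a b assume f: "f \<in> L2_space lebesgue" and g: "g \<in> L2_space lebesgue" and h: "h \<in> L2_space lebesgue"
  have fg: "(\<lambda>y. a * f y + b * g y) \<in> L2_space lebesgue" by (intro L2_space_intros f g)
  show "L2_inner lebesgue (fourier_L2 (\<lambda>y. a * f y + b * g y)) h
      = a * L2_inner lebesgue (fourier_L2 f) h + b * L2_inner lebesgue (fourier_L2 g) h"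
    unfolding fourier_L2_adjoint[OF fg h] fourier_L2_adjoint[OF f h] fourier_L2_adjoint[OF g h]
    by (simp add: L2_inner_add_left L2_inner_scale_left L2_space_scale f g inverse_fourier_L2_space[OF h])
qed simp

text \<open>Both sides are L2 limits of \<open>fourier_integral (truncate n f)\<close>; for the
  right-hand side this is contractivity applied to \<open>truncate n f - f\<close>.\<close>

lemma fourier_L2_eq_fourier_integral:
  assumes f: "f \<in> L2_space lebesgue" and int: "integrable lebesgue f"
  shows "AE t in lebesgue. fourier_L2 f t = fourier_integral f t"
proof (rule L2_AE_eqI)
  have F: "fourier_integral f \<in> L2_space lebesgue" using int f by (rule fourier_integral_L2)
  then show "fourier_integral f \<in> L2_space lebesgue" .
  show "fourier_L2 f \<in> L2_space lebesgue" using f by (rule fourier_L2)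
  fix h :: "real \<Rightarrow> complex" assume h: "h \<in> L2_space lebesgue"
  show "L2_inner lebesgue (fourier_L2 f) h = L2_inner lebesgue (fourier_integral f) h"
  proof (rule LIMSEQ_unique)
    show "(\<lambda>n. L2_inner lebesgue (fourier_integral (truncate n f)) h) \<longlonglongrightarrow> L2_inner lebesgue (fourier_L2 f) h"
      by (intro L2_inner_tendsto fourier_integral_truncate_L2 fourier_L2 f h)
    have "(\<lambda>n. L2_norm lebesgue (\<lambda>x. fourier_integral (truncate n f) x - fourier_integral f x)) \<longlonglongrightarrow> 0"
    proof (rule tendsto_sandwich[OF _ _ tendsto_const truncate_tendsto[OF f]])
      have "L2_norm lebesgue (\<lambda>x. fourier_integral (truncate n f) x - fourier_integral f x)
          \<le> L2_norm lebesgue (\<lambda>x. truncate n f x - f x)" for n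
        using fourier_integral_L2(2)[of "\<lambda>x. truncate n f x - f x"] f int truncate_L2[OF f] truncate_integrable[OF f]
        by (simp add: fourier_integral_diff L2_space_diff)
      then show "\<forall>\<^sub>F n in sequentially. L2_norm lebesgue (\<lambda>x. fourier_integral (truncate n f) x - fourier_integral f x)
          \<le> L2_norm lebesgue (\<lambda>x. truncate n f x - f x)" by simp
    qed simp
    then show "(\<lambda>n. L2_inner lebesgue (fourier_integral (truncate n f)) h) \<longlonglongrightarrow> L2_inner lebesgue (fourier_integral f) h"
      by (intro L2_inner_tendsto fourier_integral_truncate_L2 F f h)
  qed
qed

section \<open>Inversion and unitarity\<close>

definition modulated_gaussian :: "real \<Rightarrow> real \<Rightarrow> complex" where
  "modulated_gaussian b x = complex_of_real (exp (- x\<^sup>2 / 2)) * exp (\<i> * complex_of_real (b * x))"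

lemma gaussian_L2:
  "(\<lambda>x. complex_of_real (exp (- (x - \<mu>)\<^sup>2 / 2))) \<in> L2_space lebesgue"
  "integrable lebesgue (\<lambda>x. complex_of_real (exp (- (x - \<mu>)\<^sup>2 / 2)))"
proof -
  show int: "integrable lebesgue (\<lambda>x. complex_of_real (exp (- (x - \<mu>)\<^sup>2 / 2)))"
    using gaussian_integrable[of 1 \<mu>] by simp
  have [measurable]: "(\<lambda>x. complex_of_real (exp (- (x - \<mu>)\<^sup>2 / 2))) \<in> borel_measurable lebesgue" using int by simp
  show "(\<lambda>x. complex_of_real (exp (- (x - \<mu>)\<^sup>2 / 2))) \<in> L2_space lebesgue"
  proof (rule L2_spaceI)
    show "integrable lebesgue (\<lambda>x. (cmod (complex_of_real (exp (- (x - \<mu>)\<^sup>2 / 2))))\<^sup>2)"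
    proof (rule Bochner_Integration.integrable_bound[OF int])
      show "AE x in lebesgue. norm ((cmod (complex_of_real (exp (- (x - \<mu>)\<^sup>2 / 2))))\<^sup>2)
          \<le> norm (complex_of_real (exp (- (x - \<mu>)\<^sup>2 / 2)))"
        by (rule AE_I2) (simp add: power2_eq_square mult_left_le)
    qed measurable
  qed measurable
qed

lemma modulated_gaussian_space:
  "modulated_gaussian b \<in> L2_space lebesgue" "integrable lebesgue (modulated_gaussian b)"
proof -
  show int: "integrable lebesgue (modulated_gaussian b)"
    using integrable_iexp_mult[OF gaussian_L2(2)[of 0], of b]
    by (simp add: modulated_gaussian_def[abs_def] mult.commute)
  then show "modulated_gaussian b \<in> L2_space lebesgue"
    using L2_spaceD(2)[OF gaussian_L2(1)[of 0]]
    by (intro L2_spaceI) (auto simp: modulated_gaussian_def norm_mult)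
qed

text \<open>The transform of a modulated Gaussian is the translated real Gaussian \<open>G\<close>,
  and transforming \<open>G\<close> produces the conjugate of the modulated one, so both steps are
  explicit.\<close>

lemma inverse_fourier_L2_fourier_L2_gaussian:
  "AE x in lebesgue. inverse_fourier_L2 (fourier_L2 (modulated_gaussian b)) x = modulated_gaussian b x"
proof -
  define G where "G t = complex_of_real (exp (- (t - - b)\<^sup>2 / 2))" for t
  have G: "G \<in> L2_space lebesgue" "integrable lebesgue G" unfolding G_def by (rule gaussian_L2)+
  have cG: "(\<lambda>t. cnj (G t)) = G" by (simp add: G_def fun_eq_iff)
  have std: "fourier_integral (\<lambda>x. complex_of_real (exp (- x\<^sup>2 / 2))) t = complex_of_real (exp (- t\<^sup>2 / 2))" for t
    using fourier_integral_gaussian[of 1 t] by simp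
  have hat: "fourier_integral (modulated_gaussian b) t = G t" for t
    unfolding modulated_gaussian_def[abs_def] fourier_integral_modulation std G_def by simp
  have U: "AE t in lebesgue. fourier_L2 (modulated_gaussian b) t = G t"
    using fourier_L2_eq_fourier_integral[OF modulated_gaussian_space, of b] by (simp add: hat)
  have "AE x in lebesgue. fourier_L2 G x = fourier_integral G x"
    by (rule fourier_L2_eq_fourier_integral[OF G])
  moreover have "fourier_integral G x = cnj (modulated_gaussian b x)" for x
  proof -
    have "fourier_integral (\<lambda>t. complex_of_real (exp (- (t + b)\<^sup>2 / 2))) x
        = exp (- \<i> * complex_of_real (b * x)) * fourier_integral (\<lambda>t. complex_of_real (exp (- t\<^sup>2 / 2))) x"
      by (rule fourier_integral_shift) measurable
    then show ?thesis unfolding std by (simp add: G_def[abs_def] modulated_gaussian_def exp_cnj mult.commute)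
  qed
  ultimately have FG: "AE x in lebesgue. fourier_L2 G x = cnj (modulated_gaussian b x)" by simp
  \<comment> \<open>The transform agrees with \<open>G\<close> only almost everywhere, so the
    replacement is made inside an inner product, after \<open>inverse_fourier_L2\<close> has been
    moved to the other side.\<close>
  have "L2_inner lebesgue (inverse_fourier_L2 (fourier_L2 (modulated_gaussian b))) h
      = L2_inner lebesgue (modulated_gaussian b) h" if h: "h \<in> L2_space lebesgue" for h
  proof -
    note mg = modulated_gaussian_space(1)[of b]
    have "L2_inner lebesgue (inverse_fourier_L2 (fourier_L2 (modulated_gaussian b))) h
        = L2_inner lebesgue (fourier_L2 (modulated_gaussian b)) (fourier_L2 h)"
      by (intro inverse_fourier_L2_inner h fourier_L2(1) mg)
    also have "\<dots> = L2_inner lebesgue G (fourier_L2 h)"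
      using U by (intro L2_inner_cong_AE fourier_L2(1) mg G h) auto
    also have "\<dots> = L2_inner lebesgue (inverse_fourier_L2 G) h"
      by (intro inverse_fourier_L2_inner[symmetric] G h)
    also have "\<dots> = L2_inner lebesgue (modulated_gaussian b) h"
    proof (intro L2_inner_cong_AE inverse_fourier_L2_space G mg h)
      show "AE x in lebesgue. inverse_fourier_L2 G x = modulated_gaussian b x"
        using FG unfolding inverse_fourier_L2_def cG by eventually_elim simp
    qed auto
    finally show ?thesis .
  qed
  then show ?thesis
    by (intro L2_AE_eqI inverse_fourier_L2_space fourier_L2(1) modulated_gaussian_space(1))
qed

text \<open>
  The difference of both sides is orthogonal to all modulated Gaussians, that is, its product with a Gaussian
  has vanishing Fourier transform.
\<close>

lemma inverse_fourier_L2_fourier_L2: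
  assumes f: "f \<in> L2_space lebesgue"
  shows "AE x in lebesgue. inverse_fourier_L2 (fourier_L2 f) x = f x"
proof -
  define d where "d x = inverse_fourier_L2 (fourier_L2 f) x - f x" for x
  have VU: "inverse_fourier_L2 (fourier_L2 f) \<in> L2_space lebesgue"
    by (intro inverse_fourier_L2_space fourier_L2 f)
  have d: "d \<in> L2_space lebesgue" unfolding d_def by (intro L2_space_diff VU f)
  define q where "q x = d x * complex_of_real (exp (- x\<^sup>2 / 2))" for x
  have q_int: "integrable lebesgue q"
    using L2_integrable_mult_cnj[OF d gaussian_L2(1)[of 0]] by (simp add: q_def[abs_def])
  have "(LINT x|lebesgue. exp (\<i> * complex_of_real (t * x)) * q x) = 0" for t
  proof -
    note mg = modulated_gaussian_space(1)[of "- t"]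
    have "(LINT x|lebesgue. exp (\<i> * complex_of_real (t * x)) * q x) = L2_inner lebesgue d (modulated_gaussian (- t))"
      by (simp add: L2_inner_def q_def modulated_gaussian_def exp_cnj mult_ac)
    also have "\<dots> = L2_inner lebesgue (inverse_fourier_L2 (fourier_L2 f)) (modulated_gaussian (- t)) - L2_inner lebesgue f (modulated_gaussian (- t))"
      unfolding d_def by (intro L2_inner_diff_left VU f mg)
    also have "L2_inner lebesgue (inverse_fourier_L2 (fourier_L2 f)) (modulated_gaussian (- t))
        = L2_inner lebesgue (fourier_L2 f) (fourier_L2 (modulated_gaussian (- t)))"
      by (intro inverse_fourier_L2_inner fourier_L2 f mg)
    also have "\<dots> = L2_inner lebesgue f (inverse_fourier_L2 (fourier_L2 (modulated_gaussian (- t))))"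
      by (intro fourier_L2_adjoint f fourier_L2(1) mg)
    also have "\<dots> = L2_inner lebesgue f (modulated_gaussian (- t))"
      using inverse_fourier_L2_fourier_L2_gaussian[of "- t"]
      by (intro L2_inner_cong_AE f mg inverse_fourier_L2_space fourier_L2(1)) auto
    finally show ?thesis by simp
  qed
  then have "AE x in lebesgue. q x = 0" using q_int by (intro iexp_integral_eq_0_imp)
  then show ?thesis by eventually_elim (simp add: q_def d_def)
qed

lemma is_fourier_plancherel_fourier_L2: "is_fourier_plancherel fourier_L2"
  unfolding is_fourier_plancherel_def L2_unitary_def
proof (intro conjI ballI impI fourier_L2_operator fourier_L2_eq_fourier_integral)
  fix f g :: "real \<Rightarrow> complex" assume f: "f \<in> L2_space lebesgue" and g: "g \<in> L2_space lebesgue"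
  have "L2_inner lebesgue (fourier_L2 f) (fourier_L2 g) = L2_inner lebesgue f (inverse_fourier_L2 (fourier_L2 g))"
    by (intro fourier_L2_adjoint f fourier_L2(1) g)
  also have "\<dots> = L2_inner lebesgue f g"
    using inverse_fourier_L2_fourier_L2[OF g]
    by (intro L2_inner_cong_AE f g inverse_fourier_L2_space fourier_L2(1)) auto
  finally show "L2_inner lebesgue (fourier_L2 f) (fourier_L2 g) = L2_inner lebesgue f g" .
next
  fix g :: "real \<Rightarrow> complex" assume g: "g \<in> L2_space lebesgue"
  \<comment> \<open>Surjectivity: inversion at the conjugate of \<open>g\<close> is the conjugate of
    the opposite composition at \<open>g\<close>.\<close>
  have "AE x in lebesgue. cnj (fourier_L2 (inverse_fourier_L2 g) x) = cnj (g x)"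
    using inverse_fourier_L2_fourier_L2[OF L2_space_cnj[OF g]]
    by (simp add: inverse_fourier_L2_def[abs_def])
  then have "AE x in lebesgue. fourier_L2 (inverse_fourier_L2 g) x = g x" by simp
  then show "\<exists>f\<in>L2_space lebesgue. AE x in lebesgue. fourier_L2 f x = g x"
    using inverse_fourier_L2_space[OF g] by blast
qed

text \<open>Existence of one such operator makes the choice meet its specification, through which
  alone the transform enters below.\<close>

lemma is_fourier_plancherel: "is_fourier_plancherel fourier_plancherel"
  unfolding fourier_plancherel_def
  by (rule someI[of is_fourier_plancherel, OF is_fourier_plancherel_fourier_L2])

section \<open>The truncated Fourier operator\<close>

lemma integrable_pair_mult:
  fixes a b :: "'a \<Rightarrow> complex"
  assumes M: "sigma_finite_measure M" and a: "integrable M a" and b: "integrable M b"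
  shows "integrable (M \<Otimes>\<^sub>M M) (\<lambda>p. a (fst p) * b (snd p))"
    and "integral\<^sup>L (M \<Otimes>\<^sub>M M) (\<lambda>p. a (fst p) * b (snd p)) = integral\<^sup>L M a * integral\<^sup>L M b"
proof -
  interpret pair_sigma_finite M M using M by (simp add: pair_sigma_finite_def)
  have [measurable]: "a \<in> borel_measurable M" "b \<in> borel_measurable M" using a b by auto
  show int: "integrable (M \<Otimes>\<^sub>M M) (\<lambda>p. a (fst p) * b (snd p))"
    by (rule Fubini_integrable) (use a b in \<open>auto simp: norm_mult\<close>)
  have "integral\<^sup>L (M \<Otimes>\<^sub>M M) (\<lambda>p. a (fst p) * b (snd p)) = (LINT x|M. LINT y|M. a x * b y)"
    using integral_fst'[OF int] by simp
  then show "integral\<^sup>L (M \<Otimes>\<^sub>M M) (\<lambda>p. a (fst p) * b (snd p)) = integral\<^sup>L M a * integral\<^sup>L M b"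
    by simp
qed

lemma L2_integrable_finite_measure:
  assumes "finite_measure M" "f \<in> L2_space M"
  shows "integrable M f"
proof -
  interpret finite_measure M by fact
  have "(\<lambda>x. 1) \<in> L2_space M" by (simp add: L2_space_def)
  from L2_integrable_mult_cnj[OF assms(2) this] show ?thesis by simp
qed

text \<open>Integrated against \<open>f\<close> and \<open>g\<close> over the product space, each
  term of the kernel expansion factors into two inner products, and Cauchy-Schwarz in each factor
  gives the summable bound for the interchange. Boundedness of \<open>K\<close> and finiteness of
  \<open>M\<close> make the limit integrable, and Fubini recovers the operator with kernel
  \<open>K\<close>.\<close>

lemma L2_kernel_has_sum:
  fixes u v :: "'i \<Rightarrow> 'a \<Rightarrow> complex"
  assumes M: "finite_measure M" and I: "countable I"
    and u: "\<And>i. i \<in> I \<Longrightarrow> u i \<in> L2_space M" and v: "\<And>i. i \<in> I \<Longrightarrow> v i \<in> L2_space M"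
    and summable_norms: "(\<lambda>i. L2_norm M (u i) * L2_norm M (v i)) summable_on I"
    and K_meas [measurable]: "K \<in> borel_measurable (M \<Otimes>\<^sub>M M)" and K_bound: "\<And>p. cmod (K p) \<le> C"
    and K_sum: "\<And>t x. t \<in> space M \<Longrightarrow> x \<in> space M \<Longrightarrow> ((\<lambda>i. u i t * cnj (v i x)) has_sum K (t, x)) I"
    and f: "f \<in> L2_space M" and g: "g \<in> L2_space M"
  shows "((\<lambda>i. L2_inner M f (v i) * L2_inner M (u i) g) has_sum
    L2_inner M (\<lambda>t. LINT x|M. K (t, x) * f x) g) I"
proof -
  interpret finite_measure M by fact
  have sf: "sigma_finite_measure M" by unfold_locales
  interpret P: pair_sigma_finite M M using sf by (simp add: pair_sigma_finite_def)
  have f_int: "integrable M f" and g_int: "integrable M g"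
    using M f g by (auto intro: L2_integrable_finite_measure)
  have [measurable]: "f \<in> borel_measurable M" "g \<in> borel_measurable M" using f_int g_int by auto
  define F where "F i p = (u i (fst p) * cnj (g (fst p))) * (f (snd p) * cnj (v i (snd p)))" for i p
  define G where "G p = K p * f (snd p) * cnj (g (fst p))" for p
  have int_F: "integrable (M \<Otimes>\<^sub>M M) (F i)" and F_eq: "integral\<^sup>L (M \<Otimes>\<^sub>M M) (F i) = L2_inner M f (v i) * L2_inner M (u i) g"
    if "i \<in> I" for i
    using integrable_pair_mult[OF sf L2_integrable_mult_cnj[OF u[OF that] g] L2_integrable_mult_cnj[OF f v[OF that]]]
    by (simp_all add: F_def[abs_def] L2_inner_def mult.commute[of "LINT x|M. f x * _ x"])
  have norm_F: "(LINT p|(M \<Otimes>\<^sub>M M). norm (F i p)) \<le> L2_norm M f * L2_norm M g * (L2_norm M (u i) * L2_norm M (v i))"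
    if i: "i \<in> I" for i
  proof -
    have "integrable M (\<lambda>x. complex_of_real (cmod (u i x) * cmod (g x)))"
      "integrable M (\<lambda>x. complex_of_real (cmod (f x) * cmod (v i x)))"
      by (intro integrable_of_real L2_integrable_norm_mult u v f g i)+
    from integrable_pair_mult(2)[OF sf this]
    have "(LINT p|(M \<Otimes>\<^sub>M M). complex_of_real (norm (F i p)))
        = complex_of_real ((LINT x|M. cmod (u i x) * cmod (g x)) * (LINT x|M. cmod (f x) * cmod (v i x)))"
      by (simp add: F_def norm_mult integral_complex_of_real[symmetric])
    then have "(LINT p|(M \<Otimes>\<^sub>M M). norm (F i p)) = (LINT x|M. cmod (u i x) * cmod (g x)) * (LINT x|M. cmod (f x) * cmod (v i x))"
      unfolding integral_complex_of_real of_real_eq_iff .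
    also have "\<dots> \<le> (L2_norm M (u i) * L2_norm M g) * (L2_norm M f * L2_norm M (v i))"
      by (intro mult_mono L2_integral_norm_mult_le u v f g i) auto
    finally show ?thesis by (simp add: mult_ac)
  qed
  have G_int: "integrable (M \<Otimes>\<^sub>M M) G"
  proof (rule Bochner_Integration.integrable_bound)
    show "integrable (M \<Otimes>\<^sub>M M) (\<lambda>p. complex_of_real C * (cnj (g (fst p)) * f (snd p)))"
      using integrable_pair_mult(1)[OF sf integrable_cnj[OF g_int] f_int] by simp
    show "G \<in> borel_measurable (M \<Otimes>\<^sub>M M)" unfolding G_def by measurable
    have C: "C \<ge> 0" by (rule order_trans[OF norm_ge_zero K_bound])
    have "norm (G p) \<le> norm (complex_of_real C * (cnj (g (fst p)) * f (snd p)))" for p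
    proof -
      have "norm (G p) = cmod (K p) * (cmod (g (fst p)) * cmod (f (snd p)))" by (simp add: G_def norm_mult)
      also have "\<dots> \<le> C * (cmod (g (fst p)) * cmod (f (snd p)))" by (intro mult_right_mono K_bound) simp
      also have "\<dots> = norm (complex_of_real C * (cnj (g (fst p)) * f (snd p)))" using C by (simp add: norm_mult)
      finally show ?thesis .
    qed
    then show "AE p in M \<Otimes>\<^sub>M M. norm (G p) \<le> norm (complex_of_real C * (cnj (g (fst p)) * f (snd p)))"
      by (intro AE_I2)
  qed
  have FG: "((\<lambda>i. F i p) has_sum G p) I" if "p \<in> space (M \<Otimes>\<^sub>M M)" for p
  proof -
    have "((\<lambda>i. u i (fst p) * cnj (v i (snd p))) has_sum K p) I"
      using K_sum[of "fst p" "snd p"] that by (auto simp: space_pair_measure)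
    from has_sum_cmult_left[OF this, of "f (snd p) * cnj (g (fst p))"]
    show ?thesis by (simp add: F_def G_def mult_ac)
  qed
  have "((\<lambda>i. integral\<^sup>L (M \<Otimes>\<^sub>M M) (F i)) has_sum integral\<^sup>L (M \<Otimes>\<^sub>M M) G) I"
  proof (rule has_sum_integral_countable[OF I int_F])
    show "AE p in M \<Otimes>\<^sub>M M. ((\<lambda>i. F i p) has_sum G p) I" using FG by (rule AE_I2)
    have "(\<lambda>i. norm (F i p)) summable_on I" if "p \<in> space (M \<Otimes>\<^sub>M M)" for p
      using FG[OF that] unfolding summable_on_iff_abs_summable_on_complex[symmetric] summable_on_def by blast
    then show "AE p in M \<Otimes>\<^sub>M M. (\<lambda>i. norm (F i p)) summable_on I" by (rule AE_I2)
    show "(\<lambda>i. LINT p|(M \<Otimes>\<^sub>M M). norm (F i p)) summable_on I"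
      by (rule summable_on_comparison_test[OF summable_on_cmult_right[OF summable_norms] norm_F]) auto
    show "G \<in> borel_measurable (M \<Otimes>\<^sub>M M)" using G_int by auto
  qed
  then have "((\<lambda>i. L2_inner M f (v i) * L2_inner M (u i) g) has_sum integral\<^sup>L (M \<Otimes>\<^sub>M M) G) I"
    by (simp add: F_eq cong: has_sum_cong)
  also have "integral\<^sup>L (M \<Otimes>\<^sub>M M) G = L2_inner M (\<lambda>t. LINT x|M. K (t, x) * f x) g"
    using P.integral_fst'[OF G_int] by (simp add: G_def L2_inner_def)
  finally show ?thesis .
qed

lemma summable_on_Times_mult:
  fixes f :: "'i \<Rightarrow> real" and g :: "'j \<Rightarrow> real"
  assumes "f summable_on A" "g summable_on B" "\<And>x. x \<in> A \<Longrightarrow> f x \<ge> 0" "\<And>y. y \<in> B \<Longrightarrow> g y \<ge> 0"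
  shows "(\<lambda>(x, y). f x * g y) summable_on A \<times> B"
proof (rule summable_on_SigmaI)
  show "((\<lambda>y. case (x, y) of (x, y) \<Rightarrow> f x * g y) has_sum f x * infsum g B) B" for x
    unfolding prod.case using assms(2) by (intro has_sum_cmult_right has_sum_infsum)
  show "(\<lambda>x. f x * infsum g B) summable_on A" using assms(1) by (rule summable_on_cmult_left)
qed (use assms in auto)

text \<open>A cell has measure at most 1, hence at most the square root of its measure, and
  subadditivity bounds the total. The common endpoints of neighbouring closed cells do no harm to an
  upper bound.\<close>

lemma lmeasurable_if_summable_cells:
  fixes E :: "real set"
  assumes E: "E \<in> sets lebesgue"
    and sum: "(\<lambda>j::int. sqrt (measure lebesgue (E \<inter> {real_of_int j - 1/2 .. real_of_int j + 1/2}))) summable_on UNIV"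
  shows "E \<in> lmeasurable"
proof -
  define c where "c j = E \<inter> {real_of_int j - 1/2 .. real_of_int j + 1/2}" for j
  \<comment> \<open>Each cell is bounded, so \<open>measure\<close> gives its true measure and not
    the default value 0 of sets of infinite measure.\<close>
  have c: "c j \<in> lmeasurable" for j
    unfolding c_def by (intro fmeasurable_Int_fmeasurable[OF _ E, unfolded Int_commute[of _ E]]) auto
  have "measure lebesgue (c j) \<le> sqrt (measure lebesgue (c j))" for j
  proof -
    have "measure lebesgue (c j) \<le> measure lebesgue {real_of_int j - 1/2 .. real_of_int j + 1/2}"
      using c by (intro measure_mono_fmeasurable) (auto simp: c_def)
    then have "measure lebesgue (c j) \<le> 1" by simp
    then have "(measure lebesgue (c j))\<^sup>2 \<le> measure lebesgue (c j)"
      by (simp add: power2_eq_square mult_left_le)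
    then show ?thesis by (rule real_le_rsqrt)
  qed
  then have sum_c: "(\<lambda>j. measure lebesgue (c j)) summable_on UNIV"
    using sum unfolding c_def[symmetric] by (intro summable_on_comparison_test[OF sum[folded c_def]]) auto
  have "(\<lambda>n. measure lebesgue (c (int_decode n))) summable_on UNIV"
    using sum_c summable_on_reindex_bij_betw[OF bij_int_decode, of "\<lambda>j. measure lebesgue (c j)"] by simp
  then have sum_n: "summable (\<lambda>n. measure lebesgue (c (int_decode n)))"
    by (rule summable_on_imp_summable)
  have "E \<subseteq> (\<Union>n. c (int_decode n))"
  proof
    fix x assume x: "x \<in> E"
    have "x \<in> c \<lfloor>x + 1/2\<rfloor>" using x unfolding c_def by simp linarith
    then show "x \<in> (\<Union>n. c (int_decode n))" by (metis UN_I UNIV_I int_encode_inverse)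
  qed
  then have "E = (\<Union>n. c (int_decode n))" by (auto simp: c_def)
  then have "emeasure lebesgue E \<le> (\<Sum>n. emeasure lebesgue (c (int_decode n)))"
    using c emeasure_subadditive_countably[of "\<lambda>n. c (int_decode n)" lebesgue] by (metis fmeasurableD image_subsetI)
  also have "\<dots> = (\<Sum>n. ennreal (measure lebesgue (c (int_decode n))))"
    using emeasure_eq_ennreal_measure[OF fmeasurableD2[OF c]] by (simp only:)
  also have "\<dots> < \<infinity>"
    using ennreal_suminf_neq_top[OF sum_n measure_nonneg] by (simp only: less_top infinity_ennreal_def)
  finally show ?thesis using E by (intro fmeasurableI) auto
qed

section \<open>Functions on E and their extension by zero\<close>

lemma L2_space_lebesgue_on_iff:
  assumes E: "E \<in> sets lebesgue"
  shows "f \<in> L2_space (lebesgue_on E) \<longleftrightarrow> (\<lambda>x. if x \<in> E then f x else 0) \<in> L2_space lebesgue"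
proof -
  have eq: "(\<lambda>x. if x \<in> E then f x else 0) = (\<lambda>x. indicator E x *\<^sub>R f x)"
    "(\<lambda>x. (cmod (if x \<in> E then f x else 0))\<^sup>2) = (\<lambda>x. indicator E x *\<^sub>R (cmod (f x))\<^sup>2)"
    by (auto simp: fun_eq_iff indicator_def)
  show ?thesis
    unfolding L2_space_def mem_Collect_eq eq(2) using E
    by (simp add: eq(1) borel_measurable_restrict_space_iff integrable_restrict_space)
qed

lemma L2_norm_lebesgue_on:
  assumes E: "E \<in> sets lebesgue"
  shows "L2_norm (lebesgue_on E) f = L2_norm lebesgue (\<lambda>x. if x \<in> E then f x else 0)"
proof -
  have "(\<lambda>x. (cmod (if x \<in> E then f x else 0))\<^sup>2) = (\<lambda>x. indicator E x *\<^sub>R (cmod (f x))\<^sup>2)"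
    by (auto simp: fun_eq_iff indicator_def)
  then show ?thesis using E by (simp add: L2_norm_def integral_restrict_space)
qed

lemma extension_by_zero_measurable:
  fixes g :: "'a::euclidean_space \<Rightarrow> complex"
  assumes [measurable]: "E \<in> sets lebesgue" "g \<in> borel_measurable lebesgue"
  shows "(\<lambda>x. if x \<in> E then g x else 0) \<in> borel_measurable lebesgue"
proof -
  have [measurable]: "(indicator E :: 'a \<Rightarrow> complex) \<in> borel_measurable lebesgue"
    by (intro borel_measurable_indicator assms)
  have "(\<lambda>x. if x \<in> E then g x else 0) = (\<lambda>x. indicator E x * g x)" by (auto simp: fun_eq_iff indicator_def)
  then show ?thesis by simp
qed

lemma L2_restrict:
  assumes E: "E \<in> sets lebesgue" and g: "g \<in> L2_space lebesgue"
  shows "g \<in> L2_space (lebesgue_on E)" and "L2_norm (lebesgue_on E) g \<le> L2_norm lebesgue g"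
proof -
  have [measurable]: "(\<lambda>x. if x \<in> E then g x else 0) \<in> borel_measurable lebesgue"
    by (rule extension_by_zero_measurable[OF E L2_spaceD(1)[OF g]])
  have int: "integrable lebesgue (\<lambda>x. (cmod (if x \<in> E then g x else 0))\<^sup>2)"
    by (rule Bochner_Integration.integrable_bound[OF L2_spaceD(2)[OF g]]) auto
  have "(\<lambda>x. if x \<in> E then g x else 0) \<in> L2_space lebesgue" by (rule L2_spaceI[OF _ int]) measurable
  then show "g \<in> L2_space (lebesgue_on E)" unfolding L2_space_lebesgue_on_iff[OF E] .
  show "L2_norm (lebesgue_on E) g \<le> L2_norm lebesgue g"
    unfolding L2_norm_lebesgue_on[OF E] unfolding L2_norm_def
    by (intro real_sqrt_le_mono integral_mono int L2_spaceD(2)[OF g]) auto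
qed

text \<open>Extension by zero is isometric and restriction a contraction, so the operator bound of
  the Plancherel transform carries over.\<close>

lemma truncated_fourier_operator:
  assumes E: "E \<in> sets lebesgue"
  shows "L2_operator (lebesgue_on E) (truncated_fourier E)"
proof -
  have U: "L2_operator lebesgue fourier_plancherel"
    using is_fourier_plancherel by (simp add: is_fourier_plancherel_def L2_unitary_def)
  obtain C where C: "\<And>f. f \<in> L2_space lebesgue \<Longrightarrow> L2_norm lebesgue (fourier_plancherel f) \<le> C * L2_norm lebesgue f"
    using L2_operator_bound[OF U] by blast
  show ?thesis
    unfolding L2_operator_def
  proof (intro conjI ballI allI exI)
    fix f assume "f \<in> L2_space (lebesgue_on E)"
    then have f: "(\<lambda>x. if x \<in> E then f x else 0) \<in> L2_space lebesgue" unfolding L2_space_lebesgue_on_iff[OF E] .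
    show "truncated_fourier E f \<in> L2_space (lebesgue_on E)"
      unfolding truncated_fourier_def by (intro L2_restrict E L2_operatorD(1)[OF U] f)
    show "L2_norm (lebesgue_on E) (truncated_fourier E f) \<le> C * L2_norm (lebesgue_on E) f"
      unfolding truncated_fourier_def L2_norm_lebesgue_on[OF E, of f]
      using L2_restrict(2)[OF E L2_operatorD(1)[OF U f]] C[OF f] by (rule order_trans)
    fix g a b assume "g \<in> L2_space (lebesgue_on E)"
    then have g: "(\<lambda>x. if x \<in> E then g x else 0) \<in> L2_space lebesgue" unfolding L2_space_lebesgue_on_iff[OF E] .
    have eq: "(\<lambda>\<xi>. if \<xi> \<in> E then a * f \<xi> + b * g \<xi> else 0)
        = (\<lambda>\<xi>. a * (if \<xi> \<in> E then f \<xi> else 0) + b * (if \<xi> \<in> E then g \<xi> else 0))" by auto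
    have "AE x in lebesgue. truncated_fourier E (\<lambda>y. a * f y + b * g y) x
        = a * truncated_fourier E f x + b * truncated_fourier E g x"
      unfolding truncated_fourier_def eq by (rule L2_operatorD(2)[OF U f g])
    then show "AE x in lebesgue_on E. truncated_fourier E (\<lambda>y. a * f y + b * g y) x
        = a * truncated_fourier E f x + b * truncated_fourier E g x"
      using E by (subst AE_restrict_space_iff) auto
  qed
qed

definition fourier_kernel :: "real \<times> real \<Rightarrow> complex" where
  "fourier_kernel p = complex_of_real (1 / sqrt (2 * pi)) * exp (\<i> * complex_of_real (fst p * snd p))"

lemma norm_fourier_kernel: "cmod (fourier_kernel p) = 1 / sqrt (2 * pi)"
  unfolding fourier_kernel_def norm_mult norm_iexp norm_of_real by simp

text \<open>On a set of finite measure square-integrable functions are integrable, so the extension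
  by zero falls under the case in which the Plancherel transform is given by the integral.\<close>

lemma truncated_fourier_eq_integral:
  assumes E: "E \<in> lmeasurable" and f: "f \<in> L2_space (lebesgue_on E)"
  shows "(\<lambda>t. LINT x|lebesgue_on E. fourier_kernel (t, x) * f x) \<in> L2_space (lebesgue_on E)"
    and "AE t in lebesgue_on E. truncated_fourier E f t = (LINT x|lebesgue_on E. fourier_kernel (t, x) * f x)"
proof -
  have Es: "E \<in> sets lebesgue" using E by (rule fmeasurableD)
  define h where "h x = (if x \<in> E then f x else 0)" for x
  have h: "h \<in> L2_space lebesgue" using f unfolding h_def[abs_def] L2_space_lebesgue_on_iff[OF Es] .
  have h_scale: "h = (\<lambda>x. indicator E x *\<^sub>R f x)" by (auto simp: h_def fun_eq_iff indicator_def)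
  have "integrable (lebesgue_on E) f"
    using f finite_measure_lebesgue_on[OF E] by (intro L2_integrable_finite_measure)
  then have h_int: "integrable lebesgue h"
    unfolding h_scale using Es by (simp add: integrable_restrict_space)
  have eq: "(LINT x|lebesgue_on E. fourier_kernel (t, x) * f x) = fourier_integral h t" for t
  proof -
    have "(LINT x|lebesgue_on E. fourier_kernel (t, x) * f x) = (LINT x|lebesgue. indicator E x *\<^sub>R (fourier_kernel (t, x) * f x))"
      using Es by (intro integral_restrict_space) simp
    also have "\<dots> = (LINT x|lebesgue. complex_of_real (1 / sqrt (2 * pi)) * (exp (\<i> * complex_of_real (t * x)) * h x))"
      by (intro Bochner_Integration.integral_cong) (auto simp: fourier_kernel_def h_def indicator_def)
    finally show ?thesis by (simp add: fourier_integral_def)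
  qed
  show "(\<lambda>t. LINT x|lebesgue_on E. fourier_kernel (t, x) * f x) \<in> L2_space (lebesgue_on E)"
    unfolding eq by (intro L2_restrict Es fourier_integral_L2 h h_int)
  have "AE t in lebesgue. fourier_plancherel h t = fourier_integral h t"
    using is_fourier_plancherel h h_int by (simp add: is_fourier_plancherel_def)
  then have "AE t in lebesgue. truncated_fourier E f t = fourier_integral h t"
    unfolding truncated_fourier_def h_def[abs_def] .
  then show "AE t in lebesgue_on E. truncated_fourier E f t = (LINT x|lebesgue_on E. fourier_kernel (t, x) * f x)"
    unfolding eq using Es by (subst AE_restrict_space_iff) auto
qed

text \<open>Integrating the squared bound over the interval produces the square root of the cell
  measure that appears in the summability hypothesis.\<close>

lemma L2_cell_bound:
  fixes h :: "real \<Rightarrow> complex"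
  assumes E: "E \<in> sets lebesgue" and h [measurable]: "h \<in> borel_measurable borel" and B: "B \<ge> 0"
    and bound: "\<And>x. cmod (h x) \<le> B * indicator {a..b} x"
  shows "h \<in> L2_space (lebesgue_on E)"
    and "L2_norm (lebesgue_on E) h \<le> B * sqrt (measure lebesgue (E \<inter> {a..b}))"
proof -
  have [measurable]: "h \<in> borel_measurable lebesgue" by (rule measurable_completion) simp
  have [measurable]: "(\<lambda>x. if x \<in> E then h x else 0) \<in> borel_measurable lebesgue"
    by (rule extension_by_zero_measurable[OF E]) measurable
  have Eab: "E \<inter> {a..b} \<in> lmeasurable"
    by (subst Int_commute, rule fmeasurable_Int_fmeasurable[OF _ E]) auto
  have ind: "integrable lebesgue (\<lambda>x. B\<^sup>2 * indicator (E \<inter> {a..b}) x)"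
    using Eab by (intro integrable_mult_right integrable_real_indicator) (auto simp: fmeasurable_def)
  have le: "(cmod (if x \<in> E then h x else 0))\<^sup>2 \<le> B\<^sup>2 * indicator (E \<inter> {a..b}) x" for x
    using power_mono[OF bound[of x] norm_ge_zero, of 2] by (auto simp: indicator_def)
  have int: "integrable lebesgue (\<lambda>x. (cmod (if x \<in> E then h x else 0))\<^sup>2)"
    by (rule Bochner_Integration.integrable_bound[OF ind]) (use le in auto)
  have "(\<lambda>x. if x \<in> E then h x else 0) \<in> L2_space lebesgue" by (rule L2_spaceI[OF _ int]) measurable
  then show "h \<in> L2_space (lebesgue_on E)" unfolding L2_space_lebesgue_on_iff[OF E] .
  have "(LINT x|lebesgue. (cmod (if x \<in> E then h x else 0))\<^sup>2) \<le> (LINT x|lebesgue. B\<^sup>2 * indicator (E \<inter> {a..b}) x)"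
    by (intro integral_mono int ind le)
  also have "\<dots> = B\<^sup>2 * measure lebesgue (E \<inter> {a..b})" using Eab by simp
  finally have "L2_norm (lebesgue_on E) h \<le> sqrt (B\<^sup>2 * measure lebesgue (E \<inter> {a..b}))"
    unfolding L2_norm_lebesgue_on[OF E] unfolding L2_norm_def by (rule real_sqrt_le_mono)
  then show "L2_norm (lebesgue_on E) h \<le> B * sqrt (measure lebesgue (E \<inter> {a..b}))"
    using B by (simp add: real_sqrt_mult)
qed

section \<open>Taylor expansion of the kernel over pairs of cells\<close>

definition cell :: "int \<Rightarrow> real \<Rightarrow> complex" where
  "cell j x = indicator {real_of_int j - 1/2 ..< real_of_int j + 1/2} x"

lemma cell_measurable [measurable]: "cell j \<in> borel_measurable borel"
  unfolding cell_def[abs_def] by measurable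

text \<open>This is why \<open>cell\<close> is half-open: every point lies in exactly one cell,
  whereas the closed cells of the hypothesis share endpoints. Norm bounds then pass to the closed
  cells.\<close>

lemma cell_eq: "cell j x = (if j = \<lfloor>x + 1/2\<rfloor> then 1 else 0)"
proof -
  have "x \<in> {real_of_int j - 1/2 ..< real_of_int j + 1/2} \<longleftrightarrow> \<lfloor>x + 1/2\<rfloor> = j"
    by (auto simp: floor_eq_iff)
  then show ?thesis by (auto simp: cell_def indicator_def)
qed

lemma cell_power_bound:
  "cmod (cell j x * complex_of_real ((x - real_of_int j) ^ n)) \<le> indicator {real_of_int j - 1/2 .. real_of_int j + 1/2} x"
proof (cases "x \<in> {real_of_int j - 1/2 ..< real_of_int j + 1/2}")
  case True
  \<comment> \<open>The distance is in fact at most 1/2; the bound 1 suffices because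
    \<open>1 / fact n\<close> alone is summable.\<close>
  then have "\<bar>x - real_of_int j\<bar> \<le> 1" by auto
  then have "\<bar>x - real_of_int j\<bar> ^ n \<le> 1" by (intro power_le_one) auto
  with True show ?thesis unfolding norm_mult norm_of_real power_abs by (simp add: cell_def)
qed (simp add: cell_def)

text \<open>The normalization and the Taylor coefficient are placed in this factor; its phase
  depends on \<open>t\<close> alone and has modulus 1.\<close>

definition taylor_left :: "int \<times> int \<times> nat \<Rightarrow> real \<Rightarrow> complex" where
  "taylor_left = (\<lambda>(j, k, n) t. complex_of_real (1 / sqrt (2 * pi)) * (\<i> ^ n / fact n) *
     (cell k t * complex_of_real ((t - real_of_int k) ^ n)) *
     exp (\<i> * complex_of_real ((t - real_of_int k) * real_of_int j)))"

text \<open>The phase carries a minus sign because this factor is conjugated in the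
  expansion.\<close>

definition taylor_right :: "int \<times> int \<times> nat \<Rightarrow> real \<Rightarrow> complex" where
  "taylor_right = (\<lambda>(j, k, n) x. (cell j x * complex_of_real ((x - real_of_int j) ^ n)) *
     exp (\<i> * complex_of_real (- (real_of_int k * x))))"

lemma taylor_left_bound:
  "cmod (taylor_left (j, k, n) t) \<le> 1 / fact n * indicator {real_of_int k - 1/2 .. real_of_int k + 1/2} t"
proof -
  have "1 \<le> sqrt (2 * pi)" using pi_gt3 by simp
  then have c: "1 / sqrt (2 * pi) \<le> 1" by simp
  have "cmod (taylor_left (j, k, n) t)
      = 1 / sqrt (2 * pi) * (1 / fact n) * cmod (cell k t * complex_of_real ((t - real_of_int k) ^ n))"
    unfolding taylor_left_def prod.case norm_mult[of _ "exp _"] norm_iexp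
    by (simp add: norm_mult norm_divide norm_power)
  also have "\<dots> \<le> 1 * (1 / fact n) * indicator {real_of_int k - 1/2 .. real_of_int k + 1/2} t"
    by (intro mult_mono c cell_power_bound) auto
  finally show ?thesis by simp
qed

lemma taylor_right_bound:
  "cmod (taylor_right (j, k, n) x) \<le> 1 * indicator {real_of_int j - 1/2 .. real_of_int j + 1/2} x"
  unfolding taylor_right_def prod.case norm_mult[of _ "exp _"] norm_iexp
  using cell_power_bound[of j x n] by simp

lemma taylor_measurable [measurable]:
  "taylor_left i \<in> borel_measurable borel" "taylor_right i \<in> borel_measurable borel"
  unfolding taylor_left_def taylor_right_def by (cases i; simp; measurable)+

text \<open>
  With \<open>j\<close> and \<open>k\<close> the integers nearest to \<open>x\<close> and \<open>t\<close>, use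
  \<open>t x = (t - k) (x - j) + (t - k) j + k x\<close> and expand the exponential of the first summand.
\<close>

lemma taylor_has_sum:
  "((\<lambda>i. taylor_left i t * cnj (taylor_right i x)) has_sum fourier_kernel (t, x)) UNIV"
proof -
  define j where "j = \<lfloor>x + 1/2\<rfloor>"
  define k where "k = \<lfloor>t + 1/2\<rfloor>"
  define z where "z = \<i> * complex_of_real ((t - real_of_int k) * (x - real_of_int j))"
  define A where "A = complex_of_real (1 / sqrt (2 * pi)) *
    (exp (\<i> * complex_of_real ((t - real_of_int k) * real_of_int j)) * exp (\<i> * complex_of_real (real_of_int k * x)))"
  have "(\<lambda>n. z ^ n /\<^sub>R fact n) sums exp z" by (rule exp_converges)
  moreover have "summable (\<lambda>n. norm (z ^ n /\<^sub>R fact n))" by (rule summable_norm_exp)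
  ultimately have "((\<lambda>n. z ^ n /\<^sub>R fact n) has_sum exp z) UNIV" by (intro norm_summable_imp_has_sum)
  then have sum: "((\<lambda>n. A * (z ^ n /\<^sub>R fact n)) has_sum A * exp z) UNIV" by (rule has_sum_cmult_right)
  have "A * exp z = complex_of_real (1 / sqrt (2 * pi)) *
      exp (\<i> * complex_of_real ((t - real_of_int k) * real_of_int j) + \<i> * complex_of_real (real_of_int k * x) + z)"
    by (simp add: A_def exp_add mult.assoc)
  also have "\<i> * complex_of_real ((t - real_of_int k) * real_of_int j) + \<i> * complex_of_real (real_of_int k * x) + z
      = \<i> * complex_of_real (t * x)"
    by (simp add: z_def algebra_simps)
  finally have kernel: "A * exp z = fourier_kernel (t, x)" by (simp add: fourier_kernel_def)
  have term_eq: "taylor_left (j, k, n) t * cnj (taylor_right (j, k, n) x) = A * (z ^ n /\<^sub>R fact n)" for n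
  proof -
    have "cell j x = 1" "cell k t = 1" by (simp_all add: cell_eq j_def k_def)
    moreover have "cnj (exp (\<i> * complex_of_real (- (real_of_int k * x)))) = exp (\<i> * complex_of_real (real_of_int k * x))"
      by (simp add: exp_cnj)
    ultimately show ?thesis
      unfolding taylor_left_def taylor_right_def prod.case complex_cnj_mult
      by (simp add: A_def z_def power_mult_distrib scaleR_conv_of_real divide_inverse mult_ac)
  qed
  have "inj (\<lambda>n :: nat. (j, k, n))" by (simp add: inj_def)
  then have range: "((\<lambda>i. taylor_left i t * cnj (taylor_right i x)) has_sum A * exp z) (range (\<lambda>n. (j, k, n)))"
    using sum by (subst has_sum_reindex) (auto simp: o_def term_eq)
  \<comment> \<open>For fixed \<open>t\<close> and \<open>x\<close> only the cells containing them
    contribute, so the sum over triples is a single Taylor series.\<close>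
  have zero: "taylor_left i t * cnj (taylor_right i x) = 0" if "i \<notin> range (\<lambda>n. (j, k, n))" for i
    using that by (cases i) (auto simp: taylor_left_def taylor_right_def cell_eq j_def k_def)
  have "((\<lambda>i. taylor_left i t * cnj (taylor_right i x)) has_sum A * exp z) (range (\<lambda>n. (j, k, n)))
      \<longleftrightarrow> ((\<lambda>i. taylor_left i t * cnj (taylor_right i x)) has_sum A * exp z) UNIV"
    by (rule has_sum_cong_neutral) (use zero in auto)
  with range show ?thesis by (simp only: kernel)
qed

lemma fourier_kernel_measurable:
  "fourier_kernel \<in> borel_measurable (lebesgue_on E \<Otimes>\<^sub>M lebesgue_on E)"
proof -
  have id: "(\<lambda>x. x) \<in> borel_measurable (lebesgue_on E)"
    by (rule measurable_restrict_space1[OF ident_lebesgue_borel_measurable])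
  have [measurable]: "fst \<in> borel_measurable (lebesgue_on E \<Otimes>\<^sub>M lebesgue_on E)"
    "snd \<in> borel_measurable (lebesgue_on E \<Otimes>\<^sub>M lebesgue_on E)"
    using measurable_comp[OF measurable_fst id] measurable_comp[OF measurable_snd id] by (simp_all add: o_def)
  show ?thesis unfolding fourier_kernel_def[abs_def] by measurable
qed

theorem theorem1p7:
  fixes E :: "real set"
  assumes "E \<in> sets lebesgue"
    and "emeasure lebesgue E > 0"
    and "(\<lambda>j::int. sqrt (measure lebesgue
            (E \<inter> {real_of_int j - 1/2 .. real_of_int j + 1/2}))) summable_on UNIV"
  shows "L2_trace_class (lebesgue_on E) (truncated_fourier E)"
proof -
  let ?M = "lebesgue_on E"
  have E: "E \<in> lmeasurable" using assms(1,3) by (rule lmeasurable_if_summable_cells)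
  define m where "m j = sqrt (measure lebesgue (E \<inter> {real_of_int j - 1/2 .. real_of_int j + 1/2}))" for j :: int
  have m: "m summable_on UNIV" "\<And>j. m j \<ge> 0" using assms(3) by (simp_all add: m_def[abs_def])
  have left: "taylor_left i \<in> L2_space ?M" for i
    by (cases i) (auto intro: L2_cell_bound(1)[OF assms(1) _ _ taylor_left_bound])
  have right: "taylor_right i \<in> L2_space ?M" for i
    by (cases i) (auto intro: L2_cell_bound(1)[OF assms(1) _ _ taylor_right_bound])
  have "(\<lambda>n. 1 / fact n :: real) summable_on UNIV"
    using summable_norm_exp[of "1 :: real"]
    by (intro norm_summable_imp_summable_on) (simp add: inverse_eq_divide)
  then have "(\<lambda>(k, n). m k * (1 / fact n)) summable_on UNIV \<times> (UNIV :: nat set)"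
    by (intro summable_on_Times_mult m) auto
  \<comment> \<open>The majorant is a product of one function of each index, so the triple sum
    splits into two copies of the hypothesis and the exponential series.\<close>
  from summable_on_Times_mult[OF m(1) this] have "(\<lambda>(j, kn). m j * (case kn of (k, n) \<Rightarrow> m k * (1 / fact n))) summable_on UNIV \<times> (UNIV \<times> (UNIV :: nat set))"
    using m(2) by auto
  then have norms: "(\<lambda>i. L2_norm ?M (taylor_left i) * L2_norm ?M (taylor_right i)) summable_on UNIV"
    unfolding UNIV_Times_UNIV
  proof (rule summable_on_comparison_test)
    fix i :: "int \<times> int \<times> nat"
    obtain j k n where i: "i = (j, k, n)" by (cases i)
    have "L2_norm ?M (taylor_left i) \<le> 1 / fact n * m k" "L2_norm ?M (taylor_right i) \<le> 1 * m j"
      unfolding i m_def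
      by (intro L2_cell_bound(2) assms(1) taylor_measurable taylor_left_bound taylor_right_bound; simp)+
    then have "L2_norm ?M (taylor_left i) * L2_norm ?M (taylor_right i) \<le> (1 / fact n * m k) * (1 * m j)"
      using m(2) by (intro mult_mono) auto
    then show "L2_norm ?M (taylor_left i) * L2_norm ?M (taylor_right i)
        \<le> (case i of (j, kn) \<Rightarrow> m j * (case kn of (k, n) \<Rightarrow> m k * (1 / fact n)))"
      by (simp add: i mult_ac)
  qed simp
  have expansion: "((\<lambda>i. L2_inner ?M f (taylor_right i) * L2_inner ?M (taylor_left i) g) has_sum
      L2_inner ?M (truncated_fourier E f) g) UNIV"
    if f: "f \<in> L2_space ?M" and g: "g \<in> L2_space ?M" for f g
  proof -
    have "((\<lambda>i. L2_inner ?M f (taylor_right i) * L2_inner ?M (taylor_left i) g) has_sum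
        L2_inner ?M (\<lambda>t. LINT x|?M. fourier_kernel (t, x) * f x) g) UNIV"
      by (rule L2_kernel_has_sum[OF finite_measure_lebesgue_on[OF E] _ left right norms
            fourier_kernel_measurable, of "1 / sqrt (2 * pi)"])
         (auto simp: norm_fourier_kernel taylor_has_sum f g)
    also have "L2_inner ?M (\<lambda>t. LINT x|?M. fourier_kernel (t, x) * f x) g = L2_inner ?M (truncated_fourier E f) g"
      using truncated_fourier_eq_integral[OF E f] f g
      by (intro L2_inner_cong_AE L2_operatorD(1)[OF truncated_fourier_operator[OF assms(1)]]) auto
    finally show ?thesis .
  qed
  interpret L2_nuclear ?M "truncated_fourier E" UNIV taylor_left taylor_right
    by (rule L2_nuclear.intro)
       (simp_all add: truncated_fourier_operator assms(1) left right norms expansion)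
  show ?thesis by (rule trace_class)
qed

end
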